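(* Suppose that $n$ is even (and positive) and $\mathcal{A}$ is a cluster algebra of type $A_n$, $B_n$, or $C_n$ with no frozen variables. Then $\mathcal{C}_{\mathcal{A}}$ is a pointed simplicial cone with rays generated by $\widetilde v(l)$ as $l$ ranges over all diagonals and edges of $\mathbf{P}_N$ of non-maximal length.
   Context: **Gröbner cone.** Cluster algebras are over a field $\mathbb{K}$ of characteristic zero. For $\mathcal{A}$ of finite cluster type without frozen variables, with set of cluster variables $\mathcal{V}$, let $I_{\mathcal{A}}$ be the kernel of $\mathbb{K}[z_v\mid v\in\mathcal{V}]\to\mathcal{A}$, $z_v\mapsto v$, and $I_{\mathcal{A}}^{\times}$ the ideal generated by all $z_vz_w$ with $v,w\in\mathcal{V}$ not in a common cluster. For $\omega\in\mathbb{R}^{\mathcal{V}}$, $\mathrm{In}_\omega(f)$ is the sum of the terms of $f$ of maximal $\omega$-weight and $\mathrm{In}_\omega(I)=\langle\mathrm{In}_\omega(f):f\in I\rangle$. $\mathcal{C}_{\mathcal{A}}$ is the closure of $\{\omega\in\mathbb{R}^{\mathcal{V}}:\mathrm{In}_\omega(I_{\mathcal{A}})=I_{\mathcal{A}}^{\times}\}$. **Polygon models (Fomin–Zelevinsky).** $\mathbf{P}_N$ is a regular $N$-gon with vertices $1,\dots,N$ (modulo $N$) labeled counterclockwise; $[i,j]$ is the edge or diagonal with endpoints $i,j$. For $N$ even, $\overline i$ is the vertex antipodal to $i$, $\overline{[i,j]}=[\overline i,\overline j]$, and a diameter is a diagonal $[i,\overline i]$. Type $A_n$, $N=n+3$: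 cluster variables $x_l$ correspond to diagonals $l$ of $\mathbf{P}_N$, clusters to triangulations, exchange relations are $x_{[a,c]}x_{[b,d]}=x_{[a,b]}x_{[c,d]}+x_{[a,d]}x_{[b,c]}$ for crossing diagonals $[a,c],[b,d]$. Types $B_n,C_n$, $N=2n+2$: cluster variables $x_l=x_{\overline l}$ correspond to diagonal pairs $\{l,\overline l\}$ (diameters being degenerate pairs), clusters to centrally symmetric triangulations. With $r=1$ for $B_n$, $r=2$ for $C_n$, exchange relations are: $x_{[a,c]}x_{[b,d]}=x_{[a,b]}x_{[c,d]}+x_{[a,d]}x_{[b,c]}$ for $a,b,c,d,\overline a$ in counterclockwise order; $x_{[a,c]}x_{[a,\overline b]}=x_{[a,b]}x_{[a,\overline c]}+x_{[a,\overline a]}^{2/r}x_{[b,c]}$ for $a,b,c,\overline a$ in counterclockwise order; $x_{[a,\overline a]}x_{[b,\overline b]}=x_{[a,b]}^r+x_{[a,\overline b]}^r$ for $b\neq a,\overline a$. In all these relations $x_l:=1$ when $l$ is an edge of $\mathbf{P}_N$ (no frozen variables). **Ambient space.** Let $\mathcal{W}$ be the set of edges (type $A_n$) resp. pairs of edges $\{l,\overline l\}$ (types $B_n,C_n$) of $\mathbf{P}_N$. $\mathbb{R}^{\mathcal{V}}$ is identified with the subspace of $\mathbb{R}^{\mathcal{V}\cup\mathcal{W}}$ where all $\mathcal{W}$-coordinates vanish, and $\mathcal{C}_{\mathcal{A}}$ is regarded as a subset of $\mathbb{R}^{\mathcal{V}\cup\mathcal{W}}$. Standard basis vectors are $e_l$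 (type $A_n$) resp. $e_{\{l,\overline l\}}$ (types $B_n,C_n$; $e_l$ for a diameter). **Vectors.** The length $\mathrm{len}(l)$ of $l=[i,j]$ is the number of edges in a shortest boundary path (arc) between $i$ and $j$; if the arcs have different lengths the shorter is the minor arc; $l$ is of non-maximal length if $\mathrm{len}(l)<\lfloor N/2\rfloor$; $l$ is even/odd if $\mathrm{len}(l)$ is. $\delta_-(l),\delta_+(l)$ are the first and last vertices of the minor arc of a non-diameter $l$ in counterclockwise order. For $l$ of non-maximal length, $F_l$ is the set of all diagonals and edges with both endpoints on the minor arc of $l$, and $v(l)=-\sum_{k\in F_l}e_k$ (type $A_n$), $v(l)=-\sum_{k\in F_l}e_{\{k,\overline k\}}$ (types $B_n,C_n$). For a vertex $i$: in type $A_n$, $E_i=\sum e_l$ over all edges and diagonals $l$ incident to $i$; in type $B_n$, $E_i=e_{[i,\overline i]}+\sum e_L$, and in type $C_n$, $E_i=2e_{[i,\overline i]}+\sum e_L$, the sums over all non-diameter diagonal pairs and edge pairs $L=\{l,\overline l\}$ with $i$ an endpoint of $l$ or $\overline l$. Set $E=\sum_{i=1}^NE_i$ and, for $l$ not a diameter, $$E(l)=\sum_{k=1}^{\lfloor\mathrm{len}(l)/2\rfloor}E_{\delta_-(l)+2k-1},\qquad \overline E(l)=\sum_{k=1}^{\lfloor(N-\mathrm{len}(l))/2\rfloor}E_{\delta_+(l)+2k-1}.$$ For $n$ even and $l$ of non-maximal length: $\widetilde v(l)=v(l)+E(l)$ if $l$ is even; $\widetilde v(l)=v(l)+\frac12E-\overline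 E(l)$ if $l$ is odd in type $A_n$; $\widetilde v(l)=v(l)+\frac14E-E([\delta_+(l),\overline{\delta_-(l)}])$ if $l$ is odd in type $B_n$ or $C_n$. *)

theory Defs
  imports "HOL-Analysis.Analysis" "HOL-Analysis.Finite_Function_Topology" "HOL-Algebra.Ideal"
begin

text \<open>Polynomials with coefficients in \<open>'k\<close> and variables indexed by \<open>'v\<close>: finitely supported
  maps from exponent vectors to coefficients, with the convolution product of
  \<open>HOL-Library.Poly_Mapping\<close>.\<close>

type_synonym ('v, 'k) mpoly = "('v \<Rightarrow>\<^sub>0 nat) \<Rightarrow>\<^sub>0 'k"

definition var :: "'v \<Rightarrow> ('v, 'k::comm_ring_1) mpoly" where
  "var v = Poly_Mapping.single (Poly_Mapping.single v 1) 1"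

definition mpoly_ring :: "'v set \<Rightarrow> ('v, 'k::comm_ring_1) mpoly ring" where
  "mpoly_ring V =
     \<lparr>carrier = {p. \<forall>m\<in>Poly_Mapping.keys p. Poly_Mapping.keys m \<subseteq> V},
      monoid.mult = (*), one = 1, zero = 0, add = (+)\<rparr>"

definition field_embedding :: "('k::field \<Rightarrow> 'f::field) \<Rightarrow> bool" where
  "field_embedding \<iota> \<longleftrightarrow>
     \<iota> 1 = 1 \<and> (\<forall>a b. \<iota> (a + b) = \<iota> a + \<iota> b) \<and> (\<forall>a b. \<iota> (a * b) = \<iota> a * \<iota> b)"

definition peval :: "('k::field \<Rightarrow> 'f::field) \<Rightarrow> ('v \<Rightarrow> 'f) \<Rightarrow> ('v, 'k) mpoly \<Rightarrow> 'f" where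
  "peval \<iota> x p = (\<Sum>m\<in>Poly_Mapping.keys p. \<iota> (Poly_Mapping.lookup p m) *
     (\<Prod>v\<in>Poly_Mapping.keys m. x v ^ Poly_Mapping.lookup m v))"


section \<open>Cluster algebras without frozen variables\<close>

text \<open>A labeled seed of rank \<open>n\<close> is a cluster \<open>x 0, \<dots>, x (n - 1)\<close> in the ambient field \<open>'f\<close>
  together with an exchange matrix; only indices below \<open>n\<close> matter.\<close>

type_synonym 'f seed = "(nat \<Rightarrow> 'f) \<times> (nat \<Rightarrow> nat \<Rightarrow> int)"

definition free_generating :: "('k::field \<Rightarrow> 'f::field) \<Rightarrow> nat \<Rightarrow> (nat \<Rightarrow> 'f) \<Rightarrow> bool" where
  "free_generating \<iota> n x \<longleftrightarrow>
     (\<forall>p\<in>carrier (mpoly_ring {..<n}). peval \<iota> x p = 0 \<longrightarrow> p = 0) \<and>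
     (\<forall>y. \<exists>p\<in>carrier (mpoly_ring {..<n}). \<exists>q\<in>carrier (mpoly_ring {..<n}).
        peval \<iota> x q \<noteq> 0 \<and> y = peval \<iota> x p / peval \<iota> x q)"

definition skew_symmetrizable :: "nat \<Rightarrow> (nat \<Rightarrow> nat \<Rightarrow> int) \<Rightarrow> bool" where
  "skew_symmetrizable n B \<longleftrightarrow>
     (\<exists>d::nat \<Rightarrow> int. (\<forall>i<n. d i > 0) \<and> (\<forall>i<n. \<forall>j<n. d i * B i j = - (d j * B j i)))"

definition is_seed :: "('k::field \<Rightarrow> 'f::field) \<Rightarrow> nat \<Rightarrow> 'f seed \<Rightarrow> bool" where
  "is_seed \<iota> n S \<longleftrightarrow> free_generating \<iota> n (fst S) \<and> skew_symmetrizable n (snd S)"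

text \<open>Column convention: the entries \<open>B i k\<close> are the exponents in the exchange relation for \<open>x k\<close>.\<close>

definition mutate_cluster :: "nat \<Rightarrow> nat \<Rightarrow> 'f::field seed \<Rightarrow> nat \<Rightarrow> 'f" where
  "mutate_cluster n k S = (case S of (x, B) \<Rightarrow>
     x(k := ((\<Prod>i<n. x i ^ nat (B i k)) + (\<Prod>i<n. x i ^ nat (- B i k))) / x k))"

definition mutate_matrix :: "nat \<Rightarrow> (nat \<Rightarrow> nat \<Rightarrow> int) \<Rightarrow> nat \<Rightarrow> nat \<Rightarrow> int" where
  "mutate_matrix k B = (\<lambda>i j. if i = k \<or> j = k then - B i j
     else B i j + sgn (B i k) * max 0 (B i k * B k j))"

inductive_set seeds :: "nat \<Rightarrow> 'f::field seed \<Rightarrow> 'f seed set"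
  for n :: nat and S :: "'f seed" where
  initial: "S \<in> seeds n S"
| mutation: "S' \<in> seeds n S \<Longrightarrow> k < n \<Longrightarrow>
    (mutate_cluster n k S', mutate_matrix k (snd S')) \<in> seeds n S"

definition clusters :: "nat \<Rightarrow> 'f::field seed \<Rightarrow> 'f set set" where
  "clusters n S = {fst S' ` {..<n} | S'. S' \<in> seeds n S}"

definition cluster_variables :: "nat \<Rightarrow> 'f::field seed \<Rightarrow> 'f set" where
  "cluster_variables n S = \<Union> (clusters n S)"

datatype dynkin = Type_A | Type_B | Type_C

text \<open>Cartan matrices for \<open>n \<ge> 2\<close>, rows and columns numbered from 0, with
  \<open>a\<^sub>i\<^sub>j = 2 (\<alpha>\<^sub>i, \<alpha>\<^sub>j) / (\<alpha>\<^sub>i, \<alpha>\<^sub>i)\<close>, so that the last simple root is short in type B and long in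
  type C.\<close>

definition cartan :: "dynkin \<Rightarrow> nat \<Rightarrow> nat \<Rightarrow> nat \<Rightarrow> int" where
  "cartan X n i j =
     (if i = j then 2
      else if j \<noteq> Suc i \<and> i \<noteq> Suc j then 0
      else if X = Type_B \<and> i = n - 1 then -2
      else if X = Type_C \<and> j = n - 1 then -2
      else -1)"

definition cartan_counterpart :: "(nat \<Rightarrow> nat \<Rightarrow> int) \<Rightarrow> nat \<Rightarrow> nat \<Rightarrow> int" where
  "cartan_counterpart B i j = (if i = j then 2 else - \<bar>B i j\<bar>)"

definition has_type :: "dynkin \<Rightarrow> nat \<Rightarrow> 'f::field seed \<Rightarrow> bool" where
  "has_type X n S \<longleftrightarrow> (\<exists>S'\<in>seeds n S. \<exists>\<sigma>. bij_betw \<sigma> {..<n} {..<n} \<and>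
     (\<forall>i<n. \<forall>j<n. cartan_counterpart (snd S') (\<sigma> i) (\<sigma> j) = cartan X n i j))"


section \<open>The Groebner cone\<close>

text \<open>The variables of the polynomial ring are the cluster variables themselves, that is, elements
  of the ambient field, so the presentation sends the variable of \<open>v\<close> to \<open>v\<close>. Its kernel is the
  same whether the codomain is the cluster algebra or the ambient field.\<close>

definition relation_ideal :: "('k::field \<Rightarrow> 'f::field) \<Rightarrow> 'f set \<Rightarrow> ('f, 'k) mpoly set" where
  "relation_ideal \<iota> V = {f \<in> carrier (mpoly_ring V). peval \<iota> (\<lambda>v. v) f = 0}"

definition incompatibility_ideal :: "'v set \<Rightarrow> 'v set set \<Rightarrow> ('v, 'k::field) mpoly set" where
  "incompatibility_ideal V Cl =
     Idl\<^bsub>mpoly_ring V\<^esub> {var v * var w | v w. v \<in> V \<and> w \<in> V \<and> \<not> (\<exists>c\<in>Cl. v \<in> c \<and> w \<in> c)}"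

definition weight :: "('v \<Rightarrow>\<^sub>0 real) \<Rightarrow> ('v \<Rightarrow>\<^sub>0 nat) \<Rightarrow> real" where
  "weight \<omega> m =
     (\<Sum>v\<in>Poly_Mapping.keys m. Poly_Mapping.lookup \<omega> v * real (Poly_Mapping.lookup m v))"

definition initial_form :: "('v \<Rightarrow>\<^sub>0 real) \<Rightarrow> ('v, 'k::field) mpoly \<Rightarrow> ('v, 'k) mpoly" where
  "initial_form \<omega> f =
     (\<Sum>m | m \<in> Poly_Mapping.keys f \<and> (\<forall>m'\<in>Poly_Mapping.keys f. weight \<omega> m' \<le> weight \<omega> m).
        Poly_Mapping.single m (Poly_Mapping.lookup f m))"

definition initial_ideal ::
    "'v set \<Rightarrow> ('v \<Rightarrow>\<^sub>0 real) \<Rightarrow> ('v, 'k::field) mpoly set \<Rightarrow> ('v, 'k) mpoly set" where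
  "initial_ideal V \<omega> I = Idl\<^bsub>mpoly_ring V\<^esub> (initial_form \<omega> ` I)"

text \<open>For finite \<open>V\<close>, the vectors supported in \<open>V\<close> form a closed finite-dimensional subspace
  of \<open>'f \<Rightarrow>\<^sub>0 real\<close>, on which the norm topology is the usual one.\<close>

definition groebner_cone :: "('k::field \<Rightarrow> 'f::field) \<Rightarrow> nat \<Rightarrow> 'f seed \<Rightarrow> ('f \<Rightarrow>\<^sub>0 real) set" where
  "groebner_cone \<iota> n S = (let V = cluster_variables n S in
     closure {\<omega>. Poly_Mapping.keys \<omega> \<subseteq> V \<and>
       initial_ideal V \<omega> (relation_ideal \<iota> V) = incompatibility_ideal V (clusters n S)})"


section \<open>The polygon\<close>

text \<open>The vertices are \<open>0, \<dots>, N - 1\<close> in counterclockwise order, vertex \<open>0\<close> being the vertex \<open>N\<close>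
  of the labeling by \<open>1, \<dots>, N\<close>. A segment (edge or diagonal) is the set of its endpoints.\<close>

definition polygon_size :: "dynkin \<Rightarrow> nat \<Rightarrow> nat" where
  "polygon_size X n = (if X = Type_A then n + 3 else 2 * n + 2)"

definition segments :: "nat \<Rightarrow> nat set set" where
  "segments N = {{i, j} | i j. i < N \<and> j < N \<and> i \<noteq> j}"

definition edges :: "nat \<Rightarrow> nat set set" where
  "edges N = {{i, (i + 1) mod N} | i. i < N}"

definition diagonals :: "nat \<Rightarrow> nat set set" where
  "diagonals N = segments N - edges N"

definition antipode :: "nat \<Rightarrow> nat \<Rightarrow> nat" where
  "antipode N i = (i + N div 2) mod N"

text \<open>Number of edges on the boundary path going counterclockwise from \<open>i\<close> to \<open>j\<close>.\<close>

definition arc :: "nat \<Rightarrow> nat \<Rightarrow> nat \<Rightarrow> nat" where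
  "arc N i j = (j + N - i) mod N"

definition ccw :: "nat \<Rightarrow> nat list \<Rightarrow> bool" where
  "ccw N vs \<longleftrightarrow> set vs \<subseteq> {..<N} \<and> sorted_wrt (<) (map (arc N (hd vs)) vs)"

definition crosses :: "nat \<Rightarrow> nat set \<Rightarrow> nat set \<Rightarrow> bool" where
  "crosses N l m \<longleftrightarrow> (\<exists>a b c d. ccw N [a, b, c, d] \<and> l = {a, c} \<and> m = {b, d})"

definition triangulation :: "nat \<Rightarrow> nat set set \<Rightarrow> bool" where
  "triangulation N T \<longleftrightarrow> T \<subseteq> diagonals N \<and> (\<forall>l\<in>T. \<forall>m\<in>T. \<not> crosses N l m) \<and>
     (\<forall>l \<in> diagonals N - T. \<exists>m\<in>T. crosses N l m)"

definition type_triangulation :: "dynkin \<Rightarrow> nat \<Rightarrow> nat set set \<Rightarrow> bool" where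
  "type_triangulation X n T \<longleftrightarrow> (let N = polygon_size X n in
     triangulation N T \<and> (X \<noteq> Type_A \<longrightarrow> (\<lambda>l. antipode N ` l) ` T = T))"

text \<open>The index of a segment \<open>l\<close> is \<open>{l}\<close> in type A and the antipodal pair in types B and C (a
  singleton if \<open>l\<close> is a diameter). \<open>diag_labels\<close> and \<open>edge_labels\<close> index the coordinates of
  cluster variables and of edges, respectively.\<close>

definition label :: "dynkin \<Rightarrow> nat \<Rightarrow> nat set \<Rightarrow> nat set set" where
  "label X n l = (if X = Type_A then {l} else {l, antipode (polygon_size X n) ` l})"

definition diag_labels :: "dynkin \<Rightarrow> nat \<Rightarrow> nat set set set" where
  "diag_labels X n = label X n ` diagonals (polygon_size X n)"

definition edge_labels :: "dynkin \<Rightarrow> nat \<Rightarrow> nat set set set" where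
  "edge_labels X n = label X n ` edges (polygon_size X n)"

definition exchange_relations :: "dynkin \<Rightarrow> nat \<Rightarrow> (nat set set \<Rightarrow> 'f::field) \<Rightarrow> bool" where
  "exchange_relations X n x \<longleftrightarrow>
    (let N = polygon_size X n;
         y = (\<lambda>i j. x (label X n {i, j}));
         bar = antipode N;
         r = (if X = Type_B then 1 else 2 :: nat)
     in if X = Type_A then
       (\<forall>a b c d. ccw N [a, b, c, d] \<longrightarrow> y a c * y b d = y a b * y c d + y a d * y b c)
     else
       (\<forall>a b c d. ccw N [a, b, c, d, bar a] \<longrightarrow> y a c * y b d = y a b * y c d + y a d * y b c) \<and>
       (\<forall>a b c. ccw N [a, b, c, bar a] \<longrightarrow>
          y a c * y a (bar b) = y a b * y a (bar c) + y a (bar a) ^ (2 div r) * y b c) \<and>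
       (\<forall>a b. a < N \<and> b < N \<and> b \<noteq> a \<and> b \<noteq> bar a \<longrightarrow>
          y a (bar a) * y b (bar b) = y a b ^ r + y a (bar b) ^ r))"

text \<open>An identification of the cluster variables with the diagonals (or antipodal pairs of
  diagonals) of the polygon: \<open>x L\<close> is the cluster variable with index \<open>L\<close>.\<close>

definition polygon_model :: "dynkin \<Rightarrow> nat \<Rightarrow> 'f::field seed \<Rightarrow> (nat set set \<Rightarrow> 'f) \<Rightarrow> bool" where
  "polygon_model X n S x \<longleftrightarrow>
     bij_betw x (diag_labels X n) (cluster_variables n S) \<and>
     (\<forall>L\<in>edge_labels X n. x L = 1) \<and>
     clusters n S = {(\<lambda>l. x (label X n l)) ` T | T. type_triangulation X n T} \<and>
     exchange_relations X n x"


section \<open>Vectors\<close>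

text \<open>The space with coordinates indexed by \<open>diag_labels\<close> and \<open>edge_labels\<close> is realised inside the
  space of all finitely supported real functions on indices.\<close>

type_synonym lvec = "nat set set \<Rightarrow>\<^sub>0 real"

definition basis_vec :: "nat set set \<Rightarrow> lvec" where
  "basis_vec L = Poly_Mapping.single L 1"

definition relabel ::
    "dynkin \<Rightarrow> nat \<Rightarrow> (nat set set \<Rightarrow> 'f::field) \<Rightarrow> ('f \<Rightarrow>\<^sub>0 real) \<Rightarrow> lvec" where
  "relabel X n x \<omega> = (\<Sum>L\<in>diag_labels X n. Poly_Mapping.lookup \<omega> (x L) *\<^sub>R basis_vec L)"

definition len :: "nat \<Rightarrow> nat set \<Rightarrow> nat" where
  "len N l = Min {arc N i j | i j. i \<in> l \<and> j \<in> l \<and> i \<noteq> j}"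

definition nonmaximal :: "nat \<Rightarrow> nat set set" where
  "nonmaximal N = {l \<in> segments N. len N l < N div 2}"

definition delta_minus :: "nat \<Rightarrow> nat set \<Rightarrow> nat" where
  "delta_minus N l = (THE i. i \<in> l \<and> (\<exists>j\<in>l. arc N i j < arc N j i))"

definition delta_plus :: "nat \<Rightarrow> nat set \<Rightarrow> nat" where
  "delta_plus N l = (THE j. j \<in> l \<and> (\<exists>i\<in>l. arc N i j < arc N j i))"

definition minor_arc :: "nat \<Rightarrow> nat set \<Rightarrow> nat set" where
  "minor_arc N l = {(delta_minus N l + k) mod N | k. k \<le> len N l}"

definition F_set :: "nat \<Rightarrow> nat set \<Rightarrow> nat set set" where
  "F_set N l = {m \<in> segments N. m \<subseteq> minor_arc N l}"

definition v_vec :: "dynkin \<Rightarrow> nat \<Rightarrow> nat set \<Rightarrow> lvec" where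
  "v_vec X n l = - (\<Sum>m\<in>F_set (polygon_size X n) l. basis_vec (label X n m))"

definition E_vertex :: "dynkin \<Rightarrow> nat \<Rightarrow> nat \<Rightarrow> lvec" where
  "E_vertex X n i =
    (let N = polygon_size X n; diameter = {i, antipode N i}
     in if X = Type_A then (\<Sum>l | l \<in> segments N \<and> i \<in> l. basis_vec (label X n l))
     else (if X = Type_B then 1 else 2) *\<^sub>R basis_vec (label X n diameter) +
       (\<Sum>L | L \<in> label X n ` {l \<in> segments N. 2 * len N l \<noteq> N} \<and> i \<in> \<Union> L. basis_vec L))"

definition E_total :: "dynkin \<Rightarrow> nat \<Rightarrow> lvec" where
  "E_total X n = (\<Sum>i<polygon_size X n. E_vertex X n i)"

definition E_seg :: "dynkin \<Rightarrow> nat \<Rightarrow> nat set \<Rightarrow> lvec" where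
  "E_seg X n l = (let N = polygon_size X n in
     (\<Sum>k = 1..len N l div 2. E_vertex X n ((delta_minus N l + 2 * k - 1) mod N)))"

definition E_bar :: "dynkin \<Rightarrow> nat \<Rightarrow> nat set \<Rightarrow> lvec" where
  "E_bar X n l = (let N = polygon_size X n in
     (\<Sum>k = 1..(N - len N l) div 2. E_vertex X n ((delta_plus N l + 2 * k - 1) mod N)))"

definition v_tilde :: "dynkin \<Rightarrow> nat \<Rightarrow> nat set \<Rightarrow> lvec" where
  "v_tilde X n l =
    (let N = polygon_size X n
     in if even (len N l) then v_vec X n l + E_seg X n l
     else if X = Type_A then v_vec X n l + (1/2) *\<^sub>R E_total X n - E_bar X n l
     else v_vec X n l + (1/4) *\<^sub>R E_total X n
            - E_seg X n {delta_plus N l, antipode N (delta_minus N l)})"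


section \<open>Cones\<close>

definition pointed :: "'a::real_vector set \<Rightarrow> bool" where
  "pointed C \<longleftrightarrow> C \<inter> uminus ` C = {0}"

definition simplicial_cone_generated_by :: "'a::real_vector set \<Rightarrow> 'a set \<Rightarrow> bool" where
  "simplicial_cone_generated_by C R \<longleftrightarrow> finite R \<and> independent R \<and> C = convex_cone hull R"

end

theory Submission
  imports Defs
begin

text \<open>Write \<open>W i j\<close> for the weight of the segment from \<open>i\<close> to \<open>j\<close>, with edges of weight \<open>0\<close> and
  diameters counted twice in type B. The open Groebner cone consists of the \<open>\<omega>\<close> satisfying the Monge
  inequalities \<open>W i (j + 1) + W (i + 1) j < W i j + W (i + 1) (j + 1)\<close>. They are necessary because
  they come from exchange relations. Conversely, adding them up, every product of two incompatible
  variables strictly dominates the other terms of a relation for it, so that every incompatible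
  product is an initial form. An initial form of a relation cannot consist of compatible monomials: written as Laurent polynomials in the cluster of a
  leading compatible monomial, the other terms have smaller weight, and the cluster is algebraically
  independent.

  Each Monge functional belongs to a pair of polygon edges. On \<open>v_tilde\<close> it counts the
  symmetries that move this pair to the two edges adjacent to the minor arc of \<open>l\<close>, because the vectors
  \<open>E\<close> lie in the kernel of all Monge functionals and only cancel the edge coordinates. As \<open>n\<close> is
  even, the common kernel of the Monge functionals is trivial, so that the \<open>v_tilde\<close> form a basis
  dual to them up to positive factors.\<close>

section \<open>Polynomials as finitely supported maps\<close>

text \<open>That an incompatible variable has small weight in its Laurent expansion is proved by
  induction on its crossing number with a triangulation, so every relation has to control weights
  and crossing numbers at once. In types A and C the full Ptolemy relations serve; in type C they
  come from the exchange relations by writing segments as 2x2 minors. Type B is the obstacle: two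
  diagonals whose orbits cross twice need a relation with an extra term of coefficient 2, and a
  diameter occurs squared in some relations and linearly in others. Hence diameters count double in
  weights, whereas in crossing numbers the other diagonals count double. Evenness of
  \<open>n\<close> enters twice. A common zero of the Monge functionals changes sign under rotation
  by one step, and a symmetry is reached after an odd number of steps. The same parity gives either
  the minor arc or a complementary arc an even number of edges, so that every second vertex of it
  covers each of its edges once; this cancels the edge coordinates. Segments exchanged by the
  half-turn give the same vector, so the rays correspond to orbits of segments.\<close>

definition mono_eval :: "('v \<Rightarrow> 'f::field) \<Rightarrow> ('v \<Rightarrow>\<^sub>0 nat) \<Rightarrow> 'f" where
  "mono_eval x m = (\<Prod>v\<in>Poly_Mapping.keys m. x v ^ Poly_Mapping.lookup m v)"

lemma mono_eval_superset:
  assumes "finite A" "Poly_Mapping.keys m \<subseteq> A"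
  shows "mono_eval x m = (\<Prod>v\<in>A. x v ^ Poly_Mapping.lookup m v)"
  unfolding mono_eval_def using assms
  by (intro prod.mono_neutral_left) (auto simp: in_keys_iff)

lemma keys_add_nat: "Poly_Mapping.keys (m + k) = Poly_Mapping.keys m \<union> Poly_Mapping.keys (k :: 'v \<Rightarrow>\<^sub>0 nat)"
  by (auto simp: in_keys_iff lookup_add)

lemma mono_eval_add: "mono_eval x (m + k) = mono_eval x m * mono_eval x k"
proof -
  let ?A = "Poly_Mapping.keys m \<union> Poly_Mapping.keys k"
  show ?thesis
    by (simp add: mono_eval_superset[of ?A] keys_add_nat lookup_add power_add prod.distrib)
qed

lemma mono_eval_zero [simp]: "mono_eval x 0 = 1"
  by (simp add: mono_eval_def)

lemma mono_eval_single [simp]: "mono_eval x (Poly_Mapping.single v k) = x v ^ k"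
  by (simp add: mono_eval_def)

lemma sum_singles:
  assumes "finite A" "Poly_Mapping.keys p \<subseteq> A"
  shows "(\<Sum>m\<in>A. Poly_Mapping.single m (Poly_Mapping.lookup p m)) = p"
proof (rule poly_mapping_eqI)
  fix k
  have "Poly_Mapping.lookup (\<Sum>m\<in>A. Poly_Mapping.single m (Poly_Mapping.lookup p m)) k
      = (\<Sum>m\<in>A. if m = k then Poly_Mapping.lookup p k else 0)"
    unfolding lookup_sum by (intro sum.cong) (auto simp: lookup_single when_def)
  also have "\<dots> = Poly_Mapping.lookup p k"
    using assms by (auto simp: in_keys_iff)
  finally show "Poly_Mapping.lookup (\<Sum>m\<in>A. Poly_Mapping.single m (Poly_Mapping.lookup p m)) k
      = Poly_Mapping.lookup p k" .
qed

lemma single_nonneg_decomp: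
  assumes "k \<le> Poly_Mapping.lookup m v"
  shows "\<exists>m' :: 'v \<Rightarrow>\<^sub>0 nat. m = Poly_Mapping.single v k + m'"
proof
  show "m = Poly_Mapping.single v k + (m - Poly_Mapping.single v k)"
    using assms by (intro poly_mapping_eqI) (auto simp: lookup_add lookup_minus lookup_single when_def)
qed

lemma exponent_decomp:
  fixes m :: "'v \<Rightarrow>\<^sub>0 nat"
  assumes "v \<in> Poly_Mapping.keys m"
  obtains m' where "m = Poly_Mapping.single v 1 + m'"
  using single_nonneg_decomp[of 1 m v] assms by (auto simp: in_keys_iff)

lemma exponent_induct [case_names zero add]:
  fixes m :: "'v \<Rightarrow>\<^sub>0 nat"
  assumes "P 0" and "\<And>v m. P m \<Longrightarrow> P (Poly_Mapping.single v 1 + m)"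
  shows "P m"
proof -
  \<comment> \<open>Induction on the total degree \<open>n\<close>.\<close>
  have "\<forall>m :: 'v \<Rightarrow>\<^sub>0 nat. (\<Sum>v\<in>Poly_Mapping.keys m. Poly_Mapping.lookup m v) = n \<longrightarrow> P m" for n
  proof (induction n)
    case 0
    have "m = 0" if "(\<Sum>v\<in>Poly_Mapping.keys m. Poly_Mapping.lookup m v) = 0" for m :: "'v \<Rightarrow>\<^sub>0 nat"
      using that by (auto simp: in_keys_iff intro!: poly_mapping_eqI)
    then show ?case using assms(1) by blast
  next
    case (Suc n)
    show ?case
    proof (intro allI impI)
      fix m :: "'v \<Rightarrow>\<^sub>0 nat" assume h: "(\<Sum>v\<in>Poly_Mapping.keys m. Poly_Mapping.lookup m v) = Suc n"
      then obtain v where "v \<in> Poly_Mapping.keys m" by (metis ex_in_conv nat.distinct(1) sum.empty)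
      then obtain m' where m': "m = Poly_Mapping.single v 1 + m'" by (rule exponent_decomp)
      let ?A = "Poly_Mapping.keys m"
      have "Poly_Mapping.keys m' \<subseteq> ?A" using m' by (auto simp: keys_add_nat)
      then have "(\<Sum>u\<in>Poly_Mapping.keys m'. Poly_Mapping.lookup m' u) = (\<Sum>u\<in>?A. Poly_Mapping.lookup m' u)"
        by (intro sum.mono_neutral_left) (auto simp: in_keys_iff)
      moreover have "(\<Sum>u\<in>?A. Poly_Mapping.lookup m u)
          = (\<Sum>u\<in>?A. (if u = v then 1 else 0) + Poly_Mapping.lookup m' u)"
        by (subst m') (auto simp: lookup_add lookup_single when_def intro!: sum.cong)
      moreover have "v \<in> ?A" by fact
      ultimately have "(\<Sum>u\<in>Poly_Mapping.keys m'. Poly_Mapping.lookup m' u) = n"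
        using h by (simp add: sum.distrib)
      then have "P m'" using Suc by simp
      then show "P m" unfolding m' by (rule assms(2))
    qed
  qed
  then show ?thesis by blast
qed

lemma mpoly_carrier: "p \<in> carrier (mpoly_ring V) \<longleftrightarrow> (\<forall>m\<in>Poly_Mapping.keys p. Poly_Mapping.keys m \<subseteq> V)"
  by (simp add: mpoly_ring_def)

section \<open>Evaluation of polynomials along a field embedding\<close>

locale field_embedding_loc =
  fixes \<iota> :: "'k::field \<Rightarrow> 'f::field"
  assumes embedding: "field_embedding \<iota>"
begin

lemma emb_one [simp]: "\<iota> 1 = 1" and emb_add: "\<iota> (a + b) = \<iota> a + \<iota> b"
  and emb_mult: "\<iota> (a * b) = \<iota> a * \<iota> b"
  using embedding by (auto simp: field_embedding_def)

lemma emb_zero [simp]: "\<iota> 0 = 0"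
proof -
  have "\<iota> 0 + \<iota> 0 = \<iota> 0 + 0" using emb_add[of 0 0] by simp
  then show ?thesis by (simp only: add_left_cancel)
qed

lemma emb_of_nat [simp]: "\<iota> (of_nat k) = of_nat k"
  by (induction k) (auto simp: emb_add)

lemma emb_eq_zero_iff [simp]: "\<iota> a = 0 \<longleftrightarrow> a = 0"
proof
  assume "\<iota> a = 0"
  then have "\<iota> (a * inverse a) = 0" by (simp add: emb_mult)
  then show "a = 0" using emb_one right_inverse zero_neq_one by metis
qed simp

lemma peval_superset:
  assumes "finite A" "Poly_Mapping.keys p \<subseteq> A"
  shows "peval \<iota> x p = (\<Sum>m\<in>A. \<iota> (Poly_Mapping.lookup p m) * mono_eval x m)"
  unfolding peval_def mono_eval_def[symmetric] using assms
  by (intro sum.mono_neutral_left) (auto simp: in_keys_iff)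

lemma peval_zero [simp]: "peval \<iota> x 0 = 0"
  by (simp add: peval_def)

lemma peval_single [simp]: "peval \<iota> x (Poly_Mapping.single m c) = \<iota> c * mono_eval x m"
  by (auto simp: peval_def mono_eval_def)

lemma peval_one [simp]: "peval \<iota> x 1 = 1"
  unfolding single_one[symmetric] by (simp del: single_one)

lemma peval_add: "peval \<iota> x (p + q) = peval \<iota> x p + peval \<iota> x q"
proof -
  let ?A = "Poly_Mapping.keys p \<union> Poly_Mapping.keys q"
  have "Poly_Mapping.keys (p + q) \<subseteq> ?A" by (rule keys_add)
  then show ?thesis
    by (simp add: peval_superset[of ?A] lookup_add emb_add distrib_right sum.distrib)
qed

lemma peval_sum: "peval \<iota> x (\<Sum>i\<in>A. p i) = (\<Sum>i\<in>A. peval \<iota> x (p i))"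
  by (induction A rule: infinite_finite_induct) (auto simp: peval_add)

lemma peval_uminus: "peval \<iota> x (- p) = - peval \<iota> x p"
  using peval_add[of x p "- p"] by (simp add: eq_neg_iff_add_eq_0 add.commute)

lemma peval_diff: "peval \<iota> x (p - q) = peval \<iota> x p - peval \<iota> x q"
  using peval_add[of x p "- q"] by (simp add: peval_uminus)

lemma peval_mult: "peval \<iota> x (p * q) = peval \<iota> x p * peval \<iota> x q"
proof -
  let ?P = "Poly_Mapping.keys p" and ?Q = "Poly_Mapping.keys q"
  have "p * q = (\<Sum>m\<in>?P. Poly_Mapping.single m (Poly_Mapping.lookup p m)) *
      (\<Sum>k\<in>?Q. Poly_Mapping.single k (Poly_Mapping.lookup q k))"
    by (simp add: sum_singles)
  also have "\<dots> = (\<Sum>m\<in>?P. \<Sum>k\<in>?Q.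
      Poly_Mapping.single (m + k) (Poly_Mapping.lookup p m * Poly_Mapping.lookup q k))"
    by (simp add: sum_product mult_single)
  finally have "peval \<iota> x (p * q) = (\<Sum>m\<in>?P. \<Sum>k\<in>?Q.
      (\<iota> (Poly_Mapping.lookup p m) * mono_eval x m) * (\<iota> (Poly_Mapping.lookup q k) * mono_eval x k))"
    by (simp add: peval_sum emb_mult mono_eval_add mult_ac)
  also have "\<dots> = peval \<iota> x p * peval \<iota> x q"
    by (simp add: sum_product peval_def mono_eval_def)
  finally show ?thesis .
qed

lemma peval_power: "peval \<iota> x (p ^ k) = peval \<iota> x p ^ k"
  by (induction k) (auto simp: peval_mult)

end

lemma mpoly_ring_ops [simp]:
  "x \<otimes>\<^bsub>mpoly_ring V\<^esub> y = x * y" "x \<oplus>\<^bsub>mpoly_ring V\<^esub> y = x + y"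
  "\<one>\<^bsub>mpoly_ring V\<^esub> = 1" "\<zero>\<^bsub>mpoly_ring V\<^esub> = 0"
  by (simp_all add: mpoly_ring_def)

lemma mpoly_closed:
  "0 \<in> carrier (mpoly_ring V)" "1 \<in> carrier (mpoly_ring V)"
  "p \<in> carrier (mpoly_ring V) \<Longrightarrow> q \<in> carrier (mpoly_ring V) \<Longrightarrow> p + q \<in> carrier (mpoly_ring V)"
  "p \<in> carrier (mpoly_ring V) \<Longrightarrow> - p \<in> carrier (mpoly_ring V)"
  "p \<in> carrier (mpoly_ring V) \<Longrightarrow> q \<in> carrier (mpoly_ring V) \<Longrightarrow> p - q \<in> carrier (mpoly_ring V)"
  "p \<in> carrier (mpoly_ring V) \<Longrightarrow> q \<in> carrier (mpoly_ring V) \<Longrightarrow> p * q \<in> carrier (mpoly_ring V)"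
proof -
  show "p + q \<in> carrier (mpoly_ring V)" if "p \<in> carrier (mpoly_ring V)" "q \<in> carrier (mpoly_ring V)" for p q
    using that keys_add[of p q] by (auto simp: mpoly_carrier)
  show "p - q \<in> carrier (mpoly_ring V)" if "p \<in> carrier (mpoly_ring V)" "q \<in> carrier (mpoly_ring V)" for p q
    using that Poly_Mapping.keys_diff[of p q] unfolding mpoly_carrier by blast
  show "p * q \<in> carrier (mpoly_ring V)" if "p \<in> carrier (mpoly_ring V)" "q \<in> carrier (mpoly_ring V)" for p q
    using that keys_mult[of p q] by (fastforce simp: mpoly_carrier keys_add_nat)
qed (auto simp: mpoly_carrier in_keys_iff)

lemma mpoly_closed_sum: "(\<And>i. i \<in> A \<Longrightarrow> p i \<in> carrier (mpoly_ring V)) \<Longrightarrow> sum p A \<in> carrier (mpoly_ring V)"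
  by (induction A rule: infinite_finite_induct) (auto intro: mpoly_closed)

lemma mpoly_closed_power: "p \<in> carrier (mpoly_ring V) \<Longrightarrow> p ^ k \<in> carrier (mpoly_ring V)"
  by (induction k) (auto intro: mpoly_closed)

lemma mpoly_closed_single: "Poly_Mapping.keys m \<subseteq> V \<Longrightarrow> Poly_Mapping.single m c \<in> carrier (mpoly_ring V)"
  by (auto simp: mpoly_carrier)

lemma mpoly_ring_cring: "cring (mpoly_ring V)"
proof (intro cringI abelian_groupI comm_monoidI)
  show "\<exists>y\<in>carrier (mpoly_ring V). y \<oplus>\<^bsub>mpoly_ring V\<^esub> x = \<zero>\<^bsub>mpoly_ring V\<^esub>"
    if "x \<in> carrier (mpoly_ring V)" for x
    using mpoly_closed(4)[OF that] by (intro bexI[of _ "- x"]) simp_all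
qed (simp_all add: mpoly_closed algebra_simps)

section \<open>Monomial ideals\<close>

text \<open>Membership is tested term by term. Once identified with a generated ideal, this turns
  membership in the incompatibility ideal into a condition on single exponents.\<close>

definition monomial_ideal :: "'v set \<Rightarrow> ('v \<Rightarrow>\<^sub>0 nat) set \<Rightarrow> ('v, 'k::field) mpoly set" where
  "monomial_ideal V M = {p \<in> carrier (mpoly_ring V).
     \<forall>m\<in>Poly_Mapping.keys p. \<exists>g\<in>M. \<exists>m'. m = g + m'}"

lemma monomial_ideal_is_ideal: "ideal (monomial_ideal V M :: ('v, 'k::field) mpoly set) (mpoly_ring V)"
proof -
  interpret R: cring "mpoly_ring V :: ('v, 'k) mpoly ring" by (rule mpoly_ring_cring)
  have mult: "a * x \<in> monomial_ideal V M"
    if "x \<in> monomial_ideal V M" "a \<in> carrier (mpoly_ring V)" for a x :: "('v, 'k) mpoly"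
  proof -
    have "\<exists>g\<in>M. \<exists>m'. m = g + m'" if mk: "m \<in> Poly_Mapping.keys (a * x)" for m
    proof -
      obtain k l where kl: "l \<in> Poly_Mapping.keys x" "m = k + l"
        using mk keys_mult[of a x] by auto
      then obtain g m' where "g \<in> M" "l = g + m'"
        using \<open>x \<in> _\<close> unfolding monomial_ideal_def by blast
      then have "m = g + (k + m')" using kl by (simp add: ac_simps)
      then show ?thesis using \<open>g \<in> M\<close> by blast
    qed
    with that show ?thesis by (auto simp: monomial_ideal_def intro: mpoly_closed)
  qed
  have neg: "- x \<in> monomial_ideal V M" if "x \<in> monomial_ideal V M" for x :: "('v, 'k) mpoly"
    using that by (auto simp: monomial_ideal_def in_keys_iff intro: mpoly_closed)
  have add: "x + y \<in> monomial_ideal V M" if "x \<in> monomial_ideal V M" "y \<in> monomial_ideal V M"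
    for x y :: "('v, 'k) mpoly"
    using that keys_add[of x y] by (auto simp: monomial_ideal_def intro: mpoly_closed)
  have inv: "\<ominus>\<^bsub>mpoly_ring V\<^esub> x = - x" if "x \<in> carrier (mpoly_ring V)" for x :: "('v, 'k) mpoly"
    using that by (intro R.minus_equality) (auto intro: mpoly_closed)
  show ?thesis
  proof (rule idealI)
    show "ring (mpoly_ring V :: ('v, 'k) mpoly ring)" by (rule R.ring_axioms)
    show "subgroup (monomial_ideal V M) (add_monoid (mpoly_ring V :: ('v, 'k) mpoly ring))"
    proof
      show "monomial_ideal V M \<subseteq> carrier (add_monoid (mpoly_ring V :: ('v, 'k) mpoly ring))"
        by (auto simp: monomial_ideal_def)
      show "x \<otimes>\<^bsub>add_monoid (mpoly_ring V)\<^esub> y \<in> monomial_ideal V M"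
        if "x \<in> monomial_ideal V M" "y \<in> monomial_ideal V M" for x y :: "('v, 'k) mpoly"
        using add[OF that] by simp
      show "\<one>\<^bsub>add_monoid (mpoly_ring V)\<^esub> \<in> (monomial_ideal V M :: ('v, 'k) mpoly set)"
        by (simp add: monomial_ideal_def mpoly_closed)
      show "inv\<^bsub>add_monoid (mpoly_ring V)\<^esub> x \<in> monomial_ideal V M"
        if "x \<in> monomial_ideal V M" for x :: "('v, 'k) mpoly"
      proof -
        have "inv\<^bsub>add_monoid (mpoly_ring V)\<^esub> x = - x"
          using that inv[of x] by (simp add: a_inv_def monomial_ideal_def)
        then show ?thesis using neg[OF that] by simp
      qed
    qed
    show "x \<otimes>\<^bsub>mpoly_ring V\<^esub> a \<in> monomial_ideal V M" "a \<otimes>\<^bsub>mpoly_ring V\<^esub> x \<in> monomial_ideal V M"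
      if "a \<in> monomial_ideal V M" "x \<in> carrier (mpoly_ring V)" for a x :: "('v, 'k) mpoly"
      using mult[OF that] by (simp_all add: mult.commute[of a x])
  qed
qed

text \<open>The term-wise description is an ideal containing the generators, so minimality gives one
  inclusion; conversely every term of a member is a multiple of one generator.\<close>

lemma genideal_monomials:
  assumes "\<And>m. m \<in> M \<Longrightarrow> Poly_Mapping.keys m \<subseteq> V"
  shows "Idl\<^bsub>mpoly_ring V\<^esub> ((\<lambda>m. Poly_Mapping.single m 1) ` M) = (monomial_ideal V M :: ('v, 'k::field) mpoly set)"
    (is "Idl\<^bsub>?R\<^esub> ?G = _")
proof
  interpret R: cring ?R by (rule mpoly_ring_cring)
  have G: "?G \<subseteq> carrier ?R" using assms by (auto intro: mpoly_closed_single)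
  have self: "\<exists>g\<in>M. \<exists>m'. m = g + m'" if "m \<in> M" for m
    using that by (intro bexI[of _ m] exI[of _ 0]) simp_all
  have "(Poly_Mapping.single m 1 :: ('v, 'k) mpoly) \<in> monomial_ideal V M" if "m \<in> M" for m
    using self[OF that] mpoly_closed_single[OF assms[OF that]] by (simp add: monomial_ideal_def)
  then have "?G \<subseteq> monomial_ideal V M"
    by blast
  then show "Idl\<^bsub>?R\<^esub> ?G \<subseteq> monomial_ideal V M"
    by (intro R.genideal_minimal monomial_ideal_is_ideal)
  interpret I: ideal "Idl\<^bsub>?R\<^esub> ?G" ?R by (rule R.genideal_ideal[OF G])
  show "monomial_ideal V M \<subseteq> Idl\<^bsub>?R\<^esub> ?G"
  proof
    fix p :: "('v, 'k) mpoly" assume p: "p \<in> monomial_ideal V M"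
    have terms: "Poly_Mapping.single m (Poly_Mapping.lookup p m) \<in> Idl\<^bsub>?R\<^esub> ?G" if m: "m \<in> Poly_Mapping.keys p" for m
    proof -
      obtain g m' where g: "g \<in> M" "m = g + m'" using p m by (auto simp: monomial_ideal_def)
      have "Poly_Mapping.keys m \<subseteq> V" using p m by (auto simp: monomial_ideal_def mpoly_carrier)
      then have "Poly_Mapping.single m' (Poly_Mapping.lookup p m) \<in> carrier ?R"
        using g by (intro mpoly_closed_single) (simp add: keys_add_nat)
      moreover have "Poly_Mapping.single g 1 \<in> Idl\<^bsub>?R\<^esub> ?G"
        using R.genideal_self[OF G] g by blast
      ultimately have "Poly_Mapping.single g 1 \<otimes>\<^bsub>?R\<^esub> Poly_Mapping.single m' (Poly_Mapping.lookup p m) \<in> Idl\<^bsub>?R\<^esub> ?G"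
        by (intro I.I_r_closed)
      then show ?thesis using g by (simp add: mult_single)
    qed
    have sum_closed: "(\<Sum>m\<in>A. f m) \<in> Idl\<^bsub>?R\<^esub> ?G" if "\<And>m. m \<in> A \<Longrightarrow> f m \<in> Idl\<^bsub>?R\<^esub> ?G" for A :: "('v \<Rightarrow>\<^sub>0 nat) set" and f
      using that
    proof (induction A rule: infinite_finite_induct)
      case (insert a A)
      then show ?case using I.a_closed[of "f a" "sum f A"] by simp
    qed (use I.zero_closed in simp_all)
    have "(\<Sum>m\<in>Poly_Mapping.keys p. Poly_Mapping.single m (Poly_Mapping.lookup p m)) \<in> Idl\<^bsub>?R\<^esub> ?G"
      by (rule sum_closed[OF terms])
    then show "p \<in> Idl\<^bsub>?R\<^esub> ?G" by (simp add: sum_singles)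
  qed
qed

section \<open>Weights and initial forms\<close>

lemma weight_superset:
  assumes "finite A" "Poly_Mapping.keys m \<subseteq> A"
  shows "weight \<omega> m = (\<Sum>v\<in>A. Poly_Mapping.lookup \<omega> v * real (Poly_Mapping.lookup m v))"
  unfolding weight_def using assms
  by (intro sum.mono_neutral_left) (auto simp: in_keys_iff)

lemma weight_add: "weight \<omega> (m + k) = weight \<omega> m + weight \<omega> k"
proof -
  let ?A = "Poly_Mapping.keys m \<union> Poly_Mapping.keys k"
  show ?thesis
    by (simp add: weight_superset[of ?A] keys_add_nat lookup_add distrib_left sum.distrib)
qed

lemma weight_zero [simp]: "weight \<omega> 0 = 0"
  by (simp add: weight_def)

lemma weight_single [simp]: "weight \<omega> (Poly_Mapping.single v k) = Poly_Mapping.lookup \<omega> v * real k"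
  by (simp add: weight_def)

lemma lookup_initial_form:
  "Poly_Mapping.lookup (initial_form \<omega> f) m =
     (if m \<in> Poly_Mapping.keys f \<and> (\<forall>m'\<in>Poly_Mapping.keys f. weight \<omega> m' \<le> weight \<omega> m)
      then Poly_Mapping.lookup f m else 0)"
proof -
  let ?A = "{m \<in> Poly_Mapping.keys f. \<forall>m'\<in>Poly_Mapping.keys f. weight \<omega> m' \<le> weight \<omega> m}"
  have "Poly_Mapping.lookup (initial_form \<omega> f) m = (\<Sum>k\<in>?A. if k = m then Poly_Mapping.lookup f m else 0)"
    unfolding initial_form_def lookup_sum by (intro sum.cong) (auto simp: lookup_single when_def)
  then show ?thesis by simp
qed

lemma keys_initial_form:
  "Poly_Mapping.keys (initial_form \<omega> f) =
     {m \<in> Poly_Mapping.keys f. \<forall>m'\<in>Poly_Mapping.keys f. weight \<omega> m' \<le> weight \<omega> m}"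
  by (auto simp: in_keys_iff lookup_initial_form split: if_splits)

lemma keys_var_mult: "var v * var w - g = Poly_Mapping.single (Poly_Mapping.single v 1 + Poly_Mapping.single w 1) 1 - g"
  by (simp add: var_def mult_single)

text \<open>Used for relations \<open>v * w - g\<close>: if every monomial of \<open>g\<close> is
  lighter than the incompatible product, that product is the whole initial form.\<close>

lemma initial_form_leading:
  assumes "\<And>k. k \<in> Poly_Mapping.keys g \<Longrightarrow> weight \<omega> k < weight \<omega> m"
  shows "initial_form \<omega> (Poly_Mapping.single m 1 - g) = (Poly_Mapping.single m 1 :: ('v, 'k::field) mpoly)"
proof -
  let ?f = "Poly_Mapping.single m 1 - g"
  have g: "Poly_Mapping.lookup g k = 0" if "weight \<omega> m \<le> weight \<omega> k" for k
    using assms[of k] that by (auto simp: in_keys_iff)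
  have m: "m \<in> Poly_Mapping.keys ?f" using g[of m] by (simp add: in_keys_iff lookup_minus)
  have le: "weight \<omega> k \<le> weight \<omega> m" if "k \<in> Poly_Mapping.keys ?f" for k
    using that assms[of k] by (cases "k = m") (auto simp: in_keys_iff lookup_minus lookup_single when_def)
  show ?thesis
  proof (rule poly_mapping_eqI)
    fix k
    show "Poly_Mapping.lookup (initial_form \<omega> ?f) k = Poly_Mapping.lookup (Poly_Mapping.single m 1) k"
    proof (cases "k = m")
      case True
      then show ?thesis using m le g[of m] by (simp add: lookup_initial_form lookup_minus)
    next
      case False
      have "\<not> (k \<in> Poly_Mapping.keys ?f \<and> (\<forall>k'\<in>Poly_Mapping.keys ?f. weight \<omega> k' \<le> weight \<omega> k))"
      proof
        assume h: "k \<in> Poly_Mapping.keys ?f \<and> (\<forall>k'\<in>Poly_Mapping.keys ?f. weight \<omega> k' \<le> weight \<omega> k)"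
        then have "weight \<omega> m \<le> weight \<omega> k" using m by blast
        then show False using h g[of k] False by (simp add: in_keys_iff lookup_minus lookup_single)
      qed
      then show ?thesis using False unfolding lookup_initial_form by (auto simp: lookup_single)
    qed
  qed
qed

section \<open>Algebraic independence of clusters\<close>

definition alg_indep :: "('k::field \<Rightarrow> 'f::field) \<Rightarrow> 'i set \<Rightarrow> ('i \<Rightarrow> 'f) \<Rightarrow> bool" where
  "alg_indep \<iota> I x \<longleftrightarrow> (\<forall>p\<in>carrier (mpoly_ring I). peval \<iota> x p = 0 \<longrightarrow> p = 0)"

lemma lookup_mult_single_add:
  fixes h :: "('i, 'k::comm_ring_1) mpoly"
  shows "Poly_Mapping.lookup (h * Poly_Mapping.single s 1) (m + s) = Poly_Mapping.lookup h m"
proof -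
  have "h * Poly_Mapping.single s 1 = (\<Sum>a\<in>Poly_Mapping.keys h. Poly_Mapping.single a (Poly_Mapping.lookup h a)) * Poly_Mapping.single s 1"
    by (simp add: sum_singles)
  also have "\<dots> = (\<Sum>a\<in>Poly_Mapping.keys h. Poly_Mapping.single (a + s) (Poly_Mapping.lookup h a))"
    by (simp add: sum_distrib_right mult_single)
  finally have "Poly_Mapping.lookup (h * Poly_Mapping.single s 1) (m + s)
      = (\<Sum>a\<in>Poly_Mapping.keys h. Poly_Mapping.lookup (Poly_Mapping.single (a + s) (Poly_Mapping.lookup h a)) (m + s))"
    by (simp add: lookup_sum)
  also have "\<dots> = (\<Sum>a\<in>Poly_Mapping.keys h. if a = m then Poly_Mapping.lookup h m else 0)"
    by (intro sum.cong) (auto simp: lookup_single when_def)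
  also have "\<dots> = Poly_Mapping.lookup h m" by (simp add: in_keys_iff)
  finally show ?thesis .
qed

lemma mono_eval_sum: "mono_eval x (\<Sum>i\<in>A. m i) = (\<Prod>i\<in>A. mono_eval x (m i))"
  by (induction A rule: infinite_finite_induct) (simp_all add: mono_eval_add)

lemma keys_sum_single: "Poly_Mapping.keys (\<Sum>i\<in>A. Poly_Mapping.single (j i) (e i)) \<subseteq> j ` A"
  by (rule order_trans[OF Poly_Mapping.keys_sum]) auto

context field_embedding_loc
begin

lemma alg_indep_nonzero:
  assumes "alg_indep \<iota> I x" "i \<in> I"
  shows "x i \<noteq> 0"
proof
  assume "x i = 0"
  then have "peval \<iota> x (Poly_Mapping.single (Poly_Mapping.single i 1) 1) = 0" by simp
  moreover have "Poly_Mapping.single (Poly_Mapping.single i 1) 1 \<in> carrier (mpoly_ring I)"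
    using assms(2) by (intro mpoly_closed_single) simp
  ultimately have "Poly_Mapping.single (Poly_Mapping.single i (1::nat)) (1::'k) = 0"
    using assms(1) unfolding alg_indep_def by blast
  then show False by (metis lookup_single_eq lookup_zero zero_neq_one)
qed

lemma alg_indep_inj:
  assumes "alg_indep \<iota> I x"
  shows "inj_on x I"
proof
  fix i j assume ij: "i \<in> I" "j \<in> I" "x i = x j"
  let ?s = "\<lambda>i. Poly_Mapping.single (Poly_Mapping.single i 1) 1 :: ('b, 'k) mpoly"
  have "?s i - ?s j \<in> carrier (mpoly_ring I)"
    using ij by (intro mpoly_closed mpoly_closed_single) simp_all
  moreover have "peval \<iota> x (?s i - ?s j) = 0" using ij by (simp add: peval_diff)
  ultimately have "?s i - ?s j = 0"
    using assms unfolding alg_indep_def by blast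
  then have "?s i = ?s j" by simp
  then have "Poly_Mapping.keys (?s i) = Poly_Mapping.keys (?s j)" by simp
  then have "Poly_Mapping.single i (1::nat) = Poly_Mapping.single j 1" by simp
  then have "Poly_Mapping.keys (Poly_Mapping.single i (1::nat)) = Poly_Mapping.keys (Poly_Mapping.single j (1::nat))" by simp
  then show "i = j" by simp
qed

text \<open>Seeds are indexed by numbers, whereas the presentation uses the cluster variables
  themselves as variables. Exponents are transported by \<open>idx\<close> along the inverse of
  \<open>x\<close>, which exists because independence makes \<open>x\<close> injective.\<close>

lemma alg_indep_image:
  assumes "alg_indep \<iota> I x"
  shows "alg_indep \<iota> (x ` I) (\<lambda>v. v)"
  unfolding alg_indep_def
proof (intro ballI impI)
  fix p :: "('f, 'k) mpoly"
  assume p: "p \<in> carrier (mpoly_ring (x ` I))" and p0: "peval \<iota> (\<lambda>v. v) p = 0"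
  note inj = alg_indep_inj[OF assms]
  define idx where "idx m = (\<Sum>v\<in>Poly_Mapping.keys m. Poly_Mapping.single (inv_into I x v) (Poly_Mapping.lookup m v))"
    for m :: "'f \<Rightarrow>\<^sub>0 nat"
  have lookup_idx: "Poly_Mapping.lookup (idx m) i = Poly_Mapping.lookup m (x i)"
    if "Poly_Mapping.keys m \<subseteq> x ` I" "i \<in> I" for m i
  proof -
    have "Poly_Mapping.lookup (idx m) i = (\<Sum>v\<in>Poly_Mapping.keys m. if v = x i then Poly_Mapping.lookup m (x i) else 0)"
      unfolding idx_def lookup_sum
      using that inj by (intro sum.cong) (auto simp: lookup_single when_def inv_into_f_f f_inv_into_f)
    then show ?thesis by (simp add: in_keys_iff)
  qed
  have keys_idx: "Poly_Mapping.keys (idx m) \<subseteq> I" if "Poly_Mapping.keys m \<subseteq> x ` I" for m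
    unfolding idx_def using that
    by (intro order_trans[OF keys_sum_single]) (auto simp: inv_into_into)
  have eval_idx: "mono_eval x (idx m) = mono_eval (\<lambda>v. v) m" if "Poly_Mapping.keys m \<subseteq> x ` I" for m
  proof -
    have "mono_eval x (idx m) = (\<Prod>v\<in>Poly_Mapping.keys m. mono_eval x (Poly_Mapping.single (inv_into I x v) (Poly_Mapping.lookup m v)))"
      unfolding idx_def by (rule mono_eval_sum)
    also have "\<dots> = mono_eval (\<lambda>v. v) m"
      unfolding mono_eval_def[of "\<lambda>v. v"] using that
      by (intro prod.cong) (auto simp: f_inv_into_f)
    finally show ?thesis .
  qed
  have keys: "Poly_Mapping.keys m \<subseteq> x ` I" if "m \<in> Poly_Mapping.keys p" for m
    using p that by (auto simp: mpoly_carrier)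
  define q where "q = (\<Sum>m\<in>Poly_Mapping.keys p. Poly_Mapping.single (idx m) (Poly_Mapping.lookup p m))"
  have "q \<in> carrier (mpoly_ring I)"
    unfolding q_def using keys keys_idx by (intro mpoly_closed_sum mpoly_closed_single) blast
  moreover have "peval \<iota> x q = peval \<iota> (\<lambda>v. v) p"
    unfolding q_def peval_sum peval_single unfolding peval_def mono_eval_def[symmetric]
    using eval_idx keys by (intro sum.cong) auto
  ultimately have q0: "q = 0"
    using assms p0 unfolding alg_indep_def by simp
  show "p = 0"
  proof (rule ccontr)
    assume "p \<noteq> 0"
    then obtain m where m: "m \<in> Poly_Mapping.keys p" by (meson ex_in_conv keys_eq_empty)
    have "idx k = idx m \<longleftrightarrow> k = m" if "k \<in> Poly_Mapping.keys p" for k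
    proof
      assume eq: "idx k = idx m"
      show "k = m"
      proof (rule poly_mapping_eqI)
        fix v
        show "Poly_Mapping.lookup k v = Poly_Mapping.lookup m v"
        proof (cases "v \<in> x ` I")
          case True
          then show ?thesis using lookup_idx keys[OF that] keys[OF m] eq by (metis imageE)
        next
          case False
          then show ?thesis using keys[OF that] keys[OF m] by (metis in_keys_iff subsetD)
        qed
      qed
    qed simp
    then have "Poly_Mapping.lookup q (idx m) = (\<Sum>k\<in>Poly_Mapping.keys p. if k = m then Poly_Mapping.lookup p m else 0)"
      unfolding q_def lookup_sum by (intro sum.cong) (auto simp: lookup_single when_def)
    then show False using q0 m by (simp add: in_keys_iff)
  qed
qed

text \<open>A relation among the new variables, multiplied by a high power of \<open>x k\<close>,
  becomes a polynomial relation among the old ones. Since \<open>r\<close> does not involve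
  \<open>x k\<close>, its parts of different degree in the mutated variable carry different powers
  of \<open>x k\<close> and vanish separately.\<close>

lemma alg_indep_mutate:
  fixes x :: "nat \<Rightarrow> 'f"
  assumes x: "alg_indep \<iota> I x" and k: "k \<in> I"
    and r: "r \<in> carrier (mpoly_ring (I - {k}))" "r \<noteq> 0"
  shows "alg_indep \<iota> I (x(k := peval \<iota> x r / x k))"
  unfolding alg_indep_def
proof (intro ballI impI)
  let ?y = "x(k := peval \<iota> x r / x k)" and ?I = "I - {k}"
  fix p :: "(nat, 'k) mpoly"
  assume p: "p \<in> carrier (mpoly_ring I)" and p0: "peval \<iota> ?y p = 0"
  have xk: "x k \<noteq> 0" using alg_indep_nonzero[OF x k] .
  \<comment> \<open>\<open>D\<close> bounds the exponent of \<open>k\<close> in every monomial of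
    \<open>p\<close>; \<open>x k ^ D\<close> therefore clears all denominators.\<close>
  define D where "D = (\<Sum>m\<in>Poly_Mapping.keys p. Poly_Mapping.lookup m k)"
  define rest where "rest m = m - Poly_Mapping.single k (Poly_Mapping.lookup m k)" for m :: "nat \<Rightarrow>\<^sub>0 nat"
  have split: "m = rest m + Poly_Mapping.single k (Poly_Mapping.lookup m k)" for m
    unfolding rest_def by (intro poly_mapping_eqI) (auto simp: lookup_add lookup_minus lookup_single when_def)
  have rest_keys: "Poly_Mapping.keys (rest m) \<subseteq> ?I" if "m \<in> Poly_Mapping.keys p" for m
  proof -
    have "Poly_Mapping.keys (rest m) \<subseteq> Poly_Mapping.keys m - {k}"
      unfolding rest_def by (auto simp: in_keys_iff lookup_minus lookup_single when_def)
    then show ?thesis using p that unfolding mpoly_carrier by blast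
  qed
  define q where "q j = (\<Sum>m | m \<in> Poly_Mapping.keys p \<and> Poly_Mapping.lookup m k = j.
    Poly_Mapping.single (rest m) (Poly_Mapping.lookup p m))" for j
  have q: "q j \<in> carrier (mpoly_ring ?I)" for j
    unfolding q_def using rest_keys by (intro mpoly_closed_sum mpoly_closed_single) blast
  define s where "s j = Poly_Mapping.single k (D - j)" for j
  \<comment> \<open>\<open>\<Phi>\<close> represents \<open>x k ^ D\<close> times the relation,
    where \<open>q j\<close> collects the terms of \<open>p\<close> of degree \<open>j\<close> in
    the variable \<open>k\<close>, with that variable removed.\<close>
  define \<Phi> where "\<Phi> = (\<Sum>j\<le>D. (q j * r ^ j) * Poly_Mapping.single (s j) 1)"
  have le: "Poly_Mapping.lookup m k \<le> D" if "m \<in> Poly_Mapping.keys p" for m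
    unfolding D_def using that by (intro member_le_sum) auto
  have trm: "peval \<iota> x (q j * r ^ j * Poly_Mapping.single (s j) 1)
      = x k ^ D * (\<Sum>m | m \<in> Poly_Mapping.keys p \<and> Poly_Mapping.lookup m k = j.
          \<iota> (Poly_Mapping.lookup p m) * mono_eval ?y m)" if "j \<le> D" for j
  proof -
    have y: "mono_eval ?y m = (peval \<iota> x r / x k) ^ j * mono_eval x (rest m)"
      if "m \<in> Poly_Mapping.keys p" "Poly_Mapping.lookup m k = j" for m
    proof -
      have "mono_eval ?y (rest m) = mono_eval x (rest m)"
        unfolding mono_eval_def using rest_keys[OF that(1)] by (intro prod.cong) auto
      then show ?thesis by (subst split[of m]) (simp add: mono_eval_add that(2))
    qed
    have "x k ^ D * (peval \<iota> x r / x k) ^ j = peval \<iota> x r ^ j * x k ^ (D - j)"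
      using that xk by (simp add: power_divide power_diff)
    then have "x k ^ D * (\<Sum>m | m \<in> Poly_Mapping.keys p \<and> Poly_Mapping.lookup m k = j.
          \<iota> (Poly_Mapping.lookup p m) * mono_eval ?y m)
      = (\<Sum>m | m \<in> Poly_Mapping.keys p \<and> Poly_Mapping.lookup m k = j.
          \<iota> (Poly_Mapping.lookup p m) * mono_eval x (rest m)) * (peval \<iota> x r ^ j * x k ^ (D - j))"
      unfolding sum_distrib_left sum_distrib_right
      by (intro sum.cong) (simp_all add: y algebra_simps)
    then show ?thesis
      by (simp add: peval_mult peval_power q_def peval_sum s_def mult.assoc)
  qed
  have "peval \<iota> x \<Phi> = x k ^ D * (\<Sum>j\<le>D. \<Sum>m | m \<in> Poly_Mapping.keys p \<and> Poly_Mapping.lookup m k = j.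
          \<iota> (Poly_Mapping.lookup p m) * mono_eval ?y m)"
    unfolding \<Phi>_def peval_sum by (subst sum_distrib_left) (intro sum.cong refl trm, simp)
  also have "(\<Sum>j\<le>D. \<Sum>m | m \<in> Poly_Mapping.keys p \<and> Poly_Mapping.lookup m k = j.
          \<iota> (Poly_Mapping.lookup p m) * mono_eval ?y m) = peval \<iota> ?y p"
    unfolding peval_def mono_eval_def[symmetric]
    using le by (intro sum.group) auto
  finally have "peval \<iota> x \<Phi> = 0" using p0 by simp
  moreover have sub: "carrier (mpoly_ring ?I) \<subseteq> (carrier (mpoly_ring I) :: (nat, 'k) mpoly set)"
    unfolding mpoly_ring_def by fastforce
  moreover have "\<Phi> \<in> carrier (mpoly_ring I)"
    unfolding \<Phi>_def s_def using k sub q r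
    by (intro mpoly_closed_sum mpoly_closed mpoly_closed_single mpoly_closed_power) (auto simp: in_keys_iff lookup_single when_def)
  ultimately have \<Phi>0: "\<Phi> = 0" using x unfolding alg_indep_def by blast
  have q0: "q j = 0" if j: "j \<le> D" for j
  proof -
    have h: "q i * r ^ i \<in> carrier (mpoly_ring ?I)" for i
      using q r by (intro mpoly_closed mpoly_closed_power)
    have "Poly_Mapping.lookup (q j * r ^ j) m = 0" for m
    proof (cases "Poly_Mapping.lookup m k = 0")
      case False
      then have "k \<in> Poly_Mapping.keys m" by (simp add: in_keys_iff)
      then have "m \<notin> Poly_Mapping.keys (q j * r ^ j)" using h[of j] unfolding mpoly_carrier by blast
      then show ?thesis by (simp add: in_keys_iff)
    next
      case True
      \<comment> \<open>The exponent of \<open>k\<close> is \<open>D - i\<close> throughout the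
        summand of index \<open>i\<close>, so a coefficient at \<open>m + s j\<close> comes from the
        summand \<open>j\<close> alone.\<close>
      have "Poly_Mapping.lookup ((q i * r ^ i) * Poly_Mapping.single (s i) 1) (m + s j)
          = (if i = j then Poly_Mapping.lookup (q j * r ^ j) m else 0)" if "i \<le> D" for i
      proof (cases "i = j")
        case True
        then show ?thesis by (simp only: lookup_mult_single_add if_True simp_thms)
      next
        case False
        have "m + s j \<notin> Poly_Mapping.keys ((q i * r ^ i) * Poly_Mapping.single (s i) 1)"
        proof
          assume "m + s j \<in> Poly_Mapping.keys ((q i * r ^ i) * Poly_Mapping.single (s i) 1)"
          then obtain a where a: "a \<in> Poly_Mapping.keys (q i * r ^ i)" "m + s j = a + s i"
            using keys_mult[of "q i * r ^ i" "Poly_Mapping.single (s i) 1"] by auto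
          have "Poly_Mapping.lookup a k = 0"
            using h[of i] a(1) unfolding mpoly_carrier by (metis Diff_iff in_keys_iff insertI1 subsetD)
          moreover have "Poly_Mapping.lookup (m + s j) k = Poly_Mapping.lookup (a + s i) k" using a(2) by simp
          ultimately have "D - j = D - i" using \<open>Poly_Mapping.lookup m k = 0\<close> by (simp add: lookup_add s_def)
          then show False using \<open>j \<le> D\<close> \<open>i \<le> D\<close> False by simp
        qed
        then show ?thesis using False by (simp add: in_keys_iff)
      qed
      then have "Poly_Mapping.lookup \<Phi> (m + s j) = (\<Sum>i\<le>D. if i = j then Poly_Mapping.lookup (q j * r ^ j) m else 0)"
        unfolding \<Phi>_def lookup_sum by (intro sum.cong) auto
      then show ?thesis using \<Phi>0 j by simp
    qed
    then have "q j * r ^ j = 0" by (intro poly_mapping_eqI) simp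
    \<comment> \<open>Exponents over the index type \<open>nat\<close> are linearly ordered, so
      there are no zero divisors and the power of \<open>r\<close> cancels.\<close>
    then show ?thesis using r(2) by simp
  qed
  show "p = 0"
  proof (rule ccontr)
    assume "p \<noteq> 0"
    then obtain m where m: "m \<in> Poly_Mapping.keys p" by (meson ex_in_conv keys_eq_empty)
    let ?j = "Poly_Mapping.lookup m k"
    have "Poly_Mapping.lookup (q ?j) (rest m) = (\<Sum>l | l \<in> Poly_Mapping.keys p \<and> Poly_Mapping.lookup l k = ?j.
       if l = m then Poly_Mapping.lookup p m else 0)"
      unfolding q_def lookup_sum
    proof (intro sum.cong refl)
      fix l assume l: "l \<in> {l \<in> Poly_Mapping.keys p. Poly_Mapping.lookup l k = ?j}"
      have "rest l = rest m \<longleftrightarrow> l = m" using l split[of l] split[of m] by auto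
      then show "Poly_Mapping.lookup (Poly_Mapping.single (rest l) (Poly_Mapping.lookup p l)) (rest m)
        = (if l = m then Poly_Mapping.lookup p m else 0)"
        by (auto simp: lookup_single when_def)
    qed
    also have "\<dots> = Poly_Mapping.lookup p m" using m by simp
    finally show False using q0[OF le[OF m]] m by (simp add: in_keys_iff)
  qed
qed

end

section \<open>Algebraic independence along sequences of mutations\<close>

text \<open>This is what keeps \<open>x k\<close> out of its own exchange binomial.\<close>

lemma skew_symmetrizable_diag:
  assumes "skew_symmetrizable n B" "k < n"
  shows "B k k = 0"
proof -
  obtain d :: "nat \<Rightarrow> int" where "d k > 0" "d k * B k k = - (d k * B k k)"
    using assms unfolding skew_symmetrizable_def by blast
  then show ?thesis by simp
qed

text \<open>The same symmetrizer \<open>d\<close> works. Only the correction term has to be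
  examined: after scaling by \<open>d\<close> its product part is symmetric in \<open>i\<close> and
  \<open>j\<close>, and its sign is antisymmetric wherever that product is positive.\<close>

lemma skew_symmetrizable_mutate:
  assumes "skew_symmetrizable n B" "k < n"
  shows "skew_symmetrizable n (mutate_matrix k B)"
proof -
  obtain d :: "nat \<Rightarrow> int" where d: "\<And>i. i < n \<Longrightarrow> d i > 0"
    and s: "\<And>i j. i < n \<Longrightarrow> j < n \<Longrightarrow> d i * B i j = - (d j * B j i)"
    using assms unfolding skew_symmetrizable_def by blast
  have max_mult: "c * max 0 a = max 0 (c * a)" if "c > 0" for a c :: int
    using that by (simp add: max_def zero_le_mult_iff mult_le_0_iff)
  have "d i * mutate_matrix k B i j = - (d j * mutate_matrix k B j i)" if "i < n" "j < n" for i j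
  proof (cases "i = k \<or> j = k")
    case True
    then show ?thesis using s[OF that] by (auto simp: mutate_matrix_def)
  next
    case False
    have "d i * (B i k * B k j) = d j * (B j k * B k i)"
    proof -
      have "d i * (B i k * B k j) = (d i * B i k) * B k j" by simp
      also have "\<dots> = - (d k * B k j) * B k i" by (simp add: s[OF that(1) assms(2)])
      also have "\<dots> = (d j * B j k) * B k i" by (simp add: s[OF that(2) assms(2)])
      finally show ?thesis by simp
    qed
    then have eq: "d i * max 0 (B i k * B k j) = d j * max 0 (B j k * B k i)"
      using max_mult d that by simp
    have sg: "sgn (B i k) = - sgn (B j k)" if pos: "B i k * B k j > 0"
    proof -
      have "sgn (B k j) = - sgn (B j k)"
      proof -
        have "sgn (d k * B k j) = sgn (- (d j * B j k))" using s[OF assms(2) \<open>j < n\<close>] by simp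
        then show ?thesis using d[OF assms(2)] d[OF \<open>j < n\<close>] by (simp add: sgn_mult)
      qed
      moreover have "sgn (B i k) = sgn (B k j)"
        using pos by (auto simp: zero_less_mult_iff)
      ultimately show ?thesis by simp
    qed
    have "d i * (sgn (B i k) * max 0 (B i k * B k j)) = - (d j * (sgn (B j k) * max 0 (B j k * B k i)))"
    proof (cases "B i k * B k j > 0")
      case True
      have "d i * (sgn (B i k) * max 0 (B i k * B k j)) = sgn (B i k) * (d i * max 0 (B i k * B k j))" by simp
      also have "\<dots> = - sgn (B j k) * (d j * max 0 (B j k * B k i))" by (simp only: eq sg[OF True])
      finally show ?thesis by simp
    next
      case False
      then have "max 0 (B i k * B k j) = 0" by simp
      then have "max 0 (B j k * B k i) = 0" using eq d[OF that(2)] by simp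
      then show ?thesis using \<open>max 0 (B i k * B k j) = 0\<close> by (simp only: mult_zero_right neg_0_equal_iff_equal minus_zero)
    qed
    then show ?thesis using False s[OF that] by (simp add: mutate_matrix_def distrib_left)
  qed
  then show ?thesis using d unfolding skew_symmetrizable_def by blast
qed

text \<open>Skew-symmetrizability is carried along because it makes the diagonal entry of each
  mutated matrix vanish, as the step for independence requires.\<close>

lemma (in field_embedding_loc) seeds_invariant:
  assumes "S' \<in> seeds n S" "is_seed (\<iota> :: 'k \<Rightarrow> 'f) n S" and char: "(2::'k) \<noteq> 0"
  shows "alg_indep \<iota> {..<n} (fst S') \<and> skew_symmetrizable n (snd S')"
  using assms(1)
proof induction
  case initial
  then show ?case using assms(2) by (auto simp: is_seed_def free_generating_def alg_indep_def)
next
  case (mutation S' k)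
  obtain x B where S': "S' = (x, B)" by force
  have x: "alg_indep \<iota> {..<n} x" and B: "skew_symmetrizable n B" using mutation S' by auto
  let ?I = "{..<n} - {k}"
  \<comment> \<open>\<open>e 1\<close> and \<open>e (-1)\<close> are the exponents of the two
    monomials of the exchange binomial \<open>r\<close>.\<close>
  define e where "e \<sigma> = (\<Sum>i\<in>?I. Poly_Mapping.single i (nat (\<sigma> * B i k)))" for \<sigma> :: int
  define r where "r = Poly_Mapping.single (e 1) (1::'k) + Poly_Mapping.single (e (-1)) 1"
  have keys: "Poly_Mapping.keys (e \<sigma>) \<subseteq> ?I" for \<sigma>
    unfolding e_def by (rule order_trans[OF keys_sum_single]) simp
  have r: "r \<in> carrier (mpoly_ring ?I)"
    unfolding r_def using keys by (intro mpoly_closed mpoly_closed_single)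
  \<comment> \<open>If column \<open>k\<close> vanishes, both monomials are 1 and the coefficient is
    2; this is where the characteristic matters.\<close>
  have "Poly_Mapping.lookup r (e 1) \<noteq> 0"
    unfolding r_def using char by (auto simp: lookup_add lookup_single when_def)
  then have "r \<noteq> 0" by auto
  have "(\<Prod>i<n. x i ^ nat (\<sigma> * B i k)) = mono_eval x (e \<sigma>)" for \<sigma>
  proof -
    have "(\<Prod>i<n. x i ^ nat (\<sigma> * B i k)) = (\<Prod>i\<in>?I. x i ^ nat (\<sigma> * B i k))"
      using mutation(2) skew_symmetrizable_diag[OF B, of k] by (simp add: prod.remove[of "{..<n}" k])
    then show ?thesis by (simp add: e_def mono_eval_sum)
  qed
  from this[of 1] this[of "-1"] have "mutate_cluster n k S' = x(k := peval \<iota> x r / x k)"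
    by (simp add: mutate_cluster_def S' r_def peval_add)
  moreover have "alg_indep \<iota> {..<n} (x(k := peval \<iota> x r / x k))"
    using mutation(2) by (intro alg_indep_mutate x r \<open>r \<noteq> 0\<close>) simp
  ultimately show ?case using skew_symmetrizable_mutate[OF B mutation(2)]
    by (simp only: fst_conv snd_conv S' simp_thms)
qed

lemma (in field_embedding_loc) clusters_alg_indep:
  assumes "is_seed (\<iota> :: 'k \<Rightarrow> 'f) n S" "(2::'k) \<noteq> 0" "T \<in> clusters n S"
  shows "alg_indep \<iota> T (\<lambda>v. v)"
  using assms seeds_invariant alg_indep_image unfolding clusters_def by blast

section \<open>A criterion for the initial ideal\<close>

lemma var_closed: "v \<in> V \<Longrightarrow> var v \<in> carrier (mpoly_ring V)"
  unfolding var_def by (rule mpoly_closed_single) simp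

lemma (in field_embedding_loc) peval_var [simp]: "peval \<iota> x (var v) = x v"
  by (simp add: var_def)

definition common_cluster :: "'v set set \<Rightarrow> 'v \<Rightarrow> 'v \<Rightarrow> bool" where
  "common_cluster Cl v w \<longleftrightarrow> (\<exists>c\<in>Cl. v \<in> c \<and> w \<in> c)"

lemma common_cluster_sym: "common_cluster Cl v w \<longleftrightarrow> common_cluster Cl w v"
  by (auto simp: common_cluster_def)

text \<open>Compatibility is only required pairwise, which is exactly the complement of divisibility
  by a generator of the incompatibility ideal. That such a monomial is supported in one cluster is a
  separate flag property.\<close>

definition standard :: "'v set set \<Rightarrow> ('v \<Rightarrow>\<^sub>0 nat) \<Rightarrow> bool" where
  "standard Cl m \<longleftrightarrow> (\<forall>v\<in>Poly_Mapping.keys m. \<forall>w\<in>Poly_Mapping.keys m. common_cluster Cl v w)"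

lemma incompatibility_ideal_iff:
  fixes p :: "('v, 'k::field) mpoly"
  assumes cover: "V = \<Union> Cl"
  shows "p \<in> incompatibility_ideal V Cl \<longleftrightarrow>
    p \<in> carrier (mpoly_ring V) \<and> (\<forall>m\<in>Poly_Mapping.keys p. \<not> standard Cl m)"
proof -
  define M where "M = {Poly_Mapping.single v 1 + Poly_Mapping.single w (1::nat) | v w.
    v \<in> V \<and> w \<in> V \<and> \<not> common_cluster Cl v w}"
  have "{var v * var w | v w. v \<in> V \<and> w \<in> V \<and> \<not> (\<exists>c\<in>Cl. v \<in> c \<and> w \<in> c)}
      = (\<lambda>m. Poly_Mapping.single m (1::'k)) ` M"
    unfolding M_def common_cluster_def var_def by (auto simp: mult_single)
  then have "incompatibility_ideal V Cl = (monomial_ideal V M :: ('v, 'k) mpoly set)"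
    unfolding incompatibility_ideal_def
    by (simp only:) (intro genideal_monomials, auto simp: M_def keys_add_nat)
  moreover have "(\<exists>g\<in>M. \<exists>m'. m = g + m') \<longleftrightarrow> \<not> standard Cl m" if m: "Poly_Mapping.keys m \<subseteq> V" for m
  proof
    assume "\<exists>g\<in>M. \<exists>m'. m = g + m'"
    then show "\<not> standard Cl m" unfolding M_def standard_def by (auto simp: keys_add_nat)
  next
    assume "\<not> standard Cl m"
    then obtain v w where vw: "v \<in> Poly_Mapping.keys m" "w \<in> Poly_Mapping.keys m" "\<not> common_cluster Cl v w"
      unfolding standard_def by blast
    \<comment> \<open>Each variable lies in some cluster and so is compatible with itself; hence the
      two variables divide \<open>m\<close> independently.\<close>
    have "v \<noteq> w" using vw m cover unfolding common_cluster_def by blast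
    obtain m' where m': "m = Poly_Mapping.single v 1 + m'" using vw(1) by (rule exponent_decomp)
    then have "w \<in> Poly_Mapping.keys m'" using vw(2) \<open>v \<noteq> w\<close> by (simp add: keys_add_nat)
    then obtain m'' where "m' = Poly_Mapping.single w 1 + m''" by (rule exponent_decomp)
    then have "m = (Poly_Mapping.single v 1 + Poly_Mapping.single w 1) + m''" using m' by (simp add: add.assoc)
    then show "\<exists>g\<in>M. \<exists>m'. m = g + m'" using vw m unfolding M_def by blast
  qed
  ultimately have *: "incompatibility_ideal V Cl = (monomial_ideal V M :: ('v, 'k) mpoly set)"
    and **: "\<And>m. Poly_Mapping.keys m \<subseteq> V \<Longrightarrow> (\<exists>g\<in>M. \<exists>m'. m = g + m') \<longleftrightarrow> \<not> standard Cl m"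
    by simp_all
  show ?thesis unfolding * monomial_ideal_def mem_Collect_eq
    by (intro conj_cong ball_cong refl **) (auto simp: mpoly_carrier)
qed

section \<open>Weight bounds for Laurent polynomials in a cluster\<close>

context field_embedding_loc
begin

text \<open>\<open>level T \<omega> s\<close> consists of Laurent polynomials in \<open>T\<close> (with denominators cleared) of
  \<open>\<omega>\<close>-weight at most \<open>s\<close>.\<close>

definition level :: "'f set \<Rightarrow> ('f \<Rightarrow>\<^sub>0 real) \<Rightarrow> real \<Rightarrow> 'f \<Rightarrow> bool" where
  "level T \<omega> s y \<longleftrightarrow> (\<exists>\<mu> p. Poly_Mapping.keys \<mu> \<subseteq> T \<and> p \<in> carrier (mpoly_ring T) \<and>
     y * mono_eval (\<lambda>v. v) \<mu> = peval \<iota> (\<lambda>v. v) p \<and>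
     (\<forall>m\<in>Poly_Mapping.keys p. weight \<omega> m \<le> s + weight \<omega> \<mu>))"

lemma level_mono: "level T \<omega> s y \<Longrightarrow> s \<le> s' \<Longrightarrow> level T \<omega> s' y"
  unfolding level_def by (meson add_right_mono order_trans)

lemma level_zero: "level T \<omega> s 0"
  unfolding level_def by (intro exI[of _ 0]) (auto intro: mpoly_closed)

lemma level_const: "level T \<omega> 0 (\<iota> c)"
  unfolding level_def
  by (rule exI[of _ 0], rule exI[of _ "Poly_Mapping.single 0 c"]) (simp add: mpoly_closed_single)

lemma level_var: "t \<in> T \<Longrightarrow> level T \<omega> (Poly_Mapping.lookup \<omega> t) t"
  unfolding level_def
  by (rule exI[of _ 0], rule exI[of _ "Poly_Mapping.single (Poly_Mapping.single t 1) 1"])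
    (auto intro!: mpoly_closed_single)

lemma level_add:
  assumes "level T \<omega> s y" "level T \<omega> s z"
  shows "level T \<omega> s (y + z)"
proof -
  obtain \<mu> p where 1: "Poly_Mapping.keys \<mu> \<subseteq> T" "p \<in> carrier (mpoly_ring T)"
    "y * mono_eval (\<lambda>v. v) \<mu> = peval \<iota> (\<lambda>v. v) p" "\<And>m. m \<in> Poly_Mapping.keys p \<Longrightarrow> weight \<omega> m \<le> s + weight \<omega> \<mu>"
    using assms(1) unfolding level_def by blast
  obtain \<nu> q where 2: "Poly_Mapping.keys \<nu> \<subseteq> T" "q \<in> carrier (mpoly_ring T)"
    "z * mono_eval (\<lambda>v. v) \<nu> = peval \<iota> (\<lambda>v. v) q" "\<And>m. m \<in> Poly_Mapping.keys q \<Longrightarrow> weight \<omega> m \<le> s + weight \<omega> \<nu>"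
    using assms(2) unfolding level_def by blast
  let ?s = "\<lambda>m. Poly_Mapping.single m (1::'k)"
  have "weight \<omega> m \<le> s + weight \<omega> (\<mu> + \<nu>)" if "m \<in> Poly_Mapping.keys (p * ?s \<nu> + q * ?s \<mu>)" for m
  proof -
    have "m \<in> Poly_Mapping.keys (p * ?s \<nu>) \<or> m \<in> Poly_Mapping.keys (q * ?s \<mu>)"
      using that keys_add[of "p * ?s \<nu>" "q * ?s \<mu>"] by blast
    then have "(\<exists>k\<in>Poly_Mapping.keys p. m = k + \<nu>) \<or> (\<exists>k\<in>Poly_Mapping.keys q. m = k + \<mu>)"
      using keys_mult[of p "?s \<nu>"] keys_mult[of q "?s \<mu>"] by auto
    then show ?thesis using 1(4) 2(4) by (auto simp: weight_add)
  qed
  moreover have "(y + z) * mono_eval (\<lambda>v. v) (\<mu> + \<nu>) = peval \<iota> (\<lambda>v. v) (p * ?s \<nu> + q * ?s \<mu>)"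
    unfolding peval_add peval_mult mono_eval_add 1(3)[symmetric] 2(3)[symmetric]
    by (simp add: algebra_simps)
  moreover have "p * ?s \<nu> + q * ?s \<mu> \<in> carrier (mpoly_ring T)"
    using 1(1,2) 2(1,2) by (simp add: mpoly_closed mpoly_closed_single)
  moreover have "Poly_Mapping.keys (\<mu> + \<nu>) \<subseteq> T" using 1(1,2) 2(1,2) by (simp add: keys_add_nat)
  ultimately show ?thesis unfolding level_def
    by (intro exI[of _ "\<mu> + \<nu>"] exI[of _ "p * ?s \<nu> + q * ?s \<mu>"]) simp
qed

lemma level_mult:
  assumes "level T \<omega> s y" "level T \<omega> s' z"
  shows "level T \<omega> (s + s') (y * z)"
proof -
  obtain \<mu> p where 1: "Poly_Mapping.keys \<mu> \<subseteq> T" "p \<in> carrier (mpoly_ring T)"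
    "y * mono_eval (\<lambda>v. v) \<mu> = peval \<iota> (\<lambda>v. v) p" "\<And>m. m \<in> Poly_Mapping.keys p \<Longrightarrow> weight \<omega> m \<le> s + weight \<omega> \<mu>"
    using assms(1) unfolding level_def by blast
  obtain \<nu> q where 2: "Poly_Mapping.keys \<nu> \<subseteq> T" "q \<in> carrier (mpoly_ring T)"
    "z * mono_eval (\<lambda>v. v) \<nu> = peval \<iota> (\<lambda>v. v) q" "\<And>m. m \<in> Poly_Mapping.keys q \<Longrightarrow> weight \<omega> m \<le> s' + weight \<omega> \<nu>"
    using assms(2) unfolding level_def by blast
  have "weight \<omega> m \<le> (s + s') + weight \<omega> (\<mu> + \<nu>)" if m: "m \<in> Poly_Mapping.keys (p * q)" for m
  proof -
    obtain k l where kl: "k \<in> Poly_Mapping.keys p" "l \<in> Poly_Mapping.keys q" "m = k + l"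
      using m keys_mult[of p q] by auto
    then show ?thesis using 1(4)[OF kl(1)] 2(4)[OF kl(2)] by (simp add: weight_add)
  qed
  moreover have "(y * z) * mono_eval (\<lambda>v. v) (\<mu> + \<nu>) = peval \<iota> (\<lambda>v. v) (p * q)"
    by (simp add: peval_mult mono_eval_add mult_ac flip: 1(3) 2(3))
  moreover have "p * q \<in> carrier (mpoly_ring T)" using 1(1,2) 2(1,2) by (simp add: mpoly_closed)
  moreover have "Poly_Mapping.keys (\<mu> + \<nu>) \<subseteq> T" using 1(1,2) 2(1,2) by (simp add: keys_add_nat)
  ultimately show ?thesis unfolding level_def
    by (intro exI[of _ "\<mu> + \<nu>"] exI[of _ "p * q"]) simp
qed

text \<open>The factor \<open>t\<close> is moved into the denominator \<open>\<mu>\<close>. Applied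
  to a relation for \<open>v * w\<close> with \<open>w\<close> in the cluster, this turns a bound on
  the product into a bound on \<open>v\<close>.\<close>

lemma level_divide:
  assumes "level T \<omega> s (y * t)" "t \<in> T"
  shows "level T \<omega> (s - Poly_Mapping.lookup \<omega> t) y"
proof -
  obtain \<mu> p where 1: "Poly_Mapping.keys \<mu> \<subseteq> T" "p \<in> carrier (mpoly_ring T)"
    "y * t * mono_eval (\<lambda>v. v) \<mu> = peval \<iota> (\<lambda>v. v) p" "\<And>m. m \<in> Poly_Mapping.keys p \<Longrightarrow> weight \<omega> m \<le> s + weight \<omega> \<mu>"
    using assms(1) unfolding level_def by blast
  then show ?thesis unfolding level_def using assms(2)
    by (intro exI[of _ "Poly_Mapping.single t 1 + \<mu>"] exI[of _ p])
      (auto simp: keys_add_nat mono_eval_add weight_add mult.assoc)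
qed

lemma level_sum:
  assumes "\<And>i. i \<in> A \<Longrightarrow> level T \<omega> s (f i)"
  shows "level T \<omega> s (\<Sum>i\<in>A. f i)"
  using assms by (induction A rule: infinite_finite_induct) (auto intro: level_zero level_add)

lemma level_monomial:
  assumes "\<And>u. u \<in> Poly_Mapping.keys m \<Longrightarrow> level T \<omega> (Poly_Mapping.lookup \<omega> u) u"
  shows "level T \<omega> (weight \<omega> m) (mono_eval (\<lambda>v. v) m)"
  using assms
proof (induction m rule: exponent_induct)
  case zero
  then show ?case using level_const[of T \<omega> 1] by simp
next
  case (add v m)
  then have "level T \<omega> (weight \<omega> m) (mono_eval (\<lambda>v. v) m)" "level T \<omega> (Poly_Mapping.lookup \<omega> v) v"
    by (auto simp: keys_add_nat)
  from level_mult[OF this(2,1)] show ?case by (simp add: weight_add mono_eval_add)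
qed

lemma level_term:
  assumes "level T \<omega> s y"
  shows "level T \<omega> s (\<iota> c * y)"
  using level_mult[OF level_const assms] by simp

lemma level_strict_sum:
  assumes "finite A" "\<And>i. i \<in> A \<Longrightarrow> \<exists>s'<s. level T \<omega> s' (f i)"
  shows "\<exists>s'<s. level T \<omega> s' (\<Sum>i\<in>A. f i)"
proof -
  obtain h where h: "\<And>i. i \<in> A \<Longrightarrow> h i < s \<and> level T \<omega> (h i) (f i)" using assms(2) by metis
  \<comment> \<open>The entry \<open>s - 1\<close> keeps the maximum defined, and below
    \<open>s\<close>, when \<open>A\<close> is empty.\<close>
  define s' where "s' = Max (insert (s - 1) (h ` A))"
  have "s' < s" unfolding s'_def using assms(1) h by auto
  moreover have "level T \<omega> s' (f i)" if "i \<in> A" for i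
  proof -
    have "h i \<le> s'" unfolding s'_def using assms(1) that by auto
    then show ?thesis using h[OF that] level_mono by blast
  qed
  ultimately show ?thesis using level_sum by blast
qed

text \<open>One factor with a strict bound makes the whole product strict, as the bounds of the
  other factors add up.\<close>

lemma level_monomial_strict:
  assumes "\<And>u. u \<in> Poly_Mapping.keys m \<Longrightarrow> level T \<omega> (Poly_Mapping.lookup \<omega> u) u"
    and "u \<in> Poly_Mapping.keys m" "level T \<omega> s u" "s < Poly_Mapping.lookup \<omega> u"
  shows "\<exists>s'<weight \<omega> m. level T \<omega> s' (mono_eval (\<lambda>v. v) m)"
proof -
  obtain m' where m': "m = Poly_Mapping.single u 1 + m'" using assms(2) by (rule exponent_decomp)
  have "level T \<omega> (weight \<omega> m') (mono_eval (\<lambda>v. v) m')"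
    by (rule level_monomial) (use assms(1) m' in \<open>auto simp: keys_add_nat\<close>)
  from level_mult[OF assms(3) this] show ?thesis
    using assms(4) by (intro exI[of _ "s + weight \<omega> m'"]) (simp add: m' weight_add mono_eval_add)
qed

lemma relation_ideal_diff:
  assumes "v \<in> V" "w \<in> V" "g \<in> carrier (mpoly_ring V)" "peval \<iota> (\<lambda>v. v) g = v * w"
  shows "var v * var w - g \<in> relation_ideal \<iota> V"
  unfolding relation_ideal_def using assms
  by (simp add: peval_diff peval_mult var_closed mpoly_closed)

lemma initial_form_var_mult:
  assumes "\<And>m. m \<in> Poly_Mapping.keys g \<Longrightarrow> weight \<omega> m < Poly_Mapping.lookup \<omega> v + Poly_Mapping.lookup \<omega> w"
  shows "initial_form \<omega> (var v * var w - g) = (var v * var w :: ('v, 'k) mpoly)"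
proof -
  let ?m = "Poly_Mapping.single v 1 + Poly_Mapping.single w (1::nat)"
  have "weight \<omega> m < weight \<omega> ?m" if "m \<in> Poly_Mapping.keys g" for m
    using assms[OF that] by (simp add: weight_add)
  then have "initial_form \<omega> (Poly_Mapping.single ?m 1 - g) = Poly_Mapping.single ?m 1"
    by (rule initial_form_leading)
  then show ?thesis unfolding keys_var_mult by (simp add: var_def mult_single)
qed

text \<open>\<open>rel\<close> supplies relations in which weights drop, so that incompatible
  products are initial forms, and in which \<open>size\<close> drops, so that Laurent expansions can
  be bounded recursively. \<open>flag\<close> and \<open>indep\<close> then exclude compatible
  leading monomials.\<close>

lemma initial_ideal_eq_incompatibility_ideal:
  fixes V :: "'f set" and size :: "'f set \<Rightarrow> 'f \<Rightarrow> nat"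
  assumes cover: "V = \<Union> Cl"
    and indep: "\<And>T. T \<in> Cl \<Longrightarrow> alg_indep \<iota> T (\<lambda>v. v)"
    and flag: "\<And>A. finite A \<Longrightarrow> A \<subseteq> V \<Longrightarrow> \<forall>v\<in>A. \<forall>w\<in>A. common_cluster Cl v w \<Longrightarrow> \<exists>T\<in>Cl. A \<subseteq> T"
    and maximal: "\<And>T v. T \<in> Cl \<Longrightarrow> v \<in> V - T \<Longrightarrow> \<exists>w\<in>T. \<not> common_cluster Cl v w"
    and rel: "\<And>v w. v \<in> V \<Longrightarrow> w \<in> V \<Longrightarrow> \<not> common_cluster Cl v w \<Longrightarrow>
      \<exists>g\<in>carrier (mpoly_ring V). peval \<iota> (\<lambda>v. v) g = v * w \<and>
        (\<forall>m\<in>Poly_Mapping.keys g. weight \<omega> m < Poly_Mapping.lookup \<omega> v + Poly_Mapping.lookup \<omega> w \<and>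
          (\<forall>T\<in>Cl. w \<in> T \<longrightarrow> (\<forall>u\<in>Poly_Mapping.keys m. size T u < size T v)))"
  shows "initial_ideal V \<omega> (relation_ideal \<iota> V) = incompatibility_ideal V Cl"
proof
  interpret R: cring "mpoly_ring V :: ('f, 'k) mpoly ring" by (rule mpoly_ring_cring)
  \<comment> \<open>For \<open>w\<close> in \<open>T\<close> incompatible with \<open>v\<close>, the
    relation for \<open>v * w\<close> involves only variables of smaller size, whose levels are
    known by induction; division by \<open>w\<close> bounds \<open>v\<close>.\<close>
  have strict: "\<exists>s<Poly_Mapping.lookup \<omega> v. level T \<omega> s v" if T: "T \<in> Cl" and vT: "v \<in> V - T" for T v
    using vT
  proof (induction "size T v" arbitrary: v rule: less_induct)
    case less
    obtain w where w: "w \<in> T" "\<not> common_cluster Cl v w" using maximal[OF T less(2)] by blast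
    have "w \<in> V" using w(1) T cover by blast
    then obtain g where g: "g \<in> carrier (mpoly_ring V)" "peval \<iota> (\<lambda>v. v) g = v * w"
      "\<And>m. m \<in> Poly_Mapping.keys g \<Longrightarrow> weight \<omega> m < Poly_Mapping.lookup \<omega> v + Poly_Mapping.lookup \<omega> w"
      "\<And>m u. m \<in> Poly_Mapping.keys g \<Longrightarrow> u \<in> Poly_Mapping.keys m \<Longrightarrow> size T u < size T v"
      using rel[of v w] w less(2) T by blast
    have u: "level T \<omega> (Poly_Mapping.lookup \<omega> u) u" if mu: "m \<in> Poly_Mapping.keys g" "u \<in> Poly_Mapping.keys m" for m u
    proof (cases "u \<in> T")
      case True
      then show ?thesis by (rule level_var)
    next
      case False
      have "u \<in> V" using g(1) mu unfolding mpoly_carrier by blast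
      then obtain s where "s < Poly_Mapping.lookup \<omega> u" "level T \<omega> s u"
        using less(1)[OF g(4)[OF mu]] False by blast
      then show ?thesis by (rule level_mono[OF _ less_imp_le, rotated])
    qed
    have "\<exists>s<Poly_Mapping.lookup \<omega> v + Poly_Mapping.lookup \<omega> w. level T \<omega> s (v * w)"
      unfolding g(2)[symmetric] peval_def mono_eval_def[symmetric]
    proof (rule level_strict_sum)
      fix m assume m: "m \<in> Poly_Mapping.keys g"
      have "level T \<omega> (weight \<omega> m) (\<iota> (Poly_Mapping.lookup g m) * mono_eval (\<lambda>v. v) m)"
        by (rule level_term, rule level_monomial, rule u[OF m])
      then show "\<exists>s<Poly_Mapping.lookup \<omega> v + Poly_Mapping.lookup \<omega> w.
          level T \<omega> s (\<iota> (Poly_Mapping.lookup g m) * mono_eval (\<lambda>v. v) m)"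
        using g(3)[OF m] by blast
    qed simp
    then obtain s where s: "s < Poly_Mapping.lookup \<omega> v + Poly_Mapping.lookup \<omega> w" "level T \<omega> s (v * w)"
      by blast
    from level_divide[OF s(2) w(1)] show ?case using s(1) by (intro exI[of _ "s - Poly_Mapping.lookup \<omega> w"]) simp
  qed
  have weak: "level T \<omega> (Poly_Mapping.lookup \<omega> v) v" if T: "T \<in> Cl" and vV: "v \<in> V" for T v
  proof (cases "v \<in> T")
    case False
    then obtain s where "s < Poly_Mapping.lookup \<omega> v" "level T \<omega> s v"
      using strict[OF T, of v] vV by blast
    then show ?thesis by (rule level_mono[OF _ less_imp_le, rotated])
  qed (rule level_var)
  have nonstandard: "\<not> standard Cl M"
    if f: "f \<in> relation_ideal \<iota> V" and M: "M \<in> Poly_Mapping.keys (initial_form \<omega> f)" for f M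
  proof
    assume std: "standard Cl M"
    let ?ev = "mono_eval (\<lambda>v. v)"
    have fV: "f \<in> carrier (mpoly_ring V)" and f0: "peval \<iota> (\<lambda>v. v) f = 0"
      using f by (auto simp: relation_ideal_def)
    have Mf: "M \<in> Poly_Mapping.keys f" and top: "\<And>m. m \<in> Poly_Mapping.keys f \<Longrightarrow> weight \<omega> m \<le> weight \<omega> M"
      using M by (auto simp: keys_initial_form)
    have "Poly_Mapping.keys M \<subseteq> V" using fV Mf by (simp add: mpoly_carrier)
    then obtain T where T: "T \<in> Cl" "Poly_Mapping.keys M \<subseteq> T"
      using flag[of "Poly_Mapping.keys M"] std unfolding standard_def by auto
    \<comment> \<open>The terms in \<open>A\<close> are already monomials in the cluster
      \<open>T\<close>; each term in \<open>B\<close> has a factor outside \<open>T\<close> and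
      hence level strictly below the leading weight.\<close>
    define A where "A = {m \<in> Poly_Mapping.keys f. Poly_Mapping.keys m \<subseteq> T}"
    define B where "B = Poly_Mapping.keys f - A"
    have fin: "finite A" "finite B" unfolding A_def B_def by auto
    have "\<exists>s<weight \<omega> M. level T \<omega> s (\<iota> (Poly_Mapping.lookup f m) * ?ev m)" if mB: "m \<in> B" for m
    proof -
      obtain u where u: "u \<in> Poly_Mapping.keys m" "u \<notin> T" and mf: "m \<in> Poly_Mapping.keys f"
        using mB unfolding A_def B_def by blast
      have mV: "Poly_Mapping.keys m \<subseteq> V" using fV mf by (simp add: mpoly_carrier)
      obtain s where s: "s < Poly_Mapping.lookup \<omega> u" "level T \<omega> s u" using strict[OF T(1)] u mV by blast
      have "\<exists>s<weight \<omega> m. level T \<omega> s (?ev m)"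
        by (rule level_monomial_strict[OF _ u(1) s(2,1)]) (use weak[OF T(1)] mV in blast)
      then obtain s' where "s' < weight \<omega> m" "level T \<omega> s' (\<iota> (Poly_Mapping.lookup f m) * ?ev m)"
        using level_term by blast
      then show ?thesis using top[OF mf] by (intro exI[of _ s']) simp
    qed
    then obtain s where s: "s < weight \<omega> M" "level T \<omega> s (\<Sum>m\<in>B. \<iota> (Poly_Mapping.lookup f m) * ?ev m)"
      using level_strict_sum[OF fin(2), of "weight \<omega> M" T \<omega> "\<lambda>m. \<iota> (Poly_Mapping.lookup f m) * ?ev m"] by blast
    then obtain \<mu> p where p: "Poly_Mapping.keys \<mu> \<subseteq> T" "p \<in> carrier (mpoly_ring T)"
      "(\<Sum>m\<in>B. \<iota> (Poly_Mapping.lookup f m) * ?ev m) * ?ev \<mu> = peval \<iota> (\<lambda>v. v) p"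
      "\<And>m. m \<in> Poly_Mapping.keys p \<Longrightarrow> weight \<omega> m \<le> s + weight \<omega> \<mu>"
      unfolding level_def by blast
    \<comment> \<open>\<open>q\<close> is the relation multiplied by the common denominator
      \<open>\<mu>\<close> of the terms in \<open>B\<close>, written in the variables of
      \<open>T\<close> only.\<close>
    define q where "q = (\<Sum>m\<in>A. Poly_Mapping.single (m + \<mu>) (Poly_Mapping.lookup f m)) + p"
    have "q \<in> carrier (mpoly_ring T)"
      unfolding q_def using p(1,2) A_def
      by (intro mpoly_closed mpoly_closed_sum mpoly_closed_single) (auto simp: keys_add_nat)
    moreover have "peval \<iota> (\<lambda>v. v) q = 0"
    proof -
      have "peval \<iota> (\<lambda>v. v) q = (\<Sum>m\<in>A. \<iota> (Poly_Mapping.lookup f m) * ?ev m) * ?ev \<mu>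
          + (\<Sum>m\<in>B. \<iota> (Poly_Mapping.lookup f m) * ?ev m) * ?ev \<mu>"
        unfolding q_def peval_add peval_sum p(3)[symmetric]
        by (simp add: mono_eval_add sum_distrib_right mult.assoc)
      also have "\<dots> = (\<Sum>m\<in>A \<union> B. \<iota> (Poly_Mapping.lookup f m) * ?ev m) * ?ev \<mu>"
        using fin by (subst sum.union_disjoint) (auto simp: B_def distrib_right)
      also have "A \<union> B = Poly_Mapping.keys f" unfolding A_def B_def by blast
      also have "(\<Sum>m\<in>Poly_Mapping.keys f. \<iota> (Poly_Mapping.lookup f m) * ?ev m) = 0"
        using f0 unfolding peval_def mono_eval_def .
      finally show ?thesis by simp
    qed
    ultimately have "q = 0" using indep[OF T(1)] unfolding alg_indep_def by blast
    \<comment> \<open>The part from \<open>B\<close> is too light to reach \<open>M + \<mu>\<close>,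
      and distinct monomials in \<open>A\<close> stay distinct after multiplication by
      \<open>\<mu>\<close>. So the coefficient of \<open>M\<close> in \<open>f\<close> survives in
      \<open>q = 0\<close>.\<close>
    have "Poly_Mapping.lookup p (M + \<mu>) = 0"
      using p(4)[of "M + \<mu>"] s(1) by (auto simp: in_keys_iff weight_add)
    moreover have "Poly_Mapping.lookup (\<Sum>m\<in>A. Poly_Mapping.single (m + \<mu>) (Poly_Mapping.lookup f m)) (M + \<mu>)
        = (\<Sum>m\<in>A. if m = M then Poly_Mapping.lookup f M else 0)"
      unfolding lookup_sum by (intro sum.cong) (auto simp: lookup_single when_def)
    moreover have "M \<in> A" using Mf T(2) by (simp add: A_def)
    ultimately have "Poly_Mapping.lookup q (M + \<mu>) = Poly_Mapping.lookup f M"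
      unfolding q_def using fin by (simp add: lookup_add)
    then show False using \<open>q = 0\<close> Mf by (simp add: in_keys_iff)
  qed
  have init_carrier: "initial_form \<omega> f \<in> carrier (mpoly_ring V)" if "f \<in> carrier (mpoly_ring V)"
    for f :: "('f, 'k) mpoly"
    using that by (auto simp: mpoly_carrier keys_initial_form)
  have sub: "initial_form \<omega> ` relation_ideal \<iota> V \<subseteq> incompatibility_ideal V Cl"
  proof
    fix h assume "h \<in> initial_form \<omega> ` relation_ideal \<iota> V"
    then obtain f where f: "f \<in> relation_ideal \<iota> V" "h = initial_form \<omega> f" by blast
    then have "h \<in> carrier (mpoly_ring V)" using init_carrier[of f] by (simp add: relation_ideal_def)
    then show "h \<in> incompatibility_ideal V Cl"
      using nonstandard[OF f(1)] f(2) by (simp add: incompatibility_ideal_iff[OF cover])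
  qed
  have gens: "{var v * var w | v w. v \<in> V \<and> w \<in> V \<and> \<not> (\<exists>c\<in>Cl. v \<in> c \<and> w \<in> c)} \<subseteq> carrier (mpoly_ring V :: ('f, 'k) mpoly ring)"
  proof
    fix h :: "('f, 'k) mpoly"
    assume "h \<in> {var v * var w | v w. v \<in> V \<and> w \<in> V \<and> \<not> (\<exists>c\<in>Cl. v \<in> c \<and> w \<in> c)}"
    then obtain v w where "h = var v * var w" "v \<in> V" "w \<in> V" by blast
    then show "h \<in> carrier (mpoly_ring V)" by (simp only: mpoly_closed(6) var_closed)
  qed
  have "ideal (incompatibility_ideal V Cl :: ('f, 'k) mpoly set) (mpoly_ring V)"
    unfolding incompatibility_ideal_def by (rule R.genideal_ideal[OF gens])
  then show "initial_ideal V \<omega> (relation_ideal \<iota> V) \<subseteq> incompatibility_ideal V Cl"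
    unfolding initial_ideal_def using sub by (rule R.genideal_minimal)
  have inV: "initial_form \<omega> ` relation_ideal \<iota> V \<subseteq> carrier (mpoly_ring V)"
    by (auto simp: relation_ideal_def intro: init_carrier)
  show "incompatibility_ideal V Cl \<subseteq> initial_ideal V \<omega> (relation_ideal \<iota> V)"
    unfolding incompatibility_ideal_def
  proof (rule R.genideal_minimal)
    show "ideal (initial_ideal V \<omega> (relation_ideal \<iota> V)) (mpoly_ring V)"
      unfolding initial_ideal_def by (rule R.genideal_ideal[OF inV])
    have "var v * var w \<in> initial_ideal V \<omega> (relation_ideal \<iota> V)"
      if vw: "v \<in> V" "w \<in> V" "\<not> common_cluster Cl v w" for v w
    proof -
      obtain g where g: "g \<in> carrier (mpoly_ring V)" "peval \<iota> (\<lambda>v. v) g = v * w"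
        and gm: "\<forall>m\<in>Poly_Mapping.keys g. weight \<omega> m < Poly_Mapping.lookup \<omega> v + Poly_Mapping.lookup \<omega> w \<and>
          (\<forall>T\<in>Cl. w \<in> T \<longrightarrow> (\<forall>u\<in>Poly_Mapping.keys m. size T u < size T v))"
        using rel[OF vw] by (elim bexE conjE)
      have "initial_form \<omega> (var v * var w - g) = var v * var w"
        by (rule initial_form_var_mult) (rule conjunct1[OF bspec[OF gm]])
      moreover have "initial_form \<omega> (var v * var w - g) \<in> initial_form \<omega> ` relation_ideal \<iota> V"
        by (rule imageI) (rule relation_ideal_diff[OF vw(1,2) g(1,2)])
      ultimately have "var v * var w \<in> initial_form \<omega> ` relation_ideal \<iota> V" by (simp only:)
      then show ?thesis unfolding initial_ideal_def by (rule subsetD[OF R.genideal_self[OF inV]])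
    qed
    then show "{var v * var w | v w. v \<in> V \<and> w \<in> V \<and> \<not> (\<exists>c\<in>Cl. v \<in> c \<and> w \<in> c)}
        \<subseteq> initial_ideal V \<omega> (relation_ideal \<iota> V)"
      unfolding common_cluster_def by blast
  qed
qed

text \<open>Every monomial of an initial form lies in the incompatibility ideal, and
  \<open>v * w\<close> is the only non-standard monomial of the relation \<open>v * w - g\<close>.
  It is therefore the unique heaviest one.\<close>

lemma initial_ideal_eq_imp_less:
  fixes V :: "'f set"
  assumes cover: "V = \<Union> Cl"
    and eq: "initial_ideal V \<omega> (relation_ideal \<iota> V) = incompatibility_ideal V Cl"
    and vw: "v \<in> V" "w \<in> V" "\<not> common_cluster Cl v w"
    and g: "g \<in> carrier (mpoly_ring V)" "peval \<iota> (\<lambda>v. v) g = v * w"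
    and std: "\<And>m. m \<in> Poly_Mapping.keys g \<Longrightarrow> standard Cl m"
    and M: "M \<in> Poly_Mapping.keys g"
  shows "weight \<omega> M < Poly_Mapping.lookup \<omega> v + Poly_Mapping.lookup \<omega> w"
proof -
  interpret R: cring "mpoly_ring V :: ('f, 'k) mpoly ring" by (rule mpoly_ring_cring)
  let ?m = "Poly_Mapping.single v 1 + Poly_Mapping.single w (1::nat)"
  let ?f = "var v * var w - g"
  have f: "?f \<in> relation_ideal \<iota> V"
    by (rule relation_ideal_diff[OF vw(1,2) g])
  have "initial_form \<omega> ` relation_ideal \<iota> V \<subseteq> carrier (mpoly_ring V)"
    by (auto simp: mpoly_carrier keys_initial_form relation_ideal_def)
  then have "initial_form \<omega> ?f \<in> incompatibility_ideal V Cl"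
    using R.genideal_self[of "initial_form \<omega> ` relation_ideal \<iota> V"] f eq unfolding initial_ideal_def by blast
  then have nonstd: "\<not> standard Cl m" if "m \<in> Poly_Mapping.keys (initial_form \<omega> ?f)" for m
    using that by (simp add: incompatibility_ideal_iff[OF cover])
  have "\<not> standard Cl ?m" using vw(3) unfolding standard_def by (auto simp: keys_add_nat)
  then have mg: "?m \<notin> Poly_Mapping.keys g" using std by blast
  have keys: "Poly_Mapping.lookup ?f k = (if k = ?m then 1 else - Poly_Mapping.lookup g k)" for k
  proof (cases "k = ?m")
    case True
    then show ?thesis unfolding keys_var_mult using mg by (simp add: lookup_minus in_keys_iff)
  next
    case False
    then show ?thesis unfolding keys_var_mult by (simp add: lookup_minus lookup_single)
  qed
  have Mf: "M \<in> Poly_Mapping.keys ?f" using M mg by (auto simp: in_keys_iff keys)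
  have "M \<notin> Poly_Mapping.keys (initial_form \<omega> ?f)" using nonstd std[OF M] by blast
  have "Max (weight \<omega> ` Poly_Mapping.keys ?f) \<in> weight \<omega> ` Poly_Mapping.keys ?f"
    using Mf by (intro Max_in) auto
  then obtain t where t: "t \<in> Poly_Mapping.keys ?f" "weight \<omega> t = Max (weight \<omega> ` Poly_Mapping.keys ?f)"
    by auto
  have top: "weight \<omega> k \<le> weight \<omega> t" if "k \<in> Poly_Mapping.keys ?f" for k
    using that by (simp add: t(2))
  have "t \<in> Poly_Mapping.keys (initial_form \<omega> ?f)" using t(1) top by (simp add: keys_initial_form)
  then have "\<not> standard Cl t" by (rule nonstd)
  then have "t \<notin> Poly_Mapping.keys g" using std by blast
  then have "t = ?m" using t(1) by (auto simp: in_keys_iff keys split: if_splits)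
  moreover have "weight \<omega> M < weight \<omega> t"
  proof -
    obtain k where "k \<in> Poly_Mapping.keys ?f" "weight \<omega> M < weight \<omega> k"
      using \<open>M \<notin> _\<close> Mf unfolding keys_initial_form by (auto simp: not_le)
    then show ?thesis using top by fastforce
  qed
  ultimately show ?thesis by (simp add: weight_add)
qed

end

section \<open>Integer coordinates on the polygon\<close>

text \<open>Vertices are arbitrary integers read modulo \<open>N\<close>. Points in cyclic order
  then become an increasing sequence inside a window of length \<open>N\<close>, and rotations
  become translations.\<close>

definition seg :: "nat \<Rightarrow> int \<Rightarrow> int \<Rightarrow> nat set" where
  "seg N i j = {nat (i mod int N), nat (j mod int N)}"

lemma seg_commute: "seg N i j = seg N j i"
  by (auto simp: seg_def)

lemma seg_shift: "seg N (i + int N) j = seg N i j" "seg N i (j + int N) = seg N i j"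
  by (auto simp: seg_def)

lemma seg_shift_minus: "seg N (i - int N) j = seg N i j" "seg N i (j - int N) = seg N i j"
  using seg_shift(1)[of N "i - int N" j] seg_shift(2)[of N i "j - int N"] by simp_all

lemma mod_window:
  assumes "(x::int) mod n = y mod n" "\<bar>x - y\<bar> < n"
  shows "x = y"
proof -
  have "n dvd x - y" using assms(1) by (simp add: mod_eq_dvd_iff)
  show ?thesis
  proof (rule ccontr)
    assume "x \<noteq> y"
    then have "\<bar>n\<bar> \<le> \<bar>x - y\<bar>" using \<open>n dvd x - y\<close> by (intro dvd_imp_le_int) simp_all
    then show False using assms(2) by linarith
  qed
qed

lemma nat_mod_eq_iff: "N > 0 \<Longrightarrow> nat (i mod int N) = nat (j mod int N) \<longleftrightarrow> i mod int N = j mod int N"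
  by (simp add: eq_nat_nat_iff)

lemma seg_window_eq_iff:
  assumes "N > 0" "w \<le> i" "i < j" "j < w + int N" "w \<le> p" "p < q" "q < w + int N"
  shows "seg N i j = seg N p q \<longleftrightarrow> i = p \<and> j = q"
proof
  assume "seg N i j = seg N p q"
  then have "(i mod int N = p mod int N \<and> j mod int N = q mod int N) \<or>
      (i mod int N = q mod int N \<and> j mod int N = p mod int N)"
    unfolding seg_def doubleton_eq_iff nat_mod_eq_iff[OF assms(1)] .
  moreover have "i mod int N = p mod int N \<longrightarrow> i = p" "j mod int N = q mod int N \<longrightarrow> j = q"
    "i mod int N = q mod int N \<longrightarrow> i = q" "j mod int N = p mod int N \<longrightarrow> j = p"
    by (rule impI, rule mod_window, assumption, use assms in linarith)+
  ultimately show "i = p \<and> j = q" using assms(3,6) by linarith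
qed simp

lemma window_exists:
  assumes "N > 0"
  obtains k where "w \<le> k" "k < w + int N" "k mod int N = i mod int N"
proof
  let ?k = "w + (i - w) mod int N"
  show "w \<le> ?k" "?k < w + int N" using assms by simp_all
  show "?k mod int N = i mod int N" by (simp add: mod_simps)
qed

lemma segments_window:
  assumes "N > 0" "l \<in> segments N"
  obtains i j where "w \<le> i" "i < j" "j < w + int N" "l = seg N i j"
proof -
  obtain a b where ab: "a < N" "b < N" "a \<noteq> b" "l = {a, b}" using assms(2) unfolding segments_def by blast
  obtain i where i: "w \<le> i" "i < w + int N" "i mod int N = int a mod int N" using window_exists[OF assms(1)] by blast
  obtain j where j: "w \<le> j" "j < w + int N" "j mod int N = int b mod int N" using window_exists[OF assms(1)] by blast
  have l: "l = seg N i j" unfolding seg_def i(3) j(3) using ab by simp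
  have "i \<noteq> j" using i(3) j(3) ab by auto
  then consider "i < j" | "j < i" by linarith
  then show ?thesis
  proof cases
    case 1
    then show ?thesis using that[OF i(1) _ j(2) l] by blast
  next
    case 2
    have "l = seg N j i" using l by (simp only: seg_commute)
    then show ?thesis using that[OF j(1) 2 i(2)] by blast
  qed
qed

lemma seg_in_segments:
  assumes "i < j" "j < i + int N"
  shows "seg N i j \<in> segments N"
proof -
  have N: "N > 0" using assms by simp
  have "i mod int N \<noteq> j mod int N" using mod_window[of i "int N" j] assms by auto
  then show ?thesis unfolding segments_def seg_def mem_Collect_eq
    using N nat_mod_eq_iff[OF N]
    by (intro exI[of _ "nat (i mod int N)"] exI[of _ "nat (j mod int N)"]) (simp add: nat_less_iff)
qed

lemma segI:
  assumes "l \<in> segments N" "N > 0"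
  obtains i j where "i < j" "j < i + int N" "l = seg N i j"
proof -
  obtain i j where "0 \<le> i" "i < j" "j < 0 + int N" "l = seg N i j" using segments_window[OF assms(2,1)] .
  then show thesis using that[of i j] by simp
qed

lemma edges_eq:
  assumes "N > 0"
  shows "edges N = {seg N i (i + 1) | i. True}"
proof -
  have A: "{i, (i + 1) mod N} = seg N (int i) (int i + 1)" if "i < N" for i
  proof -
    have "nat ((int i + 1) mod int N) = (i + 1) mod N"
      by (metis nat_int of_nat_1 of_nat_add zmod_int)
    then show ?thesis using that by (simp add: seg_def)
  qed
  have B: "\<exists>k<N. seg N i (i + 1) = seg N (int k) (int k + 1)" for i
    using assms by (intro exI[of _ "nat (i mod int N)"]) (simp add: seg_def nat_less_iff mod_simps)
  have "u \<in> edges N \<longleftrightarrow> (\<exists>i<N. u = seg N (int i) (int i + 1))" for u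
    unfolding edges_def mem_Collect_eq using A by metis
  then show ?thesis using B by blast
qed

lemma seg_edge: "N > 0 \<Longrightarrow> seg N i (i + 1) \<in> edges N"
  by (auto simp: edges_eq)

lemma seg_edges_iff:
  assumes "i < j" "j < i + int N"
  shows "seg N i j \<in> edges N \<longleftrightarrow> j = i + 1 \<or> j = i + int N - 1"
proof
  have N: "N > 0" using assms by simp
  { assume "seg N i j \<in> edges N"
    then obtain k0 where k0: "seg N i j = seg N k0 (k0 + 1)" using edges_eq[OF N] by auto
    obtain k where k: "i \<le> k" "k < i + int N" "k mod int N = k0 mod int N" using window_exists[OF N] by blast
    have "(k + 1) mod int N = (k0 + 1) mod int N" using k(3) by (metis mod_add_left_eq)
    then have "seg N k (k + 1) = seg N k0 (k0 + 1)" using k(3) unfolding seg_def by simp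
    then have e: "seg N i j = seg N k (k + 1)" using k0 by simp
    show "j = i + 1 \<or> j = i + int N - 1"
    proof (cases "k + 1 < i + int N")
      case True
      then show ?thesis using e seg_window_eq_iff[OF N, of i i j k "k + 1"] assms k by simp
    next
      case False
      then have "k = i + int N - 1" using k by simp
      then have "seg N i j = seg N i k" using e seg_shift(2)[of N k i] by (simp add: seg_commute)
      then show ?thesis using seg_window_eq_iff[OF N, of i i j i k] assms k \<open>k = _\<close> by auto
    qed }
  { assume "j = i + 1 \<or> j = i + int N - 1"
    moreover have "seg N i (i + int N - 1) = seg N (i - 1) (i - 1 + 1)"
      using seg_shift(1)[of N "i - 1" i] by (simp add: seg_commute algebra_simps)
    ultimately show "seg N i j \<in> edges N" using seg_edge[OF N] by metis }
qed

lemma seg_diagonals_iff: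
  assumes "i < j" "j < i + int N"
  shows "seg N i j \<in> diagonals N \<longleftrightarrow> i + 2 \<le> j \<and> j \<le> i + int N - 2"
  unfolding diagonals_def using seg_in_segments[OF assms] seg_edges_iff[OF assms] assms by auto

lemma edges_subset_segments: "N > 1 \<Longrightarrow> edges N \<subseteq> segments N"
  using edges_eq[of N] seg_in_segments[of _ _ N] by fastforce

lemma arc_mod:
  assumes "N > 0"
  shows "arc N (nat (i mod int N)) (nat (j mod int N)) = nat ((j - i) mod int N)"
proof -
  have "int (arc N (nat (i mod int N)) (nat (j mod int N))) = (j mod int N + int N - i mod int N) mod int N"
    unfolding arc_def using assms
    by (subst zmod_int, subst of_nat_diff) (simp_all add: le_nat_iff trans_le_add2 nat_le_iff add_increasing less_imp_le)
  also have "j mod int N + int N - i mod int N = (j mod int N - i mod int N) + int N" by simp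
  also have "\<dots> mod int N = (j - i) mod int N" by (simp only: mod_add_self2 mod_diff_eq)
  finally show ?thesis by simp
qed

lemma arc_window:
  assumes "i \<le> j" "j < i + int N"
  shows "arc N (nat (i mod int N)) (nat (j mod int N)) = nat (j - i)"
  using assms by (subst arc_mod) (auto simp: mod_pos_pos_trivial)

lemma ccw_window:
  assumes "\<forall>z\<in>set zs. a \<le> z \<and> z < a + int N" "sorted_wrt (<) zs" "zs \<noteq> []" "hd zs = a"
  shows "ccw N (map (\<lambda>z. nat (z mod int N)) zs)"
proof -
  have N: "N > 0" using assms by (cases zs) auto
  have h: "hd (map (\<lambda>z. nat (z mod int N)) zs) = nat (a mod int N)" using assms by (cases zs) auto
  have "sorted_wrt (<) (map (\<lambda>z. nat (z - a)) zs)"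
    unfolding sorted_wrt_map using assms(2)
    by (rule sorted_wrt_mono_rel[rotated]) (use assms(1) in auto)
  also have "map (\<lambda>z. nat (z - a)) zs = map (arc N (nat (a mod int N))) (map (\<lambda>z. nat (z mod int N)) zs)"
    using assms(1) by (auto simp: arc_window)
  finally show ?thesis unfolding ccw_def h using N by (auto simp: nat_less_iff)
qed

lemma ccwE4:
  assumes "ccw N [a, b, c, d]"
  obtains b' c' d' where "int a < b'" "b' < c'" "c' < d'" "d' < int a + int N"
    "a = nat (int a mod int N)" "b = nat (b' mod int N)" "c = nat (c' mod int N)" "d = nat (d' mod int N)"
proof -
  have lt: "a < N" "b < N" "c < N" "d < N" and N: "N > 0"
    and s: "arc N a a < arc N a b" "arc N a b < arc N a c" "arc N a c < arc N a d"
    using assms by (auto simp: ccw_def)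
  have arc_eq: "z = nat ((int a + int (arc N a z)) mod int N)" if "z < N" for z
  proof -
    have "int a + int (arc N a z) = int a + (int z + int N - int a) mod int N"
      unfolding arc_def using lt that by (simp add: zmod_int of_nat_diff)
    then have "(int a + int (arc N a z)) mod int N = int z" using that by (simp add: mod_simps)
    then show ?thesis by simp
  qed
  have "arc N a a = 0" using lt by (simp add: arc_def)
  moreover have "arc N a d < N" unfolding arc_def using N by simp
  ultimately show ?thesis
    using that[of "int a + int (arc N a b)" "int a + int (arc N a c)" "int a + int (arc N a d)"]
      s arc_eq lt by auto
qed

text \<open>The window start \<open>w\<close> can be prescribed, but it normalises only
  \<open>a\<close>; the later endpoints may lie beyond the window.\<close>

lemma crosses_iff:
  assumes "N > 0"
  shows "crosses N l m \<longleftrightarrow> (\<exists>a b c d. w \<le> a \<and> a < w + int N \<and> a < b \<and> b < c \<and> c < d \<and> d < a + int N \<and>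
    l = seg N a c \<and> m = seg N b d)"
proof
  assume "crosses N l m"
  then obtain a0 b0 c0 d0 where ccw: "ccw N [a0, b0, c0, d0]" and lm: "l = {a0, c0}" "m = {b0, d0}"
    unfolding crosses_def by blast
  from ccw obtain b' c' d' where 1: "int a0 < b'" "b' < c'" "c' < d'" "d' < int a0 + int N"
    "a0 = nat (int a0 mod int N)" "b0 = nat (b' mod int N)" "c0 = nat (c' mod int N)" "d0 = nat (d' mod int N)"
    by (rule ccwE4)
  obtain a where a: "w \<le> a" "a < w + int N" "a mod int N = int a0 mod int N" using window_exists[OF assms] by blast
  have sh: "(z + (a - int a0)) mod int N = z mod int N" for z
  proof -
    have "int N dvd a - int a0" using a(3) by (simp add: mod_eq_dvd_iff)
    then show ?thesis by (simp add: mod_eq_dvd_iff)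
  qed
  have "l = seg N a (c' + (a - int a0))" "m = seg N (b' + (a - int a0)) (d' + (a - int a0))"
    unfolding lm seg_def sh a(3) using 1(5-8) by simp_all
  then show "\<exists>a b c d. w \<le> a \<and> a < w + int N \<and> a < b \<and> b < c \<and> c < d \<and> d < a + int N \<and>
    l = seg N a c \<and> m = seg N b d"
    using a 1(1-4) by (rule_tac exI[of _ a], rule_tac exI[of _ "b' + (a - int a0)"],
      rule_tac exI[of _ "c' + (a - int a0)"], rule_tac exI[of _ "d' + (a - int a0)"]) simp
next
  assume "\<exists>a b c d. w \<le> a \<and> a < w + int N \<and> a < b \<and> b < c \<and> c < d \<and> d < a + int N \<and>
    l = seg N a c \<and> m = seg N b d"
  then obtain a b c d where "a < b" "b < c" "c < d" "d < a + int N" "l = seg N a c" "m = seg N b d" by blast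
  then show "crosses N l m" unfolding crosses_def seg_def
    using ccw_window[of "[a, b, c, d]" a N] by auto
qed

lemma crossesI: "a < b \<Longrightarrow> b < c \<Longrightarrow> c < d \<Longrightarrow> d < a + int N \<Longrightarrow> crosses N (seg N a c) (seg N b d)"
  by (subst crosses_iff[of N _ _ a], simp, rule_tac exI[of _ a], rule_tac exI[of _ b],
    rule_tac exI[of _ c], rule_tac exI[of _ d]) simp

lemma crossesE:
  assumes "crosses N l m"
  obtains a b c d where "a < b" "b < c" "c < d" "d < a + int N" "l = seg N a c" "m = seg N b d"
proof -
  have "N > 0" using assms by (auto simp: crosses_def ccw_def)
  then have "\<exists>a b c d. 0 \<le> a \<and> a < 0 + int N \<and> a < b \<and> b < c \<and> c < d \<and> d < a + int N \<and>
    l = seg N a c \<and> m = seg N b d"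
    using assms by (simp only: crosses_iff[of N l m 0])
  then show ?thesis by (elim exE conjE) (rule that)
qed

lemma crosses_sym: "crosses N l m \<Longrightarrow> crosses N m l"
proof -
  assume "crosses N l m"
  then obtain a b c d where "a < b" "b < c" "c < d" "d < a + int N" "l = seg N a c" "m = seg N b d"
    by (rule crossesE)
  moreover from this have "crosses N (seg N b d) (seg N c (a + int N))" by (intro crossesI) simp_all
  moreover have "seg N c (a + int N) = seg N a c" by (simp only: seg_shift seg_commute[of N c a])
  ultimately show ?thesis by simp
qed

text \<open>Crossing becomes interlacing of integer intervals. All later facts about configurations
  of segments are decided by linear arithmetic through this equivalence.\<close>

lemma crosses_window:
  assumes "N > 0" "w \<le> i" "i < j" "j < w + int N" "w \<le> p" "p < q" "q < w + int N"
  shows "crosses N (seg N i j) (seg N p q) \<longleftrightarrow> i < p \<and> p < j \<and> j < q \<or> p < i \<and> i < q \<and> q < j"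
proof
  assume "crosses N (seg N i j) (seg N p q)"
  then obtain a b c d where *: "w \<le> a" "a < w + int N" "a < b" "b < c" "c < d" "d < a + int N"
    "seg N i j = seg N a c" "seg N p q = seg N b d"
    unfolding crosses_iff[OF assms(1), of "seg N i j" "seg N p q" w] by (elim exE conjE)
  have eq1: "i = x \<and> j = y" if "seg N i j = seg N x y" "w \<le> x" "x < y" "y < w + int N" for x y
    using seg_window_eq_iff[OF assms(1-4) that(2-4)] that(1) by blast
  have eq2: "p = x \<and> q = y" if "seg N p q = seg N x y" "w \<le> x" "x < y" "y < w + int N" for x y
    using seg_window_eq_iff[OF assms(1,5-7) that(2-4)] that(1) by blast
  \<comment> \<open>The cases count how many of \<open>b\<close>, \<open>c\<close>, \<open>d\<close>
    have passed the end of the window and must be moved back by \<open>N\<close>.\<close>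
  consider "d < w + int N" | "c < w + int N" "w + int N \<le> d" | "b < w + int N" "w + int N \<le> c" | "w + int N \<le> b"
    by linarith
  then show "i < p \<and> p < j \<and> j < q \<or> p < i \<and> i < q \<and> q < j"
  proof cases
    case 1
    have "i = a \<and> j = c" by (rule eq1[OF *(7)]) (use * 1 in linarith)+
    moreover have "p = b \<and> q = d" by (rule eq2[OF *(8)]) (use * 1 in linarith)+
    ultimately show ?thesis using * by linarith
  next
    case 2
    have e: "seg N p q = seg N (d - int N) b" using *(8) by (metis seg_commute seg_shift_minus(2))
    have "i = a \<and> j = c" by (rule eq1[OF *(7)]) (use * 2 in linarith)+
    moreover have "p = d - int N \<and> q = b" by (rule eq2[OF e]) (use * 2 in linarith)+
    ultimately show ?thesis using * by linarith
  next
    case 3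
    have e: "seg N p q = seg N (d - int N) b" "seg N i j = seg N (c - int N) a"
      using *(7,8) by (metis seg_commute seg_shift_minus(2))+
    have "i = c - int N \<and> j = a" by (rule eq1[OF e(2)]) (use * 3 in linarith)+
    moreover have "p = d - int N \<and> q = b" by (rule eq2[OF e(1)]) (use * 3 in linarith)+
    ultimately show ?thesis using * by linarith
  next
    case 4
    have e: "seg N p q = seg N (b - int N) (d - int N)" "seg N i j = seg N (c - int N) a"
      using *(7,8) by (metis seg_commute seg_shift_minus)+
    have "i = c - int N \<and> j = a" by (rule eq1[OF e(2)]) (use * 4 in linarith)+
    moreover have "p = b - int N \<and> q = d - int N" by (rule eq2[OF e(1)]) (use * 4 in linarith)+
    ultimately show ?thesis using * by linarith
  qed
next
  assume "i < p \<and> p < j \<and> j < q \<or> p < i \<and> i < q \<and> q < j"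
  then show "crosses N (seg N i j) (seg N p q)"
    using crossesI[of i p j q N] crosses_sym[OF crossesI[of p i q j N]] assms by auto
qed

section \<open>The half-turn of a polygon with an even number of vertices\<close>

lemma antipode_seg:
  assumes "N = 2 * h" "h > 0"
  shows "antipode N ` seg N i j = seg N (i + int h) (j + int h)"
proof -
  have "antipode N (nat (z mod int N)) = nat ((z + int h) mod int N)" for z
  proof -
    have "int (antipode N (nat (z mod int N))) = (z mod int N + int h) mod int N"
      unfolding antipode_def using assms by (simp add: zmod_int)
    then show ?thesis by (simp add: mod_simps)
  qed
  then show ?thesis by (simp add: seg_def)
qed

lemma crosses_antipode:
  assumes "N = 2 * h" "h > 0" "crosses N l m"
  shows "crosses N (antipode N ` l) (antipode N ` m)"
proof -
  obtain a b c d where "a < b" "b < c" "c < d" "d < a + int N" "l = seg N a c" "m = seg N b d"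
    using assms(3) by (rule crossesE)
  then show ?thesis using crossesI[of "a + int h" "b + int h" "c + int h" "d + int h" N]
    by (simp add: antipode_seg[OF assms(1,2)])
qed

lemma antipode_antipode:
  assumes "N = 2 * h" "h > 0" "l \<in> segments N"
  shows "antipode N ` antipode N ` l = l"
proof -
  have "N > 0" using assms by simp
  obtain i j where "i < j" "j < i + int N" and l: "l = seg N i j" by (rule segI[OF assms(3) \<open>N > 0\<close>])
  have "seg N (i + int h + int h) (j + int h + int h) = seg N (i + int N) (j + int N)"
    using assms(1) by (simp add: algebra_simps)
  then show ?thesis unfolding l antipode_seg[OF assms(1,2)] by (simp add: seg_shift)
qed

lemma antipode_diagonals:
  assumes "N = 2 * h" "h > 0" "l \<in> diagonals N"
  shows "antipode N ` l \<in> diagonals N"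
proof -
  have N: "N > 0" using assms by simp
  have "l \<in> segments N" using assms(3) by (simp add: diagonals_def)
  then obtain i j where l: "i < j" "j < i + int N" "l = seg N i j" using N by (rule segI)
  then show ?thesis using assms(3) seg_diagonals_iff[of i j N] seg_diagonals_iff[of "i + int h" "j + int h" N]
    by (simp add: antipode_seg[OF assms(1,2)])
qed

lemma antipode_segments:
  assumes "N = 2 * h" "h > 0" "l \<in> segments N"
  shows "antipode N ` l \<in> segments N"
proof -
  have N: "N > 0" using assms by simp
  obtain i j where l: "i < j" "j < i + int N" "l = seg N i j" using assms(3) N by (rule segI)
  then show ?thesis using seg_in_segments[of "i + int h" "j + int h" N]
    by (simp add: antipode_seg[OF assms(1,2)])
qed

text \<open>This allows a segment to be inserted into a centrally symmetric noncrossing set together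
  with its image. The cases record whether none, one or both of the translated endpoints leave the
  window.\<close>

lemma not_crosses_antipode:
  assumes "N = 2 * h" "h > 0" "l \<in> segments N"
  shows "\<not> crosses N l (antipode N ` l)"
proof -
  have N: "N > 0" using assms by simp
  obtain i j where l: "0 \<le> i" "i < j" "j < 0 + int N" "l = seg N i j" using segments_window[OF N assms(3), of 0] .
  have bar: "antipode N ` l = seg N (i + int h) (j + int h)" by (simp add: l(4) antipode_seg[OF assms(1,2)])
  have cr: "\<not> crosses N l (seg N p q)" if "0 \<le> p" "p < q" "q < 0 + int N"
    "q \<le> i \<or> j \<le> p \<or> p \<le> i \<and> j \<le> q \<or> i \<le> p \<and> q \<le> j" for p q
    using crosses_window[OF N l(1-3) that(1-3)] that(4) l(4) by auto
  have h: "int N = 2 * int h" "int h > 0" using assms(1,2) by simp_all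
  consider "j + int h < int N" | "i + int h < int N" "int N \<le> j + int h" | "int N \<le> i + int h" by linarith
  then show ?thesis
  proof cases
    case 1
    show ?thesis unfolding bar by (rule cr) (use l h 1 in linarith)+
  next
    case 2
    have "seg N (i + int h) (j + int h) = seg N (j + int h - int N) (i + int h)"
      by (metis seg_shift_minus(2) seg_commute)
    moreover have "\<not> crosses N l (seg N (j + int h - int N) (i + int h))"
      by (rule cr) (use l h 2 in linarith)+
    ultimately show ?thesis unfolding bar by simp
  next
    case 3
    have "seg N (i + int h) (j + int h) = seg N (i + int h - int N) (j + int h - int N)"
      by (simp only: seg_shift_minus)
    moreover have "\<not> crosses N l (seg N (i + int h - int N) (j + int h - int N))"
      by (rule cr) (use l h 3 in linarith)+
    ultimately show ?thesis unfolding bar by simp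
  qed
qed

section \<open>Completing noncrossing sets to triangulations\<close>

lemma finite_segments: "finite (segments N)"
proof (rule finite_subset)
  show "segments N \<subseteq> Pow {..<N}" by (auto simp: segments_def)
qed simp

lemma finite_diagonals: "finite (diagonals N)"
  by (simp add: diagonals_def finite_segments)

lemma crosses_irrefl: "\<not> crosses N l l"
proof
  assume "crosses N l l"
  then obtain a b c d where "a < b" "b < c" "c < d" "d < a + int N" "l = seg N a c" "l = seg N b d"
    by (rule crossesE)
  then show False using seg_window_eq_iff[of N a a c b d] by auto
qed

text \<open>An invariant noncrossing set of largest cardinality is a triangulation: a diagonal
  crossing none of its members could be added together with its image. The involution
  \<open>f\<close> is abstract so as to cover both the identity and the half-turn.\<close>

lemma triangulation_extend:
  assumes A: "A \<subseteq> diagonals N" "\<forall>l\<in>A. \<forall>m\<in>A. \<not> crosses N l m"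
    and f: "\<And>l. l \<in> diagonals N \<Longrightarrow> f l \<in> diagonals N" "\<And>l. l \<in> diagonals N \<Longrightarrow> f (f l) = l"
      "\<And>l m. l \<in> diagonals N \<Longrightarrow> m \<in> diagonals N \<Longrightarrow> crosses N l m \<Longrightarrow> crosses N (f l) (f m)"
      "\<And>l. l \<in> diagonals N \<Longrightarrow> \<not> crosses N l (f l)"
    and fA: "f ` A = A"
  shows "\<exists>T. A \<subseteq> T \<and> triangulation N T \<and> f ` T = T"
proof -
  define P where "P T \<longleftrightarrow> A \<subseteq> T \<and> T \<subseteq> diagonals N \<and> (\<forall>l\<in>T. \<forall>m\<in>T. \<not> crosses N l m) \<and> f ` T = T" for T
  have "P A" unfolding P_def using A fA by blast
  moreover have "card T < Suc (card (diagonals N))" if "P T" for T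
    using that finite_diagonals[of N] unfolding P_def by (simp add: card_mono le_imp_less_Suc)
  ultimately obtain T where T: "P T" and max: "\<And>T'. P T' \<Longrightarrow> card T' \<le> card T"
    using ex_has_greatest_nat[of P A card "Suc (card (diagonals N))"] by blast
  have "\<exists>m\<in>T. crosses N l m" if l: "l \<in> diagonals N - T" for l
  proof (rule ccontr)
    assume "\<not> (\<exists>m\<in>T. crosses N l m)"
    then have nc: "\<And>m. m \<in> T \<Longrightarrow> \<not> crosses N l m" by blast
    have TD: "T \<subseteq> diagonals N" and fT: "f ` T = T" using T unfolding P_def by auto
    have lD: "l \<in> diagonals N" using l by simp
    have nc': "\<not> crosses N (f l) m" if "m \<in> T" for m
    proof
      assume "crosses N (f l) m"
      then have "crosses N (f (f l)) (f m)" using f(1)[OF lD] that TD by (intro f(3)) auto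
      then have "crosses N l (f m)" using f(2)[OF lD] by simp
      moreover have "f m \<in> T" using fT that by blast
      ultimately show False using nc by blast
    qed
    let ?T = "insert l (insert (f l) T)"
    have "P ?T" unfolding P_def
    proof (intro conjI)
      have TT: "\<And>x y. x \<in> T \<Longrightarrow> y \<in> T \<Longrightarrow> \<not> crosses N x y" using T unfolding P_def by blast
      have fl: "\<not> crosses N l (f l)" "\<not> crosses N (f l) l"
        using f(4)[OF lD] crosses_sym by blast+
      have nc2: "\<And>m. m \<in> T \<Longrightarrow> \<not> crosses N m l" "\<And>m. m \<in> T \<Longrightarrow> \<not> crosses N m (f l)"
        using nc nc' crosses_sym by blast+
      show "\<forall>x\<in>?T. \<forall>y\<in>?T. \<not> crosses N x y"
        by (simp add: TT nc nc' nc2 fl crosses_irrefl)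
      show "f ` ?T = ?T" using fT f(2)[OF lD] by (simp add: insert_commute)
      show "A \<subseteq> ?T" using T unfolding P_def by blast
      show "?T \<subseteq> diagonals N" using TD lD f(1)[OF lD] by blast
    qed
    then have "card ?T \<le> card T" by (rule max)
    moreover have "finite T" using TD finite_diagonals finite_subset by blast
    moreover have "card (insert l T) \<le> card ?T"
      using \<open>finite T\<close> by (intro card_mono) auto
    ultimately show False using l by simp
  qed
  moreover have "A \<subseteq> T" "T \<subseteq> diagonals N" "\<forall>l\<in>T. \<forall>m\<in>T. \<not> crosses N l m" "f ` T = T"
    using T unfolding P_def by simp_all
  ultimately show ?thesis by (intro exI[of _ T]) (simp add: triangulation_def)
qed

section \<open>Counting crossings\<close>

text \<open>Entering the triangle spanned by this side and \<open>b\<close>, \<open>d\<close>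
  without crossing \<open>[b, d]\<close>, the segment must leave through the third side or end at
  the vertex opposite to \<open>s\<close>. Either way it separates \<open>a\<close> from
  \<open>c\<close>.\<close>

lemma side_crosses:
  assumes o: "a < b" "b < c" "c < d" "d < a + int N"
    and t: "t \<in> segments N" "\<not> crosses N t (seg N b d)"
    and s: "s \<in> {seg N a b, seg N b c, seg N c d, seg N a d}" "crosses N t s"
  shows "crosses N t (seg N a c)"
proof -
  have N: "N > 0" using o by simp
  obtain p q where pq: "a \<le> p" "p < q" "q < a + int N" "t = seg N p q" using segments_window[OF N t(1), of a] .
  have cr: "crosses N (seg N p q) (seg N i j) \<longleftrightarrow> p < i \<and> i < q \<and> q < j \<or> i < p \<and> p < j \<and> j < q"
    if "a \<le> i" "i < j" "j < a + int N" for i j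
    using crosses_window[OF N pq(1-3), of i j] that by auto
  have ab: "crosses N (seg N p q) (seg N a b) \<longleftrightarrow> p < a \<and> a < q \<and> q < b \<or> a < p \<and> p < b \<and> b < q"
    by (rule cr) (use o in linarith)+
  have bc: "crosses N (seg N p q) (seg N b c) \<longleftrightarrow> p < b \<and> b < q \<and> q < c \<or> b < p \<and> p < c \<and> c < q"
    by (rule cr) (use o in linarith)+
  have cd: "crosses N (seg N p q) (seg N c d) \<longleftrightarrow> p < c \<and> c < q \<and> q < d \<or> c < p \<and> p < d \<and> d < q"
    by (rule cr) (use o in linarith)+
  have ad: "crosses N (seg N p q) (seg N a d) \<longleftrightarrow> p < a \<and> a < q \<and> q < d \<or> a < p \<and> p < d \<and> d < q"
    by (rule cr) (use o in linarith)+
  have bd: "crosses N (seg N p q) (seg N b d) \<longleftrightarrow> p < b \<and> b < q \<and> q < d \<or> b < p \<and> p < d \<and> d < q"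
    by (rule cr) (use o in linarith)+
  have ac: "crosses N (seg N p q) (seg N a c) \<longleftrightarrow> p < a \<and> a < q \<and> q < c \<or> a < p \<and> p < c \<and> c < q"
    by (rule cr) (use o in linarith)+
  show ?thesis
    using s(1) s(2) t(2) o pq(1-3) unfolding pq(4)
    by (elim insertE emptyE; simp only: ab bc cd ad bd ac; linarith)
qed

lemma side_not_crosses:
  assumes o: "a < b" "b < c" "c < d" "d < a + int N"
    and s: "s \<in> {seg N a b, seg N b c, seg N c d, seg N a d}"
  shows "\<not> crosses N (seg N b d) s"
proof -
  have N: "N > 0" using o by simp
  have cr: "crosses N (seg N b d) (seg N i j) \<longleftrightarrow> b < i \<and> i < d \<and> d < j \<or> i < b \<and> b < j \<and> j < d"
    if "a \<le> i" "i < j" "j < a + int N" for i j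
    using crosses_window[OF N _ _ _ that, of b d] o by auto
  have ab: "crosses N (seg N b d) (seg N a b) \<longleftrightarrow> b < a \<and> a < d \<and> d < b \<or> a < b \<and> b < b \<and> b < d"
    by (rule cr) (use o in linarith)+
  have bc: "crosses N (seg N b d) (seg N b c) \<longleftrightarrow> b < b \<and> b < d \<and> d < c \<or> b < b \<and> b < c \<and> c < d"
    by (rule cr) (use o in linarith)+
  have cd: "crosses N (seg N b d) (seg N c d) \<longleftrightarrow> b < c \<and> c < d \<and> d < d \<or> c < b \<and> b < d \<and> d < d"
    by (rule cr) (use o in linarith)+
  have ad: "crosses N (seg N b d) (seg N a d) \<longleftrightarrow> b < a \<and> a < d \<and> d < d \<or> a < b \<and> b < d \<and> d < d"
    by (rule cr) (use o in linarith)+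
  show ?thesis using s o
    by (elim insertE emptyE; simp only: ab bc cd ad; linarith)
qed

lemma rotate_quad:
  assumes "a < b" "b < c" "c < d" "d < a + int N"
  shows "b < c" "c < d" "d < a + int N" "a + int N < b + int N"
  using assms by auto

text \<open>For a triangulation containing \<open>[a, c]\<close> and its image, this bounds the
  crossings of all segments on the right of the type B relation between the diameter at
  \<open>b\<close> and \<open>[a, c]\<close>.\<close>

lemma diameter_crosses:
  assumes N: "N = 2 * h" "h > 0" and o: "a < b" "b < c" "c < a + int h"
    and t: "t \<in> segments N" "\<not> crosses N t (seg N a c)" "\<not> crosses N t (seg N (a + int h) (c + int h))"
    and s: "s \<in> {seg N a (a + int h), seg N c (c + int h), seg N a b, seg N b c,
      seg N (a + int h) (b + int h), seg N (b + int h) (c + int h)}" "crosses N t s"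
  shows "crosses N t (seg N b (b + int h))"
proof -
  have N0: "N > 0" using N by simp
  obtain p q where pq: "a \<le> p" "p < q" "q < a + int N" "t = seg N p q" using segments_window[OF N0 t(1), of a] .
  have cr: "crosses N (seg N p q) (seg N i j) \<longleftrightarrow> p < i \<and> i < q \<and> q < j \<or> i < p \<and> p < j \<and> j < q"
    if "a \<le> i" "i < j" "j < a + 2 * int h" for i j
    using crosses_window[OF N0 pq(1-3), of i j] that N by auto
  have h: "a + int N = a + 2 * int h" using N by simp
  have h0: "int h > 0" using N by simp
  have f1: "crosses N (seg N p q) (seg N a (a + int h)) \<longleftrightarrow> p < a \<and> a < q \<and> q < a + int h \<or> a < p \<and> p < a + int h \<and> a + int h < q"
    by (rule cr) (use o h0 in linarith)+
  have f2: "crosses N (seg N p q) (seg N c (c + int h)) \<longleftrightarrow> p < c \<and> c < q \<and> q < c + int h \<or> c < p \<and> p < c + int h \<and> c + int h < q"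
    by (rule cr) (use o h0 in linarith)+
  have f3: "crosses N (seg N p q) (seg N a b) \<longleftrightarrow> p < a \<and> a < q \<and> q < b \<or> a < p \<and> p < b \<and> b < q"
    by (rule cr) (use o h0 in linarith)+
  have f4: "crosses N (seg N p q) (seg N b c) \<longleftrightarrow> p < b \<and> b < q \<and> q < c \<or> b < p \<and> p < c \<and> c < q"
    by (rule cr) (use o h0 in linarith)+
  have f5: "crosses N (seg N p q) (seg N (a + int h) (b + int h)) \<longleftrightarrow> p < a + int h \<and> a + int h < q \<and> q < b + int h \<or> a + int h < p \<and> p < b + int h \<and> b + int h < q"
    by (rule cr) (use o h0 in linarith)+
  have f6: "crosses N (seg N p q) (seg N (b + int h) (c + int h)) \<longleftrightarrow> p < b + int h \<and> b + int h < q \<and> q < c + int h \<or> b + int h < p \<and> p < c + int h \<and> c + int h < q"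
    by (rule cr) (use o h0 in linarith)+
  have f7: "crosses N (seg N p q) (seg N a c) \<longleftrightarrow> p < a \<and> a < q \<and> q < c \<or> a < p \<and> p < c \<and> c < q"
    by (rule cr) (use o h0 in linarith)+
  have f8: "crosses N (seg N p q) (seg N (a + int h) (c + int h)) \<longleftrightarrow> p < a + int h \<and> a + int h < q \<and> q < c + int h \<or> a + int h < p \<and> p < c + int h \<and> c + int h < q"
    by (rule cr) (use o h0 in linarith)+
  have f9: "crosses N (seg N p q) (seg N b (b + int h)) \<longleftrightarrow> p < b \<and> b < q \<and> q < b + int h \<or> b < p \<and> p < b + int h \<and> b + int h < q"
    by (rule cr) (use o h0 in linarith)+
  show ?thesis
    using s(1) s(2) t(2,3) o pq(1-3) h h0 unfolding pq(4)
    by (elim insertE emptyE; simp only: f1 f2 f3 f4 f5 f6 f7 f8 f9; linarith)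
qed

text \<open>Such a \<open>t\<close> joins the open arc from \<open>a\<close> to \<open>b\<close> to
  the opposite arc, hence separates \<open>a\<close> and \<open>b\<close> from each other and
  crosses both diameters. It shows that members of a suitable triangulation cannot cross a segment
  and its image, so that their crossings are counted disjointly.\<close>

lemma crosses_opposite_sides:
  assumes N: "N = 2 * h" "h > 0" and o: "a < b" "b < a + int h"
    and t: "t \<in> segments N" "crosses N t (seg N a b)" "crosses N t (seg N (a + int h) (b + int h))"
  shows "crosses N t (seg N a (a + int h)) \<and> crosses N t (seg N b (b + int h)) \<and>
    (\<forall>c. b < c \<and> c < a + int h \<longrightarrow> crosses N t (seg N a c))"
proof -
  have N0: "N > 0" using N by simp
  obtain p q where pq: "a \<le> p" "p < q" "q < a + int N" "t = seg N p q" using segments_window[OF N0 t(1), of a] .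
  have cr: "crosses N (seg N p q) (seg N i j) \<longleftrightarrow> p < i \<and> i < q \<and> q < j \<or> i < p \<and> p < j \<and> j < q"
    if "a \<le> i" "i < j" "j < a + 2 * int h" for i j
    using crosses_window[OF N0 pq(1-3), of i j] that N by auto
  have h: "a + int N = a + 2 * int h" using N by simp
  have h0: "int h > 0" using N by simp
  have f1: "crosses N (seg N p q) (seg N a (a + int h)) \<longleftrightarrow> p < a \<and> a < q \<and> q < a + int h \<or> a < p \<and> p < a + int h \<and> a + int h < q"
    by (rule cr) (use o h0 in linarith)+
  have f2: "crosses N (seg N p q) (seg N b (b + int h)) \<longleftrightarrow> p < b \<and> b < q \<and> q < b + int h \<or> b < p \<and> p < b + int h \<and> b + int h < q"
    by (rule cr) (use o h0 in linarith)+
  have f3: "crosses N (seg N p q) (seg N a b) \<longleftrightarrow> p < a \<and> a < q \<and> q < b \<or> a < p \<and> p < b \<and> b < q"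
    by (rule cr) (use o h0 in linarith)+
  have f4: "crosses N (seg N p q) (seg N (a + int h) (b + int h)) \<longleftrightarrow> p < a + int h \<and> a + int h < q \<and> q < b + int h \<or> a + int h < p \<and> p < b + int h \<and> b + int h < q"
    by (rule cr) (use o h0 in linarith)+
  have t': "a < p" "p < b" "a + int h < q" "q < b + int h"
    using t(2,3) o pq(1-3) h h0 unfolding pq(4) by (simp only: f3 f4; linarith)+
  have "crosses N t (seg N a c)" if "b < c" "c < a + int h" for c
  proof -
    have f5: "crosses N (seg N p q) (seg N a c) \<longleftrightarrow> p < a \<and> a < q \<and> q < c \<or> a < p \<and> p < c \<and> c < q"
      by (rule cr) (use o h0 that in linarith)+
    show ?thesis unfolding pq(4) f5 using t' that by linarith
  qed
  moreover have "crosses N t (seg N a (a + int h)) \<and> crosses N t (seg N b (b + int h))"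
    unfolding pq(4) f1 f2 using t' o by linarith
  ultimately show ?thesis by blast
qed

text \<open>The companion of \<open>diameter_crosses\<close> for triangulations that contain the
  diameter at \<open>b\<close>: crossings of the neighbouring diameters are charged to
  \<open>[a, c]\<close> or to its image.\<close>

lemma diameter_crosses_side:
  assumes N: "N = 2 * h" "h > 0" and o: "a < b" "b < c" "c < a + int h"
    and t: "t \<in> segments N" "\<not> crosses N t (seg N b (b + int h))"
    and s: "crosses N t (seg N c (c + int h)) \<or> crosses N t (seg N a (a + int h))"
  shows "crosses N t (seg N a c) \<or> crosses N t (seg N (a + int h) (c + int h))"
proof -
  have N0: "N > 0" using N by simp
  obtain p q where pq: "a \<le> p" "p < q" "q < a + int N" "t = seg N p q" using segments_window[OF N0 t(1), of a] .
  have cr: "crosses N (seg N p q) (seg N i j) \<longleftrightarrow> p < i \<and> i < q \<and> q < j \<or> i < p \<and> p < j \<and> j < q"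
    if "a \<le> i" "i < j" "j < a + 2 * int h" for i j
    using crosses_window[OF N0 pq(1-3), of i j] that N by auto
  have h: "a + int N = a + 2 * int h" using N by simp
  have h0: "int h > 0" using N by simp
  have f1: "crosses N (seg N p q) (seg N a (a + int h)) \<longleftrightarrow> p < a \<and> a < q \<and> q < a + int h \<or> a < p \<and> p < a + int h \<and> a + int h < q"
    by (rule cr) (use o h0 in linarith)+
  have f2: "crosses N (seg N p q) (seg N c (c + int h)) \<longleftrightarrow> p < c \<and> c < q \<and> q < c + int h \<or> c < p \<and> p < c + int h \<and> c + int h < q"
    by (rule cr) (use o h0 in linarith)+
  have f3: "crosses N (seg N p q) (seg N a c) \<longleftrightarrow> p < a \<and> a < q \<and> q < c \<or> a < p \<and> p < c \<and> c < q"
    by (rule cr) (use o h0 in linarith)+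
  have f4: "crosses N (seg N p q) (seg N (a + int h) (c + int h)) \<longleftrightarrow> p < a + int h \<and> a + int h < q \<and> q < c + int h \<or> a + int h < p \<and> p < c + int h \<and> c + int h < q"
    by (rule cr) (use o h0 in linarith)+
  have f5: "crosses N (seg N p q) (seg N b (b + int h)) \<longleftrightarrow> p < b \<and> b < q \<and> q < b + int h \<or> b < p \<and> p < b + int h \<and> b + int h < q"
    by (rule cr) (use o h0 in linarith)+
  show ?thesis
    using s t(2) o pq(1-3) h h0 unfolding pq(4)
    by (elim disjE; simp only: f1 f2 f3 f4 f5; linarith)
qed

text \<open>The type B relation for \<open>[i, j]\<close> and the segment from \<open>k\<close> to
  the antipode of \<open>l\<close> involves \<open>[i, l]\<close>, which is not a side of their
  quadrilateral. Its crossings are therefore compared using the half-turn images as well.\<close>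

lemma double_crossing_side:
  assumes N: "N = 2 * h" "h > 0" and o: "i < l" "l < k" "k < j" "j < i + int h"
    and t: "t \<in> segments N"
    and s: "crosses N t (seg N i l)"
  shows "\<not> crosses N t (seg N k (l + int h)) \<Longrightarrow> \<not> crosses N t (seg N (k - int h) l) \<Longrightarrow> crosses N t (seg N i j)"
    "\<not> crosses N t (seg N i j) \<Longrightarrow> crosses N t (seg N (k - int h) l)"
proof -
  have N0: "N > 0" using N by simp
  let ?w = "k - int h"
  obtain p q where pq: "?w \<le> p" "p < q" "q < ?w + int N" "t = seg N p q" using segments_window[OF N0 t(1), of ?w] .
  have cr: "crosses N (seg N p q) (seg N i j) \<longleftrightarrow> p < i \<and> i < q \<and> q < j \<or> i < p \<and> p < j \<and> j < q"
    if "?w \<le> i" "i < j" "j < ?w + 2 * int h" for i j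
    using crosses_window[OF N0 pq(1-3), of i j] that N by auto
  have h: "?w + int N = k + int h" using N by simp
  have h0: "int h > 0" using N by simp
  have f1: "crosses N (seg N p q) (seg N i l) \<longleftrightarrow> p < i \<and> i < q \<and> q < l \<or> i < p \<and> p < l \<and> l < q"
    by (rule cr) (use o h0 in linarith)+
  have f2: "crosses N (seg N p q) (seg N (k - int h) l) \<longleftrightarrow> p < k - int h \<and> k - int h < q \<and> q < l \<or> k - int h < p \<and> p < l \<and> l < q"
    by (rule cr) (use o h0 in linarith)+
  have f3: "crosses N (seg N p q) (seg N i j) \<longleftrightarrow> p < i \<and> i < q \<and> q < j \<or> i < p \<and> p < j \<and> j < q"
    by (rule cr) (use o h0 in linarith)+
  have f4: "crosses N (seg N p q) (seg N k (l + int h)) \<longleftrightarrow> p < k \<and> k < q \<and> q < l + int h \<or> k < p \<and> p < l + int h \<and> l + int h < q"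
    by (rule cr) (use o h0 in linarith)+
  show "\<not> crosses N t (seg N k (l + int h)) \<Longrightarrow> \<not> crosses N t (seg N (k - int h) l) \<Longrightarrow> crosses N t (seg N i j)"
    using s o pq(1-3) h h0 unfolding pq(4) f1 f2 f3 f4 by linarith
  show "\<not> crosses N t (seg N i j) \<Longrightarrow> crosses N t (seg N (k - int h) l)"
    using s o pq(1-3) h h0 unfolding pq(4) f1 f2 f3 f4 by linarith
qed

section \<open>Ptolemy relations in a centrally symmetric polygon\<close>

text \<open>Stated for an arbitrary codomain, since it is applied both to cluster variables and to
  weights.\<close>

lemma half_turn_flip:
  fixes X :: "int \<Rightarrow> int \<Rightarrow> 'f"
  assumes sym: "\<And>i j. X i j = X j i" and per: "\<And>i j. X (i + h) (j + h) = X i j"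
    and per2: "\<And>i j. X i (j + 2 * h) = X i j"
  shows "X u (v + h) = X v (u + h)"
proof -
  have "X u (v + h) = X (v + h) ((u - h) + h)" using sym[of u "v + h"] by simp
  also have "\<dots> = X v (u - h)" by (rule per)
  also have "\<dots> = X v (u - h + 2 * h)" by (rule per2[symmetric])
  also have "u - h + 2 * h = u + h" by simp
  finally show ?thesis .
qed

lemma full_turn:
  fixes X :: "int \<Rightarrow> int \<Rightarrow> 'f"
  assumes sym: "\<And>i j. X i j = X j i" and per2: "\<And>i j. X i (j + 2 * h) = X i j"
  shows "X u (v + h + h) = X v u"
proof -
  have "X u (v + h + h) = X u (v + 2 * h)" by (simp add: algebra_simps)
  also have "\<dots> = X v u" using per2[of u v] sym[of u v] by simp
  finally show ?thesis .
qed

text \<open>The three-term Pluecker relation among the 2x2 minors of four vectors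
  \<open>(y, z)\<close>, with a common factor \<open>D\<close> on every minor removed.\<close>

lemma pluecker_cancel:
  fixes D :: "'f::field"
  assumes "D \<noteq> 0" "D * p = y2 * z0 - y0 * z2" "D * q = y3 * z1 - y1 * z3" "D * r = y1 * z0 - y0 * z1"
    "D * s = y3 * z2 - y2 * z3" "D * t = y3 * z0 - y0 * z3" "D * u = y2 * z1 - y1 * z2"
  shows "p * q = r * s + t * u"
proof -
  have "D * D * (p * q) = (D * p) * (D * q)" by simp
  also have "\<dots> = (D * r) * (D * s) + (D * t) * (D * u)" unfolding assms by (simp add: algebra_simps)
  also have "\<dots> = D * D * (r * s + t * u)" by (simp add: algebra_simps)
  finally show ?thesis using assms(1) by simp
qed

lemma diameter_reduction:
  fixes D :: "'f::field"
  assumes "z * x = p * y + d * w" "D * d = y ^ 2 + z ^ 2" "Y * z = y * w + D * p" "z \<noteq> 0"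
  shows "D * x = y * Y + z * w"
proof -
  have "z * (D * x) = y * (D * p) + (D * d) * w" using assms(1) by (simp add: algebra_simps)
  also have "D * p = Y * z - y * w" using assms(3) by simp
  also have "y * (Y * z - y * w) + (D * d) * w = z * (y * Y + z * w)"
    unfolding assms(2) by (simp add: algebra_simps power2_eq_square)
  finally show ?thesis using assms(4) by simp
qed

text \<open>The coefficient 2 is the mixed term of the square of \<open>D * q = y + z\<close>; it is
  the origin of the coefficient 2 in the type B relation for double crossings.\<close>

lemma diameter_reduction_B:
  fixes D :: "'f::field"
  assumes "z * x = p * y + q ^ 2 * w" "D * q = y + z" "D ^ 2 * p = Y * z - y * w" "z \<noteq> 0"
  shows "D ^ 2 * x = y * Y + 2 * y * w + z * w"
proof -
  have "z * (D ^ 2 * x) = D ^ 2 * (z * x)" by simp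
  also have "\<dots> = (D ^ 2 * p) * y + (D * q) ^ 2 * w"
    unfolding assms(1) by (simp add: algebra_simps power_mult_distrib)
  also have "\<dots> = z * (y * Y + 2 * y * w + z * w)"
    unfolding assms(2,3) by (simp add: algebra_simps power2_eq_square)
  finally show ?thesis using assms(4) by simp
qed

lemma double_crossing_identity:
  fixes D :: "'f::field"
  assumes "D \<noteq> 0" "D ^ 2 * kl = il * ik + 2 * il * zk + zl * zk" "D ^ 2 * jl = il * ij + 2 * il * zj + zl * zj"
    "D ^ 2 * kj = ij * zk - ik * zj"
  shows "ij * kl = ik * jl + zl * kj + 2 * (kj * il)"
proof -
  have "D ^ 2 * (ij * kl) = ij * (D ^ 2 * kl)" by simp
  also have "\<dots> = ik * (D ^ 2 * jl) + zl * (D ^ 2 * kj) + 2 * ((D ^ 2 * kj) * il)"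
    unfolding assms by (simp add: algebra_simps)
  also have "\<dots> = D ^ 2 * (ik * jl + zl * kj + 2 * (kj * il))" by (simp add: algebra_simps)
  finally show ?thesis using assms(1) by simp
qed

text \<open>Relative to the diameter at \<open>a\<close>, every vertex \<open>a + k\<close> receives
  a vector \<open>(Y k, Z k)\<close> such that \<open>D\<close> times a segment is the minor of its
  two endpoints. The Ptolemy relation is then a Pluecker relation.\<close>

lemma ptolemy_type_C:
  fixes X :: "int \<Rightarrow> int \<Rightarrow> 'f::field" and h :: int
  assumes sym: "\<And>i j. X i j = X j i" and per: "\<And>i j. X (i + h) (j + h) = X i j"
    and per2: "\<And>i j. X i (j + 2 * h) = X i j"
    and nz: "\<And>i j. i < j \<Longrightarrow> j < i + 2 * h \<Longrightarrow> X i j \<noteq> 0"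
    and R2: "\<And>a b c. a < b \<Longrightarrow> b < c \<Longrightarrow> c < a + h \<Longrightarrow>
      X a c * X a (b + h) = X a b * X a (c + h) + X a (a + h) * X b c"
    and R3: "\<And>a b. a < b \<Longrightarrow> b < a + h \<Longrightarrow> X a (a + h) * X b (b + h) = X a b ^ 2 + X a (b + h) ^ 2"
    and o: "a < b" "b < c" "c < d" "d < a + 2 * h"
  shows "X a c * X b d = X a b * X c d + X a d * X b c"
proof -
  have h: "h > 0" using o by simp
  define D where "D = X a (a + h)"
  have D: "D \<noteq> 0" unfolding D_def using h by (intro nz) auto
  \<comment> \<open>\<open>Y\<close> and \<open>Z\<close> are the segments to the two ends of the
    diameter. Beyond the antipode of \<open>a\<close> the vector is the quarter turn
    \<open>(Z, -Y)\<close> of the one at \<open>k - h\<close>; this preserves minors, in accordance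
    with the invariance of \<open>X\<close> under the half-turn.\<close>
  define Y where "Y k = (if k = 0 then 0 else if k \<le> h then X a (a + k) else if k = 2 * h then 0 else X (a + k - h) (a + h))" for k
  define Z where "Z k = (if k < h then X (a + k) (a + h) else if k = h then 0 else - X a (a + k - h))" for k
  have Xah: "X a (a + k + h) = X (a + k) (a + h)" for k
    by (rule half_turn_flip[of X, OF sym per per2])
  have low: "D * X (a + i) (a + j) = Y j * Z i - Y i * Z j" if "0 \<le> i" "i < j" "j \<le> h" for i j
  proof (cases "i = 0 \<or> j = h")
    case True
    then show ?thesis using that h by (auto simp: Y_def Z_def D_def)
  next
    case False
    then have "X a (a + j) * X (a + i) (a + h) = X a (a + i) * X (a + j) (a + h) + D * X (a + i) (a + j)"
      using R2[of a "a + i" "a + j"] that unfolding Xah D_def by simp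
    then show ?thesis using that False by (simp add: Y_def Z_def)
  qed
  \<comment> \<open>For segments across the diameter: if \<open>i = k\<close> the formula is
    \<open>R3\<close>; otherwise \<open>R2\<close> based at \<open>a + i\<close> expresses the
    segment, and \<open>R2\<close> at \<open>a\<close> together with \<open>R3\<close> eliminates
    the auxiliary factors.\<close>
  have mid0: "D * X (a + i) (a + k + h) = X a (a + i) * X a (a + k) + X (a + i) (a + h) * X (a + k) (a + h)"
    if "0 < i" "i \<le> k" "k < h" for i k
  proof (cases "i = k")
    case True
    then show ?thesis using R3[of a "a + i"] that unfolding Xah D_def by (simp add: power2_eq_square)
  next
    case False
    have z: "X (a + i) (a + h) \<noteq> 0" using that by (intro nz) auto
    have "X (a + i) (a + h) * X (a + i) (a + k + h) = X (a + i) (a + k) * X (a + i) (a + h + h) + X (a + i) (a + i + h) * X (a + k) (a + h)"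
      using R2[of "a + i" "a + k" "a + h"] that False by simp
    moreover have "X (a + i) (a + h + h) = X a (a + i)" by (rule full_turn[of X, OF sym per2])
    moreover have "D * X (a + i) (a + i + h) = X a (a + i) ^ 2 + X (a + i) (a + h) ^ 2"
      using R3[of a "a + i"] that unfolding Xah D_def by simp
    moreover have "X a (a + k) * X (a + i) (a + h) = X a (a + i) * X (a + k) (a + h) + D * X (a + i) (a + k)"
      using R2[of a "a + i" "a + k"] that False unfolding Xah D_def by simp
    ultimately show ?thesis using z
      by (intro diameter_reduction[of "X (a + i) (a + h)" _ "X (a + i) (a + k)" "X a (a + i)" "X (a + i) (a + i + h)"]) simp_all
  qed
  have mid: "D * X (a + i) (a + k + h) = X a (a + i) * X a (a + k) + X (a + i) (a + h) * X (a + k) (a + h)"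
    if "0 < i" "0 < k" "i < h" "k < h" for i k
  proof (cases "i \<le> k")
    case True
    then show ?thesis using mid0 that by blast
  next
    case False
    have e: "X (a + i) (a + k + h) = X (a + k) (a + i + h)"
      by (rule half_turn_flip[of X, OF sym per per2])
    show ?thesis unfolding e using mid0[of k i] that False by (simp add: mult.commute)
  qed
  have high: "D * X (a + i) (a + j) = Y j * Z i - Y i * Z j" if "0 \<le> i" "i < h" "h < j" "j < 2 * h" for i j
  proof -
    have e: "a + (j - h) + h = a + j" "a + (j - h) = a + j - h" by simp_all
    have Yj: "Y j = X (a + j - h) (a + h)" and Zj: "Z j = - X a (a + j - h)"
      using that by (simp_all add: Y_def Z_def)
    show ?thesis
    proof (cases "i = 0")
      case True
      have "X a (a + j) = X (a + j - h) (a + h)" using Xah[of "j - h"] unfolding e(1) unfolding e(2) .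
      moreover have "Y i = 0" "Z i = D" using True h by (simp_all add: Y_def Z_def D_def)
      ultimately show ?thesis using True Yj by simp
    next
      case False
      have "D * X (a + i) (a + j) = X a (a + i) * X a (a + j - h) + X (a + i) (a + h) * X (a + j - h) (a + h)"
        using mid[of i "j - h"] that False unfolding e(1) unfolding e(2) by simp
      moreover have "Y i = X a (a + i)" "Z i = X (a + i) (a + h)" using that False by (simp_all add: Y_def Z_def)
      ultimately show ?thesis using Yj Zj by simp
    qed
  qed
  have top: "D * X (a + i) (a + j) = Y j * Z i - Y i * Z j" if "h \<le> i" "i < j" "j < 2 * h" for i j
  proof -
    have "X (a + i) (a + j) = X (a + (i - h)) (a + (j - h))"
      using per[of "a + (i - h)" "a + (j - h)"] by simp
    then show ?thesis using low[of "i - h" "j - h"] that h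
      by (auto simp: Y_def Z_def D_def algebra_simps)
  qed
  have all: "D * X (a + i) (a + j) = Y j * Z i - Y i * Z j" if "0 \<le> i" "i < j" "j < 2 * h" for i j
  proof -
    consider "j \<le> h" | "i < h" "h < j" | "h \<le> i" using that(2) by linarith
    then show ?thesis using low[of i j] high[of i j] top[of i j] that by cases simp_all
  qed
  define i j k where ijk: "i = b - a" "j = c - a" "k = d - a"
  have eqs: "D * X a c = Y j * Z 0 - Y 0 * Z j" "D * X b d = Y k * Z i - Y i * Z k"
    "D * X a b = Y i * Z 0 - Y 0 * Z i" "D * X c d = Y k * Z j - Y j * Z k"
    "D * X a d = Y k * Z 0 - Y 0 * Z k" "D * X b c = Y j * Z i - Y i * Z j"
    using all[of 0 j] all[of i k] all[of 0 i] all[of j k] all[of 0 k] all[of i j] o by (simp_all add: ijk)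
  show ?thesis by (rule pluecker_cancel[OF D eqs])
qed

lemma ptolemy_type_B_aux:
  fixes X :: "int \<Rightarrow> int \<Rightarrow> 'f::field" and h :: int
  assumes sym: "\<And>i j. X i j = X j i" and per: "\<And>i j. X (i + h) (j + h) = X i j"
    and per2: "\<And>i j. X i (j + 2 * h) = X i j"
    and nz: "\<And>i j. i < j \<Longrightarrow> j < i + 2 * h \<Longrightarrow> X i j \<noteq> 0"
    and R2: "\<And>a b c. a < b \<Longrightarrow> b < c \<Longrightarrow> c < a + h \<Longrightarrow>
      X a c * X a (b + h) = X a b * X a (c + h) + X a (a + h) ^ 2 * X b c"
    and R3: "\<And>a b. a < b \<Longrightarrow> b < a + h \<Longrightarrow> X a (a + h) * X b (b + h) = X a b + X a (b + h)"
    and o: "a < i" "i < k" "k < a + h"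
  shows "X a (a + h) ^ 2 * X i (k + h) = X a i * X a k + 2 * X a i * X k (a + h) + X i (a + h) * X k (a + h)"
    "X a (a + h) ^ 2 * X i k = X a k * X i (a + h) - X a i * X k (a + h)"
    "X a (a + h) * X i (i + h) = X a i + X i (a + h)"
    "X a (a + h) * X k (k + h) = X a k + X k (a + h)"
proof -
  have Xah: "X a (k + h) = X k (a + h)" for k
    by (rule half_turn_flip[of X, OF sym per per2])
  have z: "X i (a + h) \<noteq> 0" using o by (intro nz) auto
  have e1: "X i (a + h) * X i (k + h) = X i k * X i (a + h + h) + X i (i + h) ^ 2 * X k (a + h)"
    using R2[of i k "a + h"] o by simp
  have e2: "X i (a + h + h) = X a i" by (rule full_turn[of X, OF sym per2])
  show e3: "X a (a + h) * X i (i + h) = X a i + X i (a + h)"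
    using R3[of a i] o unfolding Xah[of i] by simp
  show "X a (a + h) * X k (k + h) = X a k + X k (a + h)"
    using R3[of a k] o unfolding Xah[of k] by simp
  show e4: "X a (a + h) ^ 2 * X i k = X a k * X i (a + h) - X a i * X k (a + h)"
    using R2[of a i k] o unfolding Xah[of i] Xah[of k] by (simp add: algebra_simps)
  show "X a (a + h) ^ 2 * X i (k + h) = X a i * X a k + 2 * X a i * X k (a + h) + X i (a + h) * X k (a + h)"
    by (rule diameter_reduction_B[OF e1[unfolded e2] e3 e4 z])
qed

text \<open>All segments are expanded relative to one diameter, the one at \<open>b\<close> for the
  first identity and the one at \<open>i\<close> for the second; clearing powers of that diameter
  leaves a polynomial identity.\<close>

lemma ptolemy_type_B:
  fixes X :: "int \<Rightarrow> int \<Rightarrow> 'f::field" and h :: int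
  assumes sym: "\<And>i j. X i j = X j i" and per: "\<And>i j. X (i + h) (j + h) = X i j"
    and per2: "\<And>i j. X i (j + 2 * h) = X i j"
    and nz: "\<And>i j. i < j \<Longrightarrow> j < i + 2 * h \<Longrightarrow> X i j \<noteq> 0"
    and R2: "\<And>a b c. a < b \<Longrightarrow> b < c \<Longrightarrow> c < a + h \<Longrightarrow>
      X a c * X a (b + h) = X a b * X a (c + h) + X a (a + h) ^ 2 * X b c"
    and R3: "\<And>a b. a < b \<Longrightarrow> b < a + h \<Longrightarrow> X a (a + h) * X b (b + h) = X a b + X a (b + h)"
  shows type_B_diameter: "\<And>a b c. a < b \<Longrightarrow> b < c \<Longrightarrow> c < a + h \<Longrightarrow>
      X b (b + h) * X a c = X a b * X c (c + h) + X b c * X a (a + h)"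
    and type_B_double: "\<And>i l k j. i < l \<Longrightarrow> l < k \<Longrightarrow> k < j \<Longrightarrow> j < i + h \<Longrightarrow>
      X i j * X k (l + h) = X i k * X j (l + h) + X i (l + h) * X k j + 2 * (X k j * X i l)"
proof -
  note aux = ptolemy_type_B_aux[OF sym per per2 nz R2 R3]
  fix a b c assume o: "a < b" "b < c" "c < a + h"
  let ?D = "X b (b + h)"
  have D: "?D \<noteq> 0" using o by (intro nz) auto
  \<comment> \<open>The base point is \<open>b\<close>, and \<open>a\<close> is replaced by its
    antipode \<open>a + h\<close> so that the points follow \<open>b\<close> in order.\<close>
  have e: "?D ^ 2 * X c (a + h + h) = X b c * X b (a + h) + 2 * X b c * X (a + h) (b + h) + X c (b + h) * X (a + h) (b + h)"
    "?D * X c (c + h) = X b c + X c (b + h)"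
    "?D * X (a + h) (a + h + h) = X b (a + h) + X (a + h) (b + h)"
    using aux[of b c "a + h"] o by simp_all
  have f: "X c (a + h + h) = X a c" by (rule full_turn[of X, OF sym per2])
  have g: "X (a + h) (b + h) = X a b" "X (a + h) (a + h + h) = X a (a + h)" by (rule per)+
  have "?D * (?D * X a c) = ?D ^ 2 * X a c" by (simp add: power2_eq_square)
  also have "\<dots> = X a b * (?D * X c (c + h)) + X b c * (?D * X a (a + h))"
    using e unfolding f g by (simp add: algebra_simps)
  also have "\<dots> = ?D * (X a b * X c (c + h) + X b c * X a (a + h))" by (simp add: algebra_simps)
  finally show "X b (b + h) * X a c = X a b * X c (c + h) + X b c * X a (a + h)" using D by simp
next
  note aux = ptolemy_type_B_aux[OF sym per per2 nz R2 R3]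
  fix i l k j assume o: "i < l" "l < k" "k < j" "j < i + h"
  let ?D = "X i (i + h)"
  have D: "?D \<noteq> 0" using o by (intro nz) auto
  have a: "?D ^ 2 * X l (k + h) = X i l * X i k + 2 * X i l * X k (i + h) + X l (i + h) * X k (i + h)"
    using aux(1)[of i l k] o by simp
  have b: "?D ^ 2 * X l (j + h) = X i l * X i j + 2 * X i l * X j (i + h) + X l (i + h) * X j (i + h)"
    using aux(1)[of i l j] o by simp
  have c: "?D ^ 2 * X k j = X i j * X k (i + h) - X i k * X j (i + h)"
    using aux(2)[of i k j] o by simp
  have flip: "X u (v + h) = X v (u + h)" for u v
    by (rule half_turn_flip[of X, OF sym per per2])
  show "X i j * X k (l + h) = X i k * X j (l + h) + X i (l + h) * X k j + 2 * (X k j * X i l)"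
    unfolding flip[of k l] flip[of j l] flip[of i l] by (rule double_crossing_identity[OF D a b c])
qed

section \<open>Ptolemy inequalities\<close>

text \<open>The difference of the two sides is a mixed difference over a rectangle of index pairs,
  which telescopes into local Monge inequalities: first along one row, then over the rows.\<close>

lemma ptolemy_less:
  fixes W :: "int \<Rightarrow> int \<Rightarrow> real" and N :: int
  assumes sym: "\<And>i j. W i j = W j i" and per: "\<And>i j. W i (j + N) = W i j"
    and monge: "\<And>i j. i + 2 \<le> j \<Longrightarrow> j \<le> i + N - 2 \<Longrightarrow> W i (j + 1) + W (i + 1) j < W i j + W (i + 1) (j + 1)"
    and o: "a < b" "b < c" "c < d" "d < a + N"
  shows "W a d + W b c < W a c + W b d" "W a b + W c d < W a c + W b d"
proof -
  have row: "W i d + W (i + 1) c < W i c + W (i + 1) d" if "c < d" "i + 2 \<le> c" "d \<le> i + N - 1" for i c d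
    using that
  proof (induction d rule: int_gr_induct)
    case base
    then show ?case using monge[of i c] by simp
  next
    case (step d)
    then have "W i d + W (i + 1) c < W i c + W (i + 1) d" by simp
    moreover have "W i (d + 1) + W (i + 1) d < W i d + W (i + 1) (d + 1)" using step by (intro monge) auto
    ultimately show ?case by linarith
  qed
  have main: "W a d + W b c < W a c + W b d" if "a < b" "b < c" "c < d" "d < a + N" for a b c d
    using that
  proof (induction b rule: int_gr_induct)
    case base
    then show ?case using row[of c d a] by simp
  next
    case (step b)
    then have "W a d + W b c < W a c + W b d" by simp
    moreover have "W b d + W (b + 1) c < W b c + W (b + 1) d" using step by (intro row) auto
    ultimately show ?case by linarith
  qed
  show "W a d + W b c < W a c + W b d" by (rule main[OF o])
  \<comment> \<open>The second inequality is the first one for the quadrilateral read from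
    \<open>b\<close>.\<close>
  have "W b (a + N) + W c d < W b d + W c (a + N)" using o by (intro main) auto
  then show "W a b + W c d < W a c + W b d" using per sym by (metis add.commute)
qed

text \<open>These are the weight inequalities for the two type B identities. The first is doubled
  because \<open>W\<close> counts a diameter twice, while the corresponding identity is linear in
  diameters.\<close>

lemma type_B_less:
  fixes W :: "int \<Rightarrow> int \<Rightarrow> real" and h :: int
  assumes sym: "\<And>i j. W i j = W j i" and per: "\<And>i j. W (i + h) (j + h) = W i j"
    and per2: "\<And>i j. W i (j + 2 * h) = W i j"
    and P: "\<And>a b c d. a < b \<Longrightarrow> b < c \<Longrightarrow> c < d \<Longrightarrow> d < a + 2 * h \<Longrightarrow>
      W a d + W b c < W a c + W b d \<and> W a b + W c d < W a c + W b d"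
  shows type_B_diameter_less: "\<And>a b c. a < b \<Longrightarrow> b < c \<Longrightarrow> c < a + h \<Longrightarrow>
      2 * W a b + W c (c + h) < W b (b + h) + 2 * W a c \<and> 2 * W b c + W a (a + h) < W b (b + h) + 2 * W a c"
    and type_B_double_less: "\<And>i l k j. i < l \<Longrightarrow> l < k \<Longrightarrow> k < j \<Longrightarrow> j < i + h \<Longrightarrow>
      W k j + W i l < W i j + W k (l + h)"
proof -
  have flip: "W u (v + h) = W v (u + h)" for u v
    by (rule half_turn_flip[of W, OF sym per per2])
  { fix a b c assume o: "a < b" "b < c" "c < a + h"
    have "W a (b + h) + W b c < W a c + W b (b + h)" "W a b + W c (b + h) < W a c + W b (b + h)"
      using P[of a b c "b + h"] o by auto
    moreover have "W c (c + h) + W (a + h) (b + h) < W c (b + h) + W (a + h) (c + h)"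
      using P[of c "a + h" "b + h" "c + h"] o by auto
    moreover have "W a (a + h) + W b c < W a c + W b (a + h)" using P[of a b c "a + h"] o by auto
    ultimately show "2 * W a b + W c (c + h) < W b (b + h) + 2 * W a c \<and> 2 * W b c + W a (a + h) < W b (b + h) + 2 * W a c"
      using flip[of a b] per[of a b] per[of a c] by linarith }
  { fix i l k j assume o: "i < l" "l < k" "k < j" "j < i + h"
    have a: "W i k + W j (l + h) < W i j + W k (l + h)" "W i (l + h) + W k j < W i j + W k (l + h)"
      using P[of i k j "l + h"] o by auto
    have b: "W (j - h) k + W i l < W i k + W (j - h) l"
      using P[of "j - h" i l k] o by auto
    have b': "W (j - h) l = W j (l + h)" using per[of "j - h" l] by simp
    have c: "W (l - h) (j - h) + W i k < W (l - h) i + W (j - h) k"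
      using P[of "l - h" "j - h" i k] o by auto
    have c': "W (l - h) (j - h) = W l j" "W (l - h) i = W l (i + h)"
      using per[of "l - h" "j - h"] per[of "l - h" i] by simp_all
    have d: "W i l + W k j < W i k + W l j" using P[of i l k j] o by auto
    \<comment> \<open>Adding both parts of \<open>a\<close> to \<open>b\<close>, \<open>c\<close>
      and \<open>d\<close> gives twice the claim; all other weights cancel.\<close>
    show "W k j + W i l < W i j + W k (l + h)"
      using a b b' c c' d flip[of i l] by linarith }
qed

section \<open>Polygon models\<close>

lemma sum_list_eval:
  assumes "field_embedding (\<iota> :: 'k::field \<Rightarrow> 'f::field)"
  shows "peval \<iota> x (\<Sum>m\<leftarrow>ms. Poly_Mapping.single m (1::'k)) = (\<Sum>m\<leftarrow>ms. mono_eval x m)"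
proof -
  interpret field_embedding_loc \<iota> by (rule field_embedding_loc.intro[OF assms])
  show ?thesis by (induction ms) (simp_all add: peval_add)
qed

lemma lookup_sum_list_single:
  "Poly_Mapping.lookup (\<Sum>m\<leftarrow>ms. Poly_Mapping.single m (1::'k::ring_1)) M = of_nat (count_list ms M)"
  by (induction ms) (simp_all add: lookup_add lookup_single)

text \<open>In characteristic zero repeated entries do not cancel, so a coefficient 2 can be encoded
  by listing an exponent twice.\<close>

lemma keys_sum_list_single:
  "Poly_Mapping.keys (\<Sum>m\<leftarrow>ms. Poly_Mapping.single m (1::'k::{ring_1,ring_char_0})) = set ms"
  by (auto simp: in_keys_iff lookup_sum_list_single count_list_0_iff)

section \<open>Compatibility in terms of crossing segments\<close>

locale polygon_cluster =
  fixes \<iota> :: "'k::field_char_0 \<Rightarrow> 'f::field" and X :: dynkin and n :: nat and S :: "'f seed"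
    and x :: "nat set set \<Rightarrow> 'f"
  assumes even: "even n" and n_pos: "n > 0"
    and emb: "field_embedding \<iota>"
    and seed: "is_seed \<iota> n S"
    and model: "polygon_model X n S x"
begin

sublocale field_embedding_loc \<iota>
  by (rule field_embedding_loc.intro[OF emb])

abbreviation "N \<equiv> polygon_size X n"
abbreviation "V \<equiv> cluster_variables n S"
abbreviation "Cl \<equiv> clusters n S"

definition typeA :: bool where "typeA \<longleftrightarrow> X = Type_A"
definition typeB :: bool where "typeB \<longleftrightarrow> X = Type_B"

lemma typeB_not_A: "typeB \<Longrightarrow> \<not> typeA"
  unfolding typeA_def typeB_def by auto

definition h :: nat where "h = n + 1"

text \<open>The half-turn, taken to be the identity in type A, so that labels, clusters and
  compatibility have one description for all three types.\<close>

definition bar :: "nat set \<Rightarrow> nat set" where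
  "bar l = (if typeA then l else antipode N ` l)"

lemma n_ge: "n \<ge> 2" using even n_pos by presburger

lemma N_ge: "N \<ge> 5" using n_ge by (simp add: polygon_size_def)

lemma N_pos: "N > 0" using N_ge by simp

lemma h_pos: "h > 0" by (simp add: h_def)

lemma N_h: "\<not> typeA \<Longrightarrow> N = 2 * h" by (simp add: typeA_def polygon_size_def h_def)

lemma int_N_h: "\<not> typeA \<Longrightarrow> int N = 2 * int h" by (simp add: N_h)

lemma label_eq: "label X n l = {l, bar l}"
  by (simp add: label_def bar_def typeA_def)

lemma diagonals_segments: "l \<in> diagonals N \<Longrightarrow> l \<in> segments N" by (simp add: diagonals_def)

lemma bar_bar: "l \<in> segments N \<Longrightarrow> bar (bar l) = l"
  by (simp add: bar_def antipode_antipode[OF N_h h_pos])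

lemma bar_segments: "l \<in> segments N \<Longrightarrow> bar l \<in> segments N"
  by (simp add: bar_def antipode_segments[OF N_h h_pos])

lemma bar_diagonals: "l \<in> diagonals N \<Longrightarrow> bar l \<in> diagonals N"
  by (simp add: bar_def antipode_diagonals[OF N_h h_pos])

lemma bar_crosses: "crosses N l m \<Longrightarrow> crosses N (bar l) (bar m)"
  by (simp add: bar_def crosses_antipode[OF N_h h_pos])

lemma bar_crosses_iff: "l \<in> segments N \<Longrightarrow> m \<in> segments N \<Longrightarrow> crosses N (bar l) (bar m) \<longleftrightarrow> crosses N l m"
  using bar_crosses[of l m] bar_crosses[of "bar l" "bar m"] by (auto simp: bar_bar)

lemma not_crosses_bar: "l \<in> segments N \<Longrightarrow> \<not> crosses N l (bar l)"
  by (simp add: bar_def crosses_irrefl not_crosses_antipode[OF N_h h_pos])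

lemma bar_seg: "\<not> typeA \<Longrightarrow> bar (seg N i j) = seg N (i + int h) (j + int h)"
  by (simp add: bar_def antipode_seg[OF N_h h_pos])

lemma label_eq_iff: "label X n l = label X n m \<longleftrightarrow> m = l \<or> m = bar l" if "l \<in> segments N" "m \<in> segments N"
  using that bar_bar[of l] bar_bar[of m] by (auto simp: label_eq doubleton_eq_iff)

lemma label_bar: "l \<in> segments N \<Longrightarrow> label X n (bar l) = label X n l"
  by (auto simp: label_eq bar_bar)

lemma x_bij: "bij_betw x (diag_labels X n) V"
  and x_edge: "L \<in> edge_labels X n \<Longrightarrow> x L = 1"
  and clusters_eq: "Cl = {(\<lambda>l. x (label X n l)) ` T | T. type_triangulation X n T}"
  and exchange: "exchange_relations X n x"
  using model by (auto simp: polygon_model_def)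

abbreviation xl :: "nat set \<Rightarrow> 'f" where "xl l \<equiv> x (label X n l)"

lemma xl_eq_iff: "l \<in> diagonals N \<Longrightarrow> m \<in> diagonals N \<Longrightarrow> xl l = xl m \<longleftrightarrow> m = l \<or> m = bar l"
proof -
  assume lm: "l \<in> diagonals N" "m \<in> diagonals N"
  then have "label X n l \<in> diag_labels X n" "label X n m \<in> diag_labels X n" by (auto simp: diag_labels_def)
  then have "xl l = xl m \<longleftrightarrow> label X n l = label X n m"
    by (rule inj_on_eq_iff[OF bij_betw_imp_inj_on[OF x_bij]])
  then show ?thesis using label_eq_iff lm diagonals_segments by simp
qed

lemma V_eq: "V = xl ` diagonals N"
  using x_bij unfolding diag_labels_def bij_betw_def by (auto simp: image_image)

lemma xl_V: "l \<in> diagonals N \<Longrightarrow> xl l \<in> V" by (simp add: V_eq)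

lemma type_triangulation_iff: "type_triangulation X n T \<longleftrightarrow> triangulation N T \<and> bar ` T = T"
  by (simp add: type_triangulation_def Let_def bar_def typeA_def)

lemma triangulationD:
  assumes "type_triangulation X n T"
  shows "T \<subseteq> diagonals N" "\<And>l m. l \<in> T \<Longrightarrow> m \<in> T \<Longrightarrow> \<not> crosses N l m"
    "\<And>l. l \<in> diagonals N \<Longrightarrow> l \<notin> T \<Longrightarrow> \<exists>m\<in>T. crosses N l m" "\<And>l. l \<in> T \<Longrightarrow> bar l \<in> T"
  using assms by (auto simp: type_triangulation_iff triangulation_def)

lemma xl_mem: "type_triangulation X n T \<Longrightarrow> l \<in> diagonals N \<Longrightarrow> xl l \<in> xl ` T \<longleftrightarrow> l \<in> T"
proof
  assume T: "type_triangulation X n T" and l: "l \<in> diagonals N" and "xl l \<in> xl ` T"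
  then obtain m where m: "m \<in> T" "xl l = xl m" by blast
  then have "m \<in> diagonals N" using triangulationD(1)[OF T] by blast
  then have "m = l \<or> m = bar l" using m l xl_eq_iff by simp
  then show "l \<in> T" using m(1) triangulationD(4)[OF T m(1)] bar_bar[OF diagonals_segments[OF l]] by auto
qed simp

lemma extend_to_triangulation:
  assumes "A \<subseteq> diagonals N" "\<forall>l\<in>A. \<forall>m\<in>A. \<not> crosses N l m" "bar ` A = A"
  shows "\<exists>T. A \<subseteq> T \<and> type_triangulation X n T"
proof -
  have "\<exists>T. A \<subseteq> T \<and> triangulation N T \<and> bar ` T = T"
    by (rule triangulation_extend[of A N bar, OF assms(1,2) bar_diagonals bar_bar[OF diagonals_segments] bar_crosses
        not_crosses_bar[OF diagonals_segments] assms(3)])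
  then show ?thesis by (simp add: type_triangulation_iff)
qed

text \<open>A triangulation of the type contains the image of each of its members, which gives one
  direction. Conversely, the two segments and their images form an invariant noncrossing set, and
  such a set can be completed.\<close>

lemma common_cluster_iff:
  assumes l: "l \<in> diagonals N" and m: "m \<in> diagonals N"
  shows "common_cluster Cl (xl l) (xl m) \<longleftrightarrow> \<not> crosses N l m \<and> \<not> crosses N (bar l) m"
proof
  assume "common_cluster Cl (xl l) (xl m)"
  then obtain T where T: "type_triangulation X n T" "xl l \<in> xl ` T" "xl m \<in> xl ` T"
    unfolding common_cluster_def clusters_eq by auto
  then have "l \<in> T" "m \<in> T" using xl_mem l m by auto
  then show "\<not> crosses N l m \<and> \<not> crosses N (bar l) m" using triangulationD[OF T(1)] by blast
next
  assume nc: "\<not> crosses N l m \<and> \<not> crosses N (bar l) m"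
  have ls: "l \<in> segments N" "m \<in> segments N" using l m diagonals_segments by auto
  let ?A = "{l, bar l, m, bar m}"
  have nc1: "\<not> crosses N l m" "\<not> crosses N (bar l) m" using nc by auto
  have nc2: "\<not> crosses N (bar l) (bar m)" "\<not> crosses N l (bar m)"
    using nc1 bar_crosses_iff[of l m] bar_crosses_iff[of "bar l" m] ls bar_segments bar_bar by auto
  have nc3: "\<not> crosses N m l" "\<not> crosses N m (bar l)" "\<not> crosses N (bar m) (bar l)" "\<not> crosses N (bar m) l"
    using nc1 nc2 crosses_sym by blast+
  have nc4: "\<not> crosses N l (bar l)" "\<not> crosses N (bar l) l" "\<not> crosses N m (bar m)" "\<not> crosses N (bar m) m"
    using not_crosses_bar[OF ls(1)] not_crosses_bar[OF ls(2)] crosses_sym by blast+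
  have "\<exists>T. ?A \<subseteq> T \<and> type_triangulation X n T"
  proof (rule extend_to_triangulation)
    show "?A \<subseteq> diagonals N" using l m bar_diagonals by auto
    show "\<forall>l\<in>?A. \<forall>m\<in>?A. \<not> crosses N l m" by (simp add: nc1 nc2 nc3 nc4 crosses_irrefl)
    show "bar ` ?A = ?A" using bar_bar ls by auto
  qed
  then obtain T where T: "?A \<subseteq> T" "type_triangulation X n T" by (elim exE conjE)
  have "xl ` T \<in> Cl" unfolding clusters_eq using T(2) by blast
  moreover have "xl l \<in> xl ` T" "xl m \<in> xl ` T" using T(1) by simp_all
  ultimately show "common_cluster Cl (xl l) (xl m)" unfolding common_cluster_def by (intro bexI[of _ "xl ` T"] conjI)
qed

lemma incompatible_crossing:
  assumes "v \<in> V" "w \<in> V" "\<not> common_cluster Cl v w"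
  obtains l m where "l \<in> diagonals N" "m \<in> diagonals N" "crosses N l m" "v = xl l" "w = xl m"
proof -
  obtain l m where lm: "l \<in> diagonals N" "m \<in> diagonals N" "v = xl l" "w = xl m"
    using assms(1,2) unfolding V_eq by blast
  have "xl (bar l) = xl l" using label_bar[OF diagonals_segments[OF lm(1)]] by simp
  then have v: "v = xl (bar l)" using lm(3) by simp
  have "crosses N l m \<or> crosses N (bar l) m" using common_cluster_iff[OF lm(1,2)] assms(3) lm(3,4) by simp
  then show ?thesis
  proof
    assume "crosses N l m"
    then show ?thesis by (rule that[OF lm(1,2) _ lm(3,4)])
  next
    assume "crosses N (bar l) m"
    then show ?thesis by (rule that[OF bar_diagonals[OF lm(1)] lm(2) _ v lm(4)])
  qed
qed

lemma V_cover: "V = \<Union> Cl" by (simp add: cluster_variables_def)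

lemma cluster_indep: "T \<in> Cl \<Longrightarrow> alg_indep \<iota> T (\<lambda>v. v)"
  by (rule clusters_alg_indep[OF seed]) simp_all

lemma V_nonzero: "v \<in> V \<Longrightarrow> v \<noteq> 0"
  using alg_indep_nonzero[OF cluster_indep] V_cover by blast

text \<open>The flag property: being noncrossing is a condition on pairs, so all segments carrying
  the given variables can be completed to a single triangulation.\<close>

lemma pairwise_common_cluster:
  assumes "A \<subseteq> V" "\<forall>v\<in>A. \<forall>w\<in>A. common_cluster Cl v w"
  shows "\<exists>T\<in>Cl. A \<subseteq> T"
proof -
  define A' where "A' = {l \<in> diagonals N. xl l \<in> A}"
  have xbar: "xl (bar l) = xl l" if "l \<in> diagonals N" for l
    using label_bar[OF diagonals_segments[OF that]] by simp
  have "\<exists>T. A' \<subseteq> T \<and> type_triangulation X n T"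
  proof (rule extend_to_triangulation)
    show "A' \<subseteq> diagonals N" by (auto simp: A'_def)
    show "\<forall>l\<in>A'. \<forall>m\<in>A'. \<not> crosses N l m"
      using assms(2) common_cluster_iff unfolding A'_def by blast
    have sub: "bar l \<in> A'" if "l \<in> A'" for l
      using that bar_diagonals[of l] xbar[of l] by (simp add: A'_def)
    have "l \<in> bar ` A'" if "l \<in> A'" for l
    proof (rule image_eqI)
      show "l = bar (bar l)" using that bar_bar[OF diagonals_segments, of l] by (simp add: A'_def)
    qed (rule sub[OF that])
    then show "bar ` A' = A'" using sub by blast
  qed
  then obtain T where T: "A' \<subseteq> T" "type_triangulation X n T" by blast
  have "A \<subseteq> xl ` T" using T(1) assms(1) unfolding V_eq A'_def by blast
  then show ?thesis using T(2) unfolding clusters_eq by blast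
qed

lemma cluster_maximal:
  assumes "T \<in> Cl" "v \<in> V - T"
  shows "\<exists>w\<in>T. \<not> common_cluster Cl v w"
proof -
  obtain Tr where Tr: "type_triangulation X n Tr" "T = xl ` Tr" using assms(1) unfolding clusters_eq by blast
  obtain l where l: "l \<in> diagonals N" "v = xl l" using assms(2) V_eq by blast
  have "l \<notin> Tr" using assms(2) l Tr(2) by blast
  then obtain m where m: "m \<in> Tr" "crosses N l m" using triangulationD(3)[OF Tr(1) l(1)] by blast
  then have "\<not> common_cluster Cl v (xl m)"
    using common_cluster_iff[OF l(1), of m] triangulationD(1)[OF Tr(1)] l(2) by blast
  then show ?thesis using m(1) Tr(2) by blast
qed

subsection \<open>The crossing number as an induction measure\<close>

text \<open>In type B the diameters and the other diagonals have to be weighted differently: a diagonal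
  \<open>l\<close> that is not a diameter stands for the two segments \<open>l\<close> and \<open>bar l\<close>.\<close>

definition mult :: "nat set \<Rightarrow> nat" where
  "mult l = (if typeB \<and> bar l \<noteq> l then 2 else 1)"

definition crossing_set :: "nat set set \<Rightarrow> nat set \<Rightarrow> nat set set" where
  "crossing_set T l = {t \<in> T. crosses N t l}"

definition crossing_number :: "nat set set \<Rightarrow> nat set \<Rightarrow> nat" where
  "crossing_number T l = mult l * card (crossing_set T l)"

text \<open>The criterion for initial ideals needs a measure on field elements. The triangulation is
  recovered from its cluster, and the chosen segment may be either member of its antipodal pair,
  which does not affect the crossing number.\<close>

definition crossing_size :: "'f set \<Rightarrow> 'f \<Rightarrow> nat" where
  "crossing_size c u = crossing_number {t \<in> diagonals N. xl t \<in> c} (SOME l. l \<in> diagonals N \<and> xl l = u)"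

lemma crossing_set_bar:
  assumes "type_triangulation X n T" "l \<in> segments N"
  shows "crossing_set T (bar l) = bar ` crossing_set T l"
proof -
  note T = triangulationD[OF assms(1)]
  have sT: "t \<in> segments N" if "t \<in> T" for t using T(1) diagonals_segments that by blast
  have sub: "bar ` crossing_set T l \<subseteq> crossing_set T (bar l)" if "l \<in> segments N" for l
    using T(4) bar_crosses by (auto simp: crossing_set_def)
  moreover have "crossing_set T (bar l) \<subseteq> bar ` crossing_set T l"
  proof
    fix t assume t: "t \<in> crossing_set T (bar l)"
    then have "bar t \<in> crossing_set T (bar (bar l))" using sub[OF bar_segments[OF assms(2)]] by blast
    then have "bar t \<in> crossing_set T l" using bar_bar[OF assms(2)] by simp
    moreover have "bar (bar t) = t" using t sT bar_bar by (auto simp: crossing_set_def)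
    ultimately show "t \<in> bar ` crossing_set T l" by (metis imageI)
  qed
  ultimately show ?thesis using assms(2) by blast
qed

lemma finite_crossing_set: "type_triangulation X n T \<Longrightarrow> finite (crossing_set T l)"
  unfolding crossing_set_def using triangulationD(1) finite_diagonals finite_subset by fastforce

lemma crossing_number_bar:
  assumes "type_triangulation X n T" "l \<in> segments N"
  shows "crossing_number T (bar l) = crossing_number T l"
proof -
  have "inj_on bar (crossing_set T l)"
    by (rule inj_on_inverseI[of _ bar])
      (use triangulationD(1)[OF assms(1)] diagonals_segments bar_bar in \<open>auto simp: crossing_set_def\<close>)
  then have "card (crossing_set T (bar l)) = card (crossing_set T l)"
    unfolding crossing_set_bar[OF assms] by (rule card_image)
  moreover have "mult (bar l) = mult l" using bar_bar[OF assms(2)] by (auto simp: mult_def)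
  ultimately show ?thesis by (simp add: crossing_number_def)
qed

lemma crossing_size_eq:
  assumes "type_triangulation X n T" "l \<in> diagonals N"
  shows "crossing_size (xl ` T) (xl l) = crossing_number T l"
proof -
  have "{t \<in> diagonals N. xl t \<in> xl ` T} = T"
    using xl_mem[OF assms(1)] triangulationD(1)[OF assms(1)] by blast
  moreover define m where "m = (SOME m. m \<in> diagonals N \<and> xl m = xl l)"
  have "m \<in> diagonals N \<and> xl m = xl l" unfolding m_def by (rule someI[of _ l]) (simp add: assms(2))
  then have "l = m \<or> l = bar m" "m \<in> segments N" using xl_eq_iff[of m l] assms(2) diagonals_segments by auto
  then have "crossing_number T m = crossing_number T l" using crossing_number_bar[OF assms(1)] by auto
  ultimately show ?thesis unfolding crossing_size_def m_def by simp
qed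

subsection \<open>Monomials of segments\<close>

abbreviation xs :: "int \<Rightarrow> int \<Rightarrow> 'f" where "xs i j \<equiv> xl (seg N i j)"

definition diameter :: "int \<Rightarrow> int \<Rightarrow> bool" where
  "diameter i j \<longleftrightarrow> \<not> typeA \<and> bar (seg N i j) = seg N i j"

text \<open>Edges have exponent 0 because their value is 1. Diameters are squared in type B, as in
  the exchange relation with one endpoint in common; with this convention the weights obey the same
  Ptolemy inequalities in all types.\<close>

definition expo :: "int \<Rightarrow> int \<Rightarrow> 'f \<Rightarrow>\<^sub>0 nat" where
  "expo i j = (if seg N i j \<in> edges N then 0
     else Poly_Mapping.single (xs i j) (if typeB \<and> diameter i j then 2 else 1))"

definition W :: "('f \<Rightarrow>\<^sub>0 real) \<Rightarrow> int \<Rightarrow> int \<Rightarrow> real" where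
  "W \<omega> i j = weight \<omega> (expo i j)"

definition Y :: "int \<Rightarrow> int \<Rightarrow> 'f" where
  "Y i j = mono_eval (\<lambda>v. v) (expo i j)"

lemma bar_bar_seg: "bar (bar (seg N i j)) = seg N i j"
proof (cases "typeA")
  case False
  have "seg N (i + int h + int h) (j + int h + int h) = seg N (i + int N) (j + int N)"
    using int_N_h[OF False] by (simp add: algebra_simps)
  then show ?thesis using False by (simp add: bar_seg seg_shift)
qed (simp add: bar_def)

lemma label_bar_seg: "label X n (bar (seg N i j)) = label X n (seg N i j)"
  by (auto simp: label_eq bar_bar_seg)

lemma xs_half: "\<not> typeA \<Longrightarrow> xs (i + int h) (j + int h) = xs i j"
  using label_bar_seg[of i j] by (simp add: bar_seg)

lemma xs_commute: "xs i j = xs j i" unfolding seg_commute[of N i j] ..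

lemma edge_half: "\<not> typeA \<Longrightarrow> seg N (i + int h) (j + int h) \<in> edges N \<longleftrightarrow> seg N i j \<in> edges N"
proof -
  assume A: "\<not> typeA"
  have imp: "seg N (i + int h) (j + int h) \<in> edges N" if ed: "seg N i j \<in> edges N" for i j
  proof -
    obtain k where k: "seg N i j = seg N k (k + 1)" using ed unfolding edges_eq[OF N_pos] by blast
    have "k + 1 + int h = k + int h + 1" by simp
    then have "seg N (i + int h) (j + int h) = seg N (k + int h) (k + int h + 1)"
      using arg_cong[OF k, of bar] unfolding bar_seg[OF A] by (simp only:)
    then show ?thesis using seg_edge[OF N_pos, of "k + int h"] by (simp only:)
  qed
  have "seg N (i + int h + int h) (j + int h + int h) = seg N i j"
    using bar_bar_seg[of i j] unfolding bar_seg[OF A] .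
  from imp[of "i + int h" "j + int h", unfolded this] imp[of i j] show ?thesis by (rule iffI)
qed

lemma diameter_half: "diameter (i + int h) (j + int h) \<longleftrightarrow> diameter i j"
proof (cases "typeA")
  case False
  have e2: "bar (seg N i j) = seg N (i + int h) (j + int h)" by (rule bar_seg[OF False])
  have e1: "bar (seg N (i + int h) (j + int h)) = seg N i j" using bar_bar_seg[of i j] unfolding e2 .
  show ?thesis unfolding diameter_def e1 e2 by (rule conj_cong[OF refl eq_commute])
qed (simp add: diameter_def)

lemma diameter_iff:
  assumes "\<not> typeA" "i < j" "j < i + int N"
  shows "diameter i j \<longleftrightarrow> j = i + int h"
proof -
  have Nh: "int N = 2 * int h" by (rule int_N_h[OF assms(1)])
  have bar: "bar (seg N i j) = seg N (i + int h) (j + int h)" by (rule bar_seg[OF assms(1)])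
  show ?thesis
  proof (cases "j + int h < i + int N")
    case True
    have "seg N (i + int h) (j + int h) = seg N i j \<longleftrightarrow> i + int h = i \<and> j + int h = j"
      by (rule seg_window_eq_iff[OF N_pos, of i]) (use assms True Nh h_pos in linarith)+
    then show ?thesis using True Nh h_pos assms(1) unfolding diameter_def bar by linarith
  next
    case False
    have e: "seg N (i + int h) (j + int h) = seg N (j + int h - int N) (i + int h)"
      by (simp only: seg_shift_minus seg_commute[of N "j + int h" "i + int h"])
    have "seg N (j + int h - int N) (i + int h) = seg N i j \<longleftrightarrow> j + int h - int N = i \<and> i + int h = j"
      by (rule seg_window_eq_iff[OF N_pos, of i]) (use assms Nh False h_pos in linarith)+
    then show ?thesis using Nh assms(1) unfolding diameter_def bar e by linarith
  qed
qed

lemma expo_commute: "expo i j = expo j i"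
  unfolding expo_def diameter_def seg_commute[of N i j] ..

lemma expo_shift: "expo i (j + int N) = expo i j"
  by (simp add: expo_def diameter_def seg_shift)

lemma expo_half: "\<not> typeA \<Longrightarrow> expo (i + int h) (j + int h) = expo i j"
  by (simp add: expo_def diameter_half edge_half xs_half)

lemma expo_edge: "expo i (i + 1) = 0"
  by (simp add: expo_def seg_edge[OF N_pos])

lemma keys_expo_diag: "u \<in> Poly_Mapping.keys (expo i j) \<Longrightarrow> i < j \<Longrightarrow> j < i + int N \<Longrightarrow>
    seg N i j \<in> diagonals N \<and> u = xs i j"
  using seg_in_segments[of i j N] by (auto simp: expo_def diagonals_def split: if_splits)

lemma W_commute: "W \<omega> i j = W \<omega> j i" unfolding W_def expo_commute[of i j] ..
lemma W_shift: "W \<omega> i (j + int N) = W \<omega> i j" by (simp add: W_def expo_shift)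
lemma W_half: "\<not> typeA \<Longrightarrow> W \<omega> (i + int h) (j + int h) = W \<omega> i j" by (simp add: W_def expo_half)

lemma xs_edge: "seg N i j \<in> edges N \<Longrightarrow> xs i j = 1"
  by (rule x_edge) (auto simp: edge_labels_def)

lemma Y_eq: "Y i j = (if typeB \<and> diameter i j then xs i j ^ 2 else xs i j)"
  if "i < j" "j < i + int N"
proof (cases "seg N i j \<in> edges N")
  case True
  then show ?thesis by (auto simp: Y_def expo_def xs_edge)
qed (simp add: Y_def expo_def)

lemma xs_nonzero: "i < j \<Longrightarrow> j < i + int N \<Longrightarrow> xs i j \<noteq> 0"
proof -
  assume ij: "i < j" "j < i + int N"
  show ?thesis
  proof (cases "seg N i j \<in> edges N")
    case False
    then have "seg N i j \<in> diagonals N" using seg_in_segments[OF ij] by (simp add: diagonals_def)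
    then show ?thesis by (rule V_nonzero[OF xl_V])
  qed (simp add: xs_edge)
qed

subsection \<open>Exchange relations in integer coordinates\<close>

abbreviation vx :: "int \<Rightarrow> nat" where "vx z \<equiv> nat (z mod int N)"

lemma ccw_vx:
  assumes "sorted_wrt (<) (a # zs)" "\<forall>z\<in>set zs. z < a + int N"
  shows "ccw N (map vx (a # zs))"
proof -
  have "\<forall>z\<in>set (a # zs). a \<le> z \<and> z < a + int N" using assms N_pos by (simp add: less_imp_le)
  from ccw_window[OF this assms(1)] show ?thesis by simp
qed

lemma seg_vx: "{vx i, vx j} = seg N i j" by (simp add: seg_def)

lemma antipode_vx: "\<not> typeA \<Longrightarrow> antipode N (vx a) = vx (a + int h)"
proof -
  assume "\<not> typeA"
  then have "{antipode N (vx a)} = {vx (a + int h)}"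
    using antipode_seg[OF N_h h_pos, of a a] by (simp add: seg_def)
  then show ?thesis by simp
qed

lemma exchange_nat_A:
  assumes "typeA" "ccw N [a, b, c, d]"
  shows "xl {a, c} * xl {b, d} = xl {a, b} * xl {c, d} + xl {a, d} * xl {b, c}"
proof -
  have X: "X = Type_A" using assms(1) by (simp only: typeA_def)
  show ?thesis using exchange assms(2) unfolding exchange_relations_def Let_def if_P[OF X] by blast
qed

lemma exchange_nat:
  assumes "\<not> typeA"
  shows "ccw N [a, b, c, d, antipode N a] \<Longrightarrow> xl {a, c} * xl {b, d} = xl {a, b} * xl {c, d} + xl {a, d} * xl {b, c}"
    "ccw N [a, b, c, antipode N a] \<Longrightarrow> xl {a, c} * xl {a, antipode N b} = xl {a, b} * xl {a, antipode N c} +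
      xl {a, antipode N a} ^ (2 div (if typeB then 1 else 2)) * xl {b, c}"
    "a < N \<Longrightarrow> b < N \<Longrightarrow> b \<noteq> a \<Longrightarrow> b \<noteq> antipode N a \<Longrightarrow>
      xl {a, antipode N a} * xl {b, antipode N b} =
      xl {a, b} ^ (if typeB then 1 else 2) + xl {a, antipode N b} ^ (if typeB then 1 else 2)"
proof -
  have X: "X \<noteq> Type_A" using assms by (simp only: typeA_def) simp
  note ex = exchange[unfolded exchange_relations_def Let_def if_not_P[OF X] typeB_def[symmetric]]
  show "ccw N [a, b, c, d, antipode N a] \<Longrightarrow> xl {a, c} * xl {b, d} = xl {a, b} * xl {c, d} + xl {a, d} * xl {b, c}"
    using conjunct1[OF ex] by blast
  show "ccw N [a, b, c, antipode N a] \<Longrightarrow> xl {a, c} * xl {a, antipode N b} = xl {a, b} * xl {a, antipode N c} +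
      xl {a, antipode N a} ^ (2 div (if typeB then 1 else 2)) * xl {b, c}"
    using conjunct1[OF conjunct2[OF ex]] by blast
  show "a < N \<Longrightarrow> b < N \<Longrightarrow> b \<noteq> a \<Longrightarrow> b \<noteq> antipode N a \<Longrightarrow>
      xl {a, antipode N a} * xl {b, antipode N b} =
      xl {a, b} ^ (if typeB then 1 else 2) + xl {a, antipode N b} ^ (if typeB then 1 else 2)"
    using conjunct2[OF conjunct2[OF ex]] by blast
qed

lemma exchange_A:
  assumes "typeA" "a < b" "b < c" "c < d" "d < a + int N"
  shows "xs a c * xs b d = xs a b * xs c d + xs a d * xs b c"
proof -
  have "ccw N [vx a, vx b, vx c, vx d]" using ccw_vx[of a "[b, c, d]"] assms by simp
  from exchange_nat_A[OF assms(1) this] show ?thesis unfolding seg_vx .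
qed

lemma exchange_1:
  assumes A: "\<not> typeA" and o: "a < b" "b < c" "c < d" "d < a + int h"
  shows "xs a c * xs b d = xs a b * xs c d + xs a d * xs b c"
proof -
  have "ccw N (map vx [a, b, c, d, a + int h])" by (rule ccw_vx) (use o int_N_h[OF A] in auto)
  then have "ccw N [vx a, vx b, vx c, vx d, antipode N (vx a)]" by (simp only: antipode_vx[OF A] list.map)
  from exchange_nat(1)[OF A this] show ?thesis unfolding seg_vx .
qed

lemma exchange_2:
  assumes A: "\<not> typeA" and o: "a < b" "b < c" "c < a + int h"
  shows "xs a c * xs a (b + int h) = xs a b * xs a (c + int h) +
    xs a (a + int h) ^ (if typeB then 2 else 1) * xs b c"
proof -
  have "ccw N (map vx [a, b, c, a + int h])" by (rule ccw_vx) (use o int_N_h[OF A] in auto)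
  then have "ccw N [vx a, vx b, vx c, antipode N (vx a)]" by (simp only: antipode_vx[OF A] list.map)
  note e = exchange_nat(2)[OF A this, unfolded antipode_vx[OF A] seg_vx]
  show ?thesis using e by (cases typeB) simp_all
qed

lemma exchange_3:
  assumes A: "\<not> typeA" and o: "a < b" "b < a + int h"
  shows "xs a (a + int h) * xs b (b + int h) = xs a b ^ (if typeB then 1 else 2) +
    xs a (b + int h) ^ (if typeB then 1 else 2)"
proof -
  have ne: "vx b \<noteq> vx c" if "b \<noteq> c" "\<bar>b - c\<bar> < int N" for c
    using mod_window[of b "int N" c] that nat_mod_eq_iff[OF N_pos, of b c] by blast
  have "vx b \<noteq> vx a" "vx b \<noteq> antipode N (vx a)"
    unfolding antipode_vx[OF A] by (rule ne; use o int_N_h[OF A] in linarith)+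
  moreover have lt: "vx z < N" for z using N_pos by (simp add: nat_less_iff)
  ultimately have e: "xl {vx a, antipode N (vx a)} * xl {vx b, antipode N (vx b)} =
      xl {vx a, vx b} ^ (if typeB then 1 else 2) + xl {vx a, antipode N (vx b)} ^ (if typeB then 1 else 2)"
    by (intro exchange_nat(3)[OF A] lt)
  show ?thesis using e unfolding antipode_vx[OF A] seg_vx .
qed

end

context polygon_cluster
begin

section \<open>Relations between incompatible cluster variables\<close>

subsection \<open>Comparing crossing numbers\<close>

lemma tri_segments: "type_triangulation X n T \<Longrightarrow> t \<in> T \<Longrightarrow> t \<in> segments N"
  using triangulationD(1) diagonals_segments by blast

lemma card_crossing_less:
  assumes T: "type_triangulation X n T" and sub: "\<And>t. t \<in> T \<Longrightarrow> crosses N t u \<Longrightarrow> crosses N t l"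
    and z: "z \<in> T" "crosses N z l" "\<not> crosses N z u"
  shows "card (crossing_set T u) < card (crossing_set T l)"
proof (rule psubset_card_mono)
  show "finite (crossing_set T l)" by (rule finite_crossing_set[OF T])
  have "crossing_set T u \<subseteq> crossing_set T l" using sub by (auto simp: crossing_set_def)
  moreover have "z \<in> crossing_set T l - crossing_set T u" using z by (simp add: crossing_set_def)
  ultimately show "crossing_set T u \<subset> crossing_set T l" by blast
qed

lemma card_crossing_bar:
  assumes T: "type_triangulation X n T" and l: "l \<in> segments N"
  shows "card (crossing_set T (bar l)) = card (crossing_set T l)"
  unfolding crossing_set_bar[OF T l]
proof (rule card_image, rule inj_on_inverseI[of _ bar])
  fix t assume "t \<in> crossing_set T l"
  then show "bar (bar t) = t" using bar_bar[OF tri_segments[OF T]] by (simp add: crossing_set_def)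
qed

text \<open>The sets of members crossing \<open>u\<close> and its image have equal size, are
  disjoint and lie in the crossing set of \<open>l\<close>, which contains \<open>z\<close> in
  addition. The factor 2 is what compares a diameter \<open>l\<close> with segments that are counted
  doubly.\<close>

lemma card_crossing_double_less:
  assumes T: "type_triangulation X n T" and u: "u \<in> segments N"
    and sub: "\<And>t. t \<in> T \<Longrightarrow> crosses N t u \<or> crosses N t (bar u) \<Longrightarrow> crosses N t l"
    and disj: "\<And>t. t \<in> T \<Longrightarrow> crosses N t u \<Longrightarrow> crosses N t (bar u) \<Longrightarrow> False"
    and z: "z \<in> T" "crosses N z l" "\<not> crosses N z u" "\<not> crosses N z (bar u)"
  shows "2 * card (crossing_set T u) < card (crossing_set T l)"
proof -
  let ?c = "crossing_set T"
  have "?c u \<inter> ?c (bar u) = {}" using disj by (auto simp: crossing_set_def)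
  then have "card (?c u \<union> ?c (bar u)) = 2 * card (?c u)"
    using card_Un_disjoint[OF finite_crossing_set[OF T] finite_crossing_set[OF T], of u "bar u"]
      card_crossing_bar[OF T u] by simp
  moreover have "card (?c u \<union> ?c (bar u)) < card (?c l)"
  proof (rule psubset_card_mono)
    show "finite (?c l)" by (rule finite_crossing_set[OF T])
    have "?c u \<union> ?c (bar u) \<subseteq> ?c l" using sub by (auto simp: crossing_set_def)
    moreover have "z \<in> ?c l - (?c u \<union> ?c (bar u))" using z by (simp add: crossing_set_def)
    ultimately show "?c u \<union> ?c (bar u) \<subset> ?c l" by blast
  qed
  ultimately show ?thesis by simp
qed

text \<open>Crossings of a side are crossings of the opposed diagonal, and the diagonal contained in
  \<open>T\<close> is one more crossing that no side has.\<close>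

lemma card_crossing_side_less:
  assumes T: "type_triangulation X n T" and o: "a < b" "b < c" "c < d" "d < a + int N"
    and s: "s \<in> {seg N a b, seg N b c, seg N c d, seg N a d}"
  shows "seg N b d \<in> T \<Longrightarrow> card (crossing_set T s) < card (crossing_set T (seg N a c))"
    and "seg N a c \<in> T \<Longrightarrow> card (crossing_set T s) < card (crossing_set T (seg N b d))"
proof -
  show "card (crossing_set T s) < card (crossing_set T (seg N a c))" if bd: "seg N b d \<in> T"
  proof (rule card_crossing_less[OF T _ bd])
    show "crosses N t (seg N a c)" if "t \<in> T" "crosses N t s" for t
      by (rule side_crosses[OF o tri_segments[OF T that(1)] _ s that(2)])
        (rule triangulationD(2)[OF T that(1) bd])
    show "crosses N (seg N b d) (seg N a c)" by (rule crosses_sym[OF crossesI[OF o]])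
    show "\<not> crosses N (seg N b d) s" by (rule side_not_crosses[OF o s])
  qed
  show "card (crossing_set T s) < card (crossing_set T (seg N b d))" if ac: "seg N a c \<in> T"
  proof (rule card_crossing_less[OF T _ ac])
    \<comment> \<open>Reading the quadrilateral from \<open>b\<close> exchanges the roles of its two
      diagonals.\<close>
    note o' = rotate_quad[OF o]
    have s': "s \<in> {seg N b c, seg N c d, seg N d (a + int N), seg N b (a + int N)}"
      using s unfolding seg_shift seg_commute[of N d a] seg_commute[of N b a] by blast
    have ac': "seg N c (a + int N) = seg N a c" unfolding seg_shift seg_commute[of N c a] ..
    show "crosses N t (seg N b d)" if "t \<in> T" "crosses N t s" for t
      by (rule side_crosses[OF o' tri_segments[OF T that(1)] _ s' that(2)])
        (simp add: ac' triangulationD(2)[OF T that(1) ac])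
    show "crosses N (seg N a c) (seg N b d)" by (rule crossesI[OF o])
    show "\<not> crosses N (seg N a c) s" using side_not_crosses[OF o' s'] unfolding ac' .
  qed
qed

lemma crossing_number_less:
  assumes "card (crossing_set T u) < card (crossing_set T l)" "\<not> typeB \<or> bar l \<noteq> l"
  shows "crossing_number T u < crossing_number T l"
  using assms by (auto simp: crossing_number_def mult_def)

lemma crossing_number_le: "crossing_number T u \<le> 2 * card (crossing_set T u)"
  by (simp add: crossing_number_def mult_def)

lemma crossing_number_ge: "card (crossing_set T u) \<le> crossing_number T u"
  by (simp add: crossing_number_def mult_def)

subsection \<open>Relations with control of the crossing numbers\<close>

text \<open>Both directions are required because either of the two incompatible variables may be the
  one that belongs to the cluster used for Laurent expansion.\<close>

definition simpler :: "nat set \<Rightarrow> nat set \<Rightarrow> nat set \<Rightarrow> bool" where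
  "simpler l m u \<longleftrightarrow> (\<forall>T. type_triangulation X n T \<longrightarrow>
     (m \<in> T \<longrightarrow> crossing_number T u < crossing_number T l) \<and>
     (l \<in> T \<longrightarrow> crossing_number T u < crossing_number T m))"

text \<open>The product of two variables as a sum of monomials with coefficient 1; repeated entries
  of the list account for larger coefficients. All variables involved are closer to the
  triangulation than the crossing pair.\<close>

definition relation :: "nat set \<Rightarrow> nat set \<Rightarrow> ('f \<Rightarrow>\<^sub>0 nat) list \<Rightarrow> bool" where
  "relation l m ms \<longleftrightarrow> l \<in> diagonals N \<and> m \<in> diagonals N \<and>
     (\<forall>e\<in>set ms. Poly_Mapping.keys e \<subseteq> xl ` {u \<in> diagonals N. simpler l m u}) \<and>
     (\<Sum>e\<leftarrow>ms. mono_eval (\<lambda>v. v) e) = xl l * xl m"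

lemma simpler_sym: "simpler l m u \<longleftrightarrow> simpler m l u"
  unfolding simpler_def by blast

lemma relation_sym: "relation l m ms \<longleftrightarrow> relation m l ms"
  unfolding relation_def simpler_sym[of l m] by (auto simp: mult.commute)

definition positive :: "('f \<Rightarrow>\<^sub>0 real) \<Rightarrow> bool" where
  "positive \<omega> \<longleftrightarrow> (\<forall>i j. i + 2 \<le> j \<and> j \<le> i + int N - 2 \<longrightarrow>
     W \<omega> i (j + 1) + W \<omega> (i + 1) j < W \<omega> i j + W \<omega> (i + 1) (j + 1))"

text \<open>The relation is chosen before \<open>\<omega>\<close>. The representatives
  \<open>l\<close> and \<open>m\<close> are left free because a cluster variable determines its
  segment only up to the half-turn.\<close>

definition good :: "'f \<Rightarrow> 'f \<Rightarrow> bool" where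
  "good v w \<longleftrightarrow> (\<exists>l m ms. v = xl l \<and> w = xl m \<and> relation l m ms \<and>
     (\<forall>\<omega>. positive \<omega> \<longrightarrow> (\<forall>e\<in>set ms. weight \<omega> e < Poly_Mapping.lookup \<omega> v + Poly_Mapping.lookup \<omega> w)))"

lemma good_sym: "good v w \<Longrightarrow> good w v"
  unfolding good_def using relation_sym by (metis add.commute)

lemma positive_ptolemy:
  assumes "positive \<omega>" "a < b" "b < c" "c < d" "d < a + int N"
  shows "W \<omega> a d + W \<omega> b c < W \<omega> a c + W \<omega> b d" "W \<omega> a b + W \<omega> c d < W \<omega> a c + W \<omega> b d"
proof -
  have monge: "W \<omega> i (j + 1) + W \<omega> (i + 1) j < W \<omega> i j + W \<omega> (i + 1) (j + 1)"
    if "i + 2 \<le> j" "j \<le> i + int N - 2" for i j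
    using assms(1) that unfolding positive_def by blast
  show "W \<omega> a d + W \<omega> b c < W \<omega> a c + W \<omega> b d" "W \<omega> a b + W \<omega> c d < W \<omega> a c + W \<omega> b d"
    using ptolemy_less[of "W \<omega>" "int N" a b c d, OF W_commute W_shift monge assms(2-5)] by auto
qed

lemma lookup_eq_W:
  assumes "seg N i j \<in> diagonals N" "\<not> typeB \<or> \<not> diameter i j"
  shows "Poly_Mapping.lookup \<omega> (xs i j) = W \<omega> i j"
proof -
  have "seg N i j \<notin> edges N" using assms(1) by (simp add: diagonals_def)
  then have "expo i j = Poly_Mapping.single (xs i j) 1" using assms(2) by (auto simp: expo_def)
  then show ?thesis by (simp add: W_def)
qed

lemma lookup_diameter:
  assumes "seg N i j \<in> diagonals N" "typeB" "diameter i j"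
  shows "2 * Poly_Mapping.lookup \<omega> (xs i j) = W \<omega> i j"
proof -
  have "seg N i j \<notin> edges N" using assms(1) by (simp add: diagonals_def)
  then have "expo i j = Poly_Mapping.single (xs i j) 2" using assms(2,3) by (auto simp: expo_def)
  then show ?thesis by (simp add: W_def)
qed

lemma crossing_diagonals:
  assumes "a < b" "b < c" "c < d" "d < a + int N"
  shows "seg N a c \<in> diagonals N" "seg N b d \<in> diagonals N"
  using seg_diagonals_iff[of a c N] seg_diagonals_iff[of b d N] assms by auto

lemma keys_expo_simpler:
  assumes "i < j" "j < i + int N" "simpler l m (seg N i j)"
  shows "Poly_Mapping.keys (expo i j) \<subseteq> xl ` {u \<in> diagonals N. simpler l m u}"
  using keys_expo_diag[OF _ assms(1,2)] assms(3) by blast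

text \<open>Excluding diameters in type B gives both crossing diagonals the maximal multiplicity, so
  the strict comparison of cardinalities passes to crossing numbers.\<close>

lemma side_simpler:
  assumes o: "a < b" "b < c" "c < d" "d < a + int N"
    and nd: "\<not> typeB \<or> \<not> diameter a c \<and> \<not> diameter b d"
    and s: "s \<in> {seg N a b, seg N b c, seg N c d, seg N a d}"
  shows "simpler (seg N a c) (seg N b d) s"
proof -
  have nd': "\<not> typeB \<or> bar (seg N a c) \<noteq> seg N a c" "\<not> typeB \<or> bar (seg N b d) \<noteq> seg N b d"
    using nd typeB_not_A unfolding diameter_def by blast+
  show ?thesis unfolding simpler_def
  proof (intro allI impI conjI)
    fix T assume T: "type_triangulation X n T"
    show "crossing_number T s < crossing_number T (seg N a c)" if "seg N b d \<in> T"
      by (rule crossing_number_less[OF card_crossing_side_less(1)[OF T o s that] nd'(1)])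
    show "crossing_number T s < crossing_number T (seg N b d)" if "seg N a c \<in> T"
      by (rule crossing_number_less[OF card_crossing_side_less(2)[OF T o s that] nd'(2)])
  qed
qed

lemma ptolemy_relation:
  assumes o: "a < b" "b < c" "c < d" "d < a + int N"
    and nd: "\<not> typeB \<or> \<not> diameter a c \<and> \<not> diameter b d"
    and eq: "xs a c * xs b d = Y a b * Y c d + Y a d * Y b c"
  shows "relation (seg N a c) (seg N b d) [expo a b + expo c d, expo a d + expo b c]"
    and "positive \<omega> \<Longrightarrow> e \<in> set [expo a b + expo c d, expo a d + expo b c] \<Longrightarrow>
      weight \<omega> e < Poly_Mapping.lookup \<omega> (xs a c) + Poly_Mapping.lookup \<omega> (xs b d)"
proof -
  note D = crossing_diagonals[OF o]
  have k: "Poly_Mapping.keys (expo i j) \<subseteq> xl ` {u \<in> diagonals N. simpler (seg N a c) (seg N b d) u}"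
    if "i < j" "j < i + int N" "seg N i j \<in> {seg N a b, seg N b c, seg N c d, seg N a d}" for i j
    by (rule keys_expo_simpler[OF that(1,2) side_simpler[OF o nd that(3)]])
  have "Poly_Mapping.keys (expo a b + expo c d) \<subseteq> xl ` {u \<in> diagonals N. simpler (seg N a c) (seg N b d) u}"
    "Poly_Mapping.keys (expo a d + expo b c) \<subseteq> xl ` {u \<in> diagonals N. simpler (seg N a c) (seg N b d) u}"
    unfolding keys_add_nat using k[of a b] k[of c d] k[of a d] k[of b c] o by auto
  then show "relation (seg N a c) (seg N b d) [expo a b + expo c d, expo a d + expo b c]"
    unfolding relation_def using D eq by (simp add: mono_eval_add Y_def)
  assume \<omega>: "positive \<omega>" and e: "e \<in> set [expo a b + expo c d, expo a d + expo b c]"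
  have "Poly_Mapping.lookup \<omega> (xs a c) = W \<omega> a c" "Poly_Mapping.lookup \<omega> (xs b d) = W \<omega> b d"
    using lookup_eq_W D nd by blast+
  then show "weight \<omega> e < Poly_Mapping.lookup \<omega> (xs a c) + Poly_Mapping.lookup \<omega> (xs b d)"
    using e positive_ptolemy[OF \<omega> o] by (auto simp: weight_add W_def)
qed

text \<open>In type A this is the exchange relation itself. In type C it also covers quadrilaterals
  not contained in a half of the polygon, which the exchange relations treat only in special
  cases.\<close>

lemma full_ptolemy:
  assumes nB: "\<not> typeB" and o: "a < b" "b < c" "c < d" "d < a + int N"
  shows "xs a c * xs b d = xs a b * xs c d + xs a d * xs b c"
proof (cases typeA)
  case True
  then show ?thesis using o by (rule exchange_A)
next
  case False
  have Nh: "int N = 2 * int h" by (rule int_N_h[OF False])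
  have per2: "xs i (j + 2 * int h) = xs i j" for i j using seg_shift(2)[of N i j] unfolding Nh by simp
  have R2: "xs a c * xs a (b + int h) = xs a b * xs a (c + int h) + xs a (a + int h) * xs b c"
    if "a < b" "b < c" "c < a + int h" for a b c
    using exchange_2[OF False that] nB by simp
  have R3: "xs a (a + int h) * xs b (b + int h) = xs a b ^ 2 + xs a (b + int h) ^ 2"
    if "a < b" "b < a + int h" for a b
    using exchange_3[OF False that] nB by simp
  have nz: "xs i j \<noteq> 0" if "i < j" "j < i + 2 * int h" for i j using xs_nonzero that Nh by simp
  show ?thesis
    by (rule ptolemy_type_C[of xs "int h", OF xs_commute xs_half[OF False] per2 nz R2 R3 o(1-3) o(4)[unfolded Nh]])
qed

lemma good_not_B:
  assumes nB: "\<not> typeB" and o: "a < b" "b < c" "c < d" "d < a + int N"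
  shows "relation (seg N a c) (seg N b d) [expo a b + expo c d, expo a d + expo b c]"
    and "good (xs a c) (xs b d)"
proof -
  have Y: "Y i j = xs i j" if "i < j" "j < i + int N" for i j using Y_eq[OF that] nB by simp
  have eq: "xs a c * xs b d = Y a b * Y c d + Y a d * Y b c"
    using full_ptolemy[OF nB o] o by (simp add: Y)
  note r = ptolemy_relation[OF o _ eq]
  show "relation (seg N a c) (seg N b d) [expo a b + expo c d, expo a d + expo b c]"
    using r(1) nB by blast
  then show "good (xs a c) (xs b d)" unfolding good_def using r(2) nB by blast
qed

subsection \<open>Type B\<close>

lemma flip_xs: "\<not> typeA \<Longrightarrow> xs u (v + int h) = xs v (u + int h)"
proof -
  assume A: "\<not> typeA"
  have per2: "xs i (j + 2 * int h) = xs i j" for i j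
    using seg_shift(2)[of N i j] unfolding int_N_h[OF A] by simp
  show ?thesis by (rule half_turn_flip[of xs, OF xs_commute xs_half[OF A] per2])
qed

lemma B_ptolemy:
  assumes B: typeB
  shows B_diameter: "\<And>a b c. a < b \<Longrightarrow> b < c \<Longrightarrow> c < a + int h \<Longrightarrow>
      xs b (b + int h) * xs a c = xs a b * xs c (c + int h) + xs b c * xs a (a + int h)"
    and B_double: "\<And>i l k j. i < l \<Longrightarrow> l < k \<Longrightarrow> k < j \<Longrightarrow> j < i + int h \<Longrightarrow>
      xs i j * xs k (l + int h) = xs i k * xs j (l + int h) + xs i (l + int h) * xs k j + 2 * (xs k j * xs i l)"
proof -
  note A = typeB_not_A[OF B]
  have Nh: "int N = 2 * int h" by (rule int_N_h[OF A])
  have per2: "xs i (j + 2 * int h) = xs i j" for i j using seg_shift(2)[of N i j] unfolding Nh by simp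
  have R2: "xs a c * xs a (b + int h) = xs a b * xs a (c + int h) + xs a (a + int h) ^ 2 * xs b c"
    if "a < b" "b < c" "c < a + int h" for a b c
    using exchange_2[OF A that] B by simp
  have R3: "xs a (a + int h) * xs b (b + int h) = xs a b + xs a (b + int h)"
    if "a < b" "b < a + int h" for a b
    using exchange_3[OF A that] B by simp
  have nz: "xs i j \<noteq> 0" if "i < j" "j < i + 2 * int h" for i j using xs_nonzero that Nh by simp
  show "xs b (b + int h) * xs a c = xs a b * xs c (c + int h) + xs b c * xs a (a + int h)"
    if "a < b" "b < c" "c < a + int h" for a b c
    by (rule ptolemy_type_B(1)[of xs "int h", OF xs_commute xs_half[OF A] per2 nz R2 R3]; (assumption | rule that))
  show "xs i j * xs k (l + int h) = xs i k * xs j (l + int h) + xs i (l + int h) * xs k j + 2 * (xs k j * xs i l)"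
    if "i < l" "l < k" "k < j" "j < i + int h" for i l k j
    by (rule ptolemy_type_B(2)[of xs "int h", OF xs_commute xs_half[OF A] per2 nz R2 R3]; (assumption | rule that))
qed

lemma B_less:
  assumes B: typeB and \<omega>: "positive \<omega>"
  shows B_diameter_less: "\<And>a b c. a < b \<Longrightarrow> b < c \<Longrightarrow> c < a + int h \<Longrightarrow>
      2 * W \<omega> a b + W \<omega> c (c + int h) < W \<omega> b (b + int h) + 2 * W \<omega> a c \<and>
      2 * W \<omega> b c + W \<omega> a (a + int h) < W \<omega> b (b + int h) + 2 * W \<omega> a c"
    and B_double_less: "\<And>i l k j. i < l \<Longrightarrow> l < k \<Longrightarrow> k < j \<Longrightarrow> j < i + int h \<Longrightarrow>
      W \<omega> k j + W \<omega> i l < W \<omega> i j + W \<omega> k (l + int h)"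
proof -
  note A = typeB_not_A[OF B]
  have Nh: "int N = 2 * int h" by (rule int_N_h[OF A])
  have per2: "W \<omega> i (j + 2 * int h) = W \<omega> i j" for i j using W_shift[of \<omega> i j] unfolding Nh .
  have P: "W \<omega> a d + W \<omega> b c < W \<omega> a c + W \<omega> b d \<and> W \<omega> a b + W \<omega> c d < W \<omega> a c + W \<omega> b d"
    if "a < b" "b < c" "c < d" "d < a + 2 * int h" for a b c d
    using positive_ptolemy[OF \<omega> that(1-3)] that(4) Nh by simp
  show "2 * W \<omega> a b + W \<omega> c (c + int h) < W \<omega> b (b + int h) + 2 * W \<omega> a c \<and>
      2 * W \<omega> b c + W \<omega> a (a + int h) < W \<omega> b (b + int h) + 2 * W \<omega> a c"
    if "a < b" "b < c" "c < a + int h" for a b c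
    by (rule type_B_less(1)[of "W \<omega>" "int h", OF W_commute W_half[OF A] per2 P]; (assumption | rule that))
  show "W \<omega> k j + W \<omega> i l < W \<omega> i j + W \<omega> k (l + int h)"
    if "i < l" "l < k" "k < j" "j < i + int h" for i l k j
    by (rule type_B_less(2)[of "W \<omega>" "int h", OF W_commute W_half[OF A] per2 P]; (assumption | rule that))
qed

lemma bar_ne: "\<not> typeA \<Longrightarrow> i < j \<Longrightarrow> j < i + int N \<Longrightarrow> j \<noteq> i + int h \<Longrightarrow> bar (seg N i j) \<noteq> seg N i j"
  using diameter_iff[of i j] unfolding diameter_def by blast

lemma bar_diameter: "\<not> typeA \<Longrightarrow> bar (seg N i (i + int h)) = seg N i (i + int h)"
  using diameter_iff[of i "i + int h"] int_N_h h_pos unfolding diameter_def by auto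

text \<open>The quadrilateral lies in one closed half of the polygon. Its outer side may be a
  diameter, which then enters squared; since \<open>Y\<close> squares diameters in type B, both
  cases have the same form.\<close>

lemma B_single_relation:
  assumes B: typeB and o: "a < b" "b < c" "c < d" "d \<le> a + int h" "c < a + int h"
  shows "relation (seg N a c) (seg N b d) [expo a b + expo c d, expo a d + expo b c]"
    and "good (xs a c) (xs b d)"
proof -
  note A = typeB_not_A[OF B]
  have Nh: "int N = 2 * int h" by (rule int_N_h[OF A])
  have o4: "d < a + int N" using o Nh h_pos by simp
  have dia: "diameter i j \<longleftrightarrow> j = i + int h" if "i < j" "j < i + int N" for i j using diameter_iff[OF A that] .
  have nd: "\<not> typeB \<or> \<not> diameter a c \<and> \<not> diameter b d" using dia o Nh by simp
  have Y: "Y a b = xs a b" "Y c d = xs c d" "Y b c = xs b c"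
    "Y a d = (if d = a + int h then xs a d ^ 2 else xs a d)"
    using Y_eq[of a b] Y_eq[of c d] Y_eq[of b c] Y_eq[of a d] dia[of a b] dia[of c d] dia[of b c] dia[of a d] o o4 Nh B
    by simp_all
  have eq: "xs a c * xs b d = Y a b * Y c d + Y a d * Y b c"
  proof (cases "d = a + int h")
    case True
    have "xs a c * xs b (a + int h) = xs a b * xs c (a + int h) + xs a (a + int h) ^ 2 * xs b c"
      using exchange_2[OF A o(1,2,5)] B unfolding flip_xs[OF A, of a b] flip_xs[OF A, of a c] by simp
    then show ?thesis using True unfolding Y by simp
  next
    case False
    then show ?thesis using exchange_1[OF A o(1-3)] o(4) unfolding Y by simp
  qed
  note r = ptolemy_relation[OF o(1-3) o4 nd eq]
  show "relation (seg N a c) (seg N b d) [expo a b + expo c d, expo a d + expo b c]" by (rule r(1))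
  then show "good (xs a c) (xs b d)" unfolding good_def using r(2) by blast
qed

text \<open>Here \<open>[i, j]\<close> crosses the second segment and also its half-turn image, so
  the relation has more terms than the sides of one quadrilateral provide.\<close>

lemma B_double_good:
  assumes B: typeB and o: "i < l" "l < k" "k < j" "j < i + int h"
  shows "good (xs i j) (xs k (l + int h))"
proof -
  note A = typeB_not_A[OF B]
  have Nh: "int N = 2 * int h" and hp: "int h > 0" using int_N_h[OF A] h_pos by simp_all
  let ?l = "seg N i j" and ?m = "seg N k (l + int h)"
  \<comment> \<open>The last exponent is listed twice for the coefficient 2.\<close>
  let ?ms = "[expo i k + expo j (l + int h), expo i (l + int h) + expo k j, expo k j + expo i l, expo k j + expo i l]"
  have q: "i < k" "k < j" "j < l + int h" "l + int h < i + int N" using o Nh by simp_all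
  have dia: "diameter i j \<longleftrightarrow> j = i + int h" if "i < j" "j < i + int N" for i j using diameter_iff[OF A that] .
  have nd: "\<not> typeB \<or> \<not> diameter i j \<and> \<not> diameter k (l + int h)" using dia o Nh by simp
  have side: "simpler ?l ?m s" if "s \<in> {seg N i k, seg N k j, seg N j (l + int h), seg N i (l + int h)}" for s
    by (rule side_simpler[OF q nd that])
  have barm: "bar ?m = seg N (k - int h) l"
  proof -
    have "seg N (k + int h) (l + int h + int h) = seg N (k - int h + int N) (l + int N)"
      using Nh by (simp add: algebra_simps)
    then show ?thesis unfolding bar_seg[OF A] by (simp only: seg_shift)
  qed
  have ms: "?m \<in> segments N" "?l \<in> segments N" using crossing_diagonals[OF q] diagonals_segments by auto
  \<comment> \<open>The image of \<open>?m\<close> runs from \<open>k - h\<close> to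
    \<open>l\<close>; it crosses \<open>?l\<close> but not \<open>[i, l]\<close>, and so provides
    the strict decrease.\<close>
  have extra: "simpler ?l ?m (seg N i l)"
    unfolding simpler_def
  proof (intro allI impI conjI)
    fix T assume T: "type_triangulation X n T"
    have bl: "\<not> typeB \<or> bar ?l \<noteq> ?l" "\<not> typeB \<or> bar ?m \<noteq> ?m"
      using bar_ne[OF A, of i j] bar_ne[OF A, of k "l + int h"] o Nh by auto
    have w: "\<not> crosses N (seg N (k - int h) l) (seg N i l)" "\<not> crosses N ?l (seg N i l)"
      using crosses_window[OF N_pos, of "k - int h" "k - int h" l i l] crosses_window[OF N_pos, of i i j i l] o Nh hp by auto
    have c: "crosses N (seg N (k - int h) l) ?l" by (rule crossesI) (use o Nh hp in linarith)+
    show "crossing_number T (seg N i l) < crossing_number T ?l" if m: "?m \<in> T"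
    proof (rule crossing_number_less[OF card_crossing_less[OF T _ _ c w(1)] bl(1)])
      show bm: "seg N (k - int h) l \<in> T" using triangulationD(4)[OF T m] unfolding barm .
      show "crosses N t ?l" if "t \<in> T" "crosses N t (seg N i l)" for t
        by (rule double_crossing_side(1)[OF N_h[OF A] h_pos o tri_segments[OF T that(1)] that(2)])
          (rule triangulationD(2)[OF T that(1)], rule m bm)+
    qed
    show "crossing_number T (seg N i l) < crossing_number T ?m" if l: "?l \<in> T"
    proof (rule crossing_number_less[OF _ bl(2)])
      have "card (crossing_set T (seg N i l)) < card (crossing_set T (seg N (k - int h) l))"
      proof (rule card_crossing_less[OF T _ l crosses_sym[OF c] w(2)])
        show "crosses N t (seg N (k - int h) l)" if "t \<in> T" "crosses N t (seg N i l)" for t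
          by (rule double_crossing_side(2)[OF N_h[OF A] h_pos o tri_segments[OF T that(1)] that(2)
            triangulationD(2)[OF T that(1) l]])
      qed
      then show "card (crossing_set T (seg N i l)) < card (crossing_set T ?m)"
        using card_crossing_bar[OF T ms(1)] unfolding barm by simp
    qed
  qed
  have k: "Poly_Mapping.keys (expo i' j') \<subseteq> xl ` {u \<in> diagonals N. simpler ?l ?m u}"
    if "i' < j'" "j' < i' + int N" "simpler ?l ?m (seg N i' j')" for i' j'
    by (rule keys_expo_simpler[OF that])
  have keys: "Poly_Mapping.keys e \<subseteq> xl ` {u \<in> diagonals N. simpler ?l ?m u}" if "e \<in> set ?ms" for e
  proof -
    have 1: "Poly_Mapping.keys (expo i k) \<subseteq> xl ` {u \<in> diagonals N. simpler ?l ?m u}"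
      by (rule k) (use o Nh in linarith, use o Nh in linarith, rule side, simp)
    have 2: "Poly_Mapping.keys (expo j (l + int h)) \<subseteq> xl ` {u \<in> diagonals N. simpler ?l ?m u}"
      by (rule k) (use o Nh in linarith, use o Nh in linarith, rule side, simp)
    have 3: "Poly_Mapping.keys (expo i (l + int h)) \<subseteq> xl ` {u \<in> diagonals N. simpler ?l ?m u}"
      by (rule k) (use o Nh in linarith, use o Nh in linarith, rule side, simp)
    have 4: "Poly_Mapping.keys (expo k j) \<subseteq> xl ` {u \<in> diagonals N. simpler ?l ?m u}"
      by (rule k) (use o Nh in linarith, use o Nh in linarith, rule side, simp)
    have 5: "Poly_Mapping.keys (expo i l) \<subseteq> xl ` {u \<in> diagonals N. simpler ?l ?m u}"
      by (rule k) (use o Nh in linarith, use o Nh in linarith, rule extra)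
    show ?thesis using that 1 2 3 4 5 by (auto simp only: list.set insert_iff empty_iff keys_add_nat Un_subset_iff)
  qed
  have Y: "Y a b = xs a b" if "a < b" "b < a + int N" "b \<noteq> a + int h" for a b
    using Y_eq[OF that(1,2)] dia[OF that(1,2)] that(3) by simp
  have Y': "Y i k = xs i k" "Y j (l + int h) = xs j (l + int h)" "Y i (l + int h) = xs i (l + int h)"
    "Y k j = xs k j" "Y i l = xs i l"
    by (rule Y; use o Nh in linarith)+
  have "(\<Sum>e\<leftarrow>?ms. mono_eval (\<lambda>v. v) e) = Y i k * Y j (l + int h) + (Y i (l + int h) * Y k j + (Y k j * Y i l + Y k j * Y i l))"
    by (simp add: mono_eval_add Y_def)
  also have "\<dots> = xs i j * xs k (l + int h)"
    unfolding B_double[OF B o] Y' by simp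
  finally have rel: "relation ?l ?m ?ms"
    unfolding relation_def using crossing_diagonals[OF q] keys by blast
  have "weight \<omega> e < Poly_Mapping.lookup \<omega> (xs i j) + Poly_Mapping.lookup \<omega> (xs k (l + int h))"
    if \<omega>: "positive \<omega>" and e: "e \<in> set ?ms" for \<omega> e
  proof -
    have "Poly_Mapping.lookup \<omega> (xs i j) = W \<omega> i j" "Poly_Mapping.lookup \<omega> (xs k (l + int h)) = W \<omega> k (l + int h)"
      using lookup_eq_W crossing_diagonals[OF q] nd by blast+
    then show ?thesis using e positive_ptolemy[OF \<omega> q] B_double_less[OF B \<omega> o]
      by (auto simp: weight_add W_def)
  qed
  then show ?thesis unfolding good_def using rel by blast
qed

text \<open>A diameter has multiplicity 1 and \<open>[a, b]\<close> may have multiplicity 2, so the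
  crossing sets must differ by a factor of 2. This holds because crossings of \<open>[a, b]\<close>
  and of its image are disjoint sets of crossings of the diameter.\<close>

lemma B_two_diameters:
  assumes B: typeB and o: "a < b" "b < a + int h"
  shows "relation (seg N a (a + int h)) (seg N b (b + int h)) [expo a b, expo a (b + int h)]"
    and "good (xs a (a + int h)) (xs b (b + int h))"
proof -
  note A = typeB_not_A[OF B]
  have Nh: "int N = 2 * int h" and hp: "int h > 0" using int_N_h[OF A] h_pos by simp_all
  have less: "2 * card (crossing_set T (seg N a b)) < card (crossing_set T (seg N a (a + int h)))"
    if T: "type_triangulation X n T" and b: "seg N b (b + int h) \<in> T" and o: "a < b" "b < a + int h" for T a b
  proof (rule card_crossing_double_less[OF T _ _ _ b])
    have q: "a < b" "b < a + int h" "a + int h < b + int h" "b + int h < a + int N" using o Nh by simp_all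
    have bar: "bar (seg N a b) = seg N (a + int h) (b + int h)" by (rule bar_seg[OF A])
    show "seg N a b \<in> segments N" by (rule seg_in_segments) (use o Nh in linarith)+
    show "crosses N t (seg N a (a + int h))" if "t \<in> T" "crosses N t (seg N a b) \<or> crosses N t (bar (seg N a b))" for t
      using that(2) unfolding bar
      by (elim disjE; intro side_crosses[OF q tri_segments[OF T that(1)] triangulationD(2)[OF T that(1) b]]) auto
    show False if "t \<in> T" "crosses N t (seg N a b)" "crosses N t (bar (seg N a b))" for t
      using crosses_opposite_sides[OF N_h[OF A] h_pos o tri_segments[OF T that(1)] that(2) that(3)[unfolded bar]]
        triangulationD(2)[OF T that(1) b] by blast
    show "crosses N (seg N b (b + int h)) (seg N a (a + int h))" by (rule crosses_sym[OF crossesI[OF q]])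
    show "\<not> crosses N (seg N b (b + int h)) (seg N a b)" "\<not> crosses N (seg N b (b + int h)) (bar (seg N a b))"
      unfolding bar by (rule side_not_crosses[OF q], simp)+
  qed
  have less': "2 * card (crossing_set T (seg N a b)) < card (crossing_set T (seg N b (b + int h)))"
    if T: "type_triangulation X n T" and a: "seg N a (a + int h) \<in> T" and o: "a < b" "b < a + int h" for T a b
  proof (rule card_crossing_double_less[OF T _ _ _ a])
    have q: "a < b" "b < a + int h" "a + int h < b + int h" "b + int h < a + int N" using o Nh by simp_all
    note q' = rotate_quad[OF q]
    have bar: "bar (seg N a b) = seg N (a + int h) (b + int h)" by (rule bar_seg[OF A])
    have e: "seg N (a + int h) (a + int N) = seg N a (a + int h)" "seg N b (a + int N) = seg N a b"
      unfolding seg_shift seg_commute[of N _ a] by simp_all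
    show "seg N a b \<in> segments N" by (rule seg_in_segments) (use o Nh in linarith)+
    show "crosses N t (seg N b (b + int h))" if "t \<in> T" "crosses N t (seg N a b) \<or> crosses N t (bar (seg N a b))" for t
      using that(2) unfolding bar
      by (elim disjE; intro side_crosses[OF q' tri_segments[OF T that(1)], unfolded e] triangulationD(2)[OF T that(1) a]) auto
    show False if "t \<in> T" "crosses N t (seg N a b)" "crosses N t (bar (seg N a b))" for t
      using crosses_opposite_sides[OF N_h[OF A] h_pos o tri_segments[OF T that(1)] that(2) that(3)[unfolded bar]]
        triangulationD(2)[OF T that(1) a] by blast
    show "crosses N (seg N a (a + int h)) (seg N b (b + int h))" by (rule crossesI[OF q])
    show "\<not> crosses N (seg N a (a + int h)) (seg N a b)" "\<not> crosses N (seg N a (a + int h)) (bar (seg N a b))"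
      unfolding bar using side_not_crosses[OF q', unfolded e] by simp_all
  qed
  let ?l = "seg N a (a + int h)" and ?m = "seg N b (b + int h)"
  have q: "a < b" "b < a + int h" "a + int h < b + int h" "b + int h < a + int N" using o Nh by simp_all
  have s1: "simpler ?l ?m (seg N a b)" unfolding simpler_def
    using less less' o crossing_number_le crossing_number_ge by (meson le_less_trans less_le_trans)
  have e: "seg N (a + int h) (a + int h + int h) = ?l"
    using Nh seg_shift(2)[of N "a + int h" a] unfolding seg_commute[of N a] by (simp add: algebra_simps)
  have e2: "seg N a (b + int h) = bar (seg N b (a + int h))"
    unfolding bar_seg[OF A] using Nh seg_shift(2)[of N "b + int h" a] unfolding seg_commute[of N a] by (simp add: algebra_simps)
  have o2: "b < a + int h" "a + int h < b + int h" using o by simp_all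
  \<comment> \<open>The segment from \<open>a\<close> to \<open>b + h\<close> is the image of the
    one from \<open>b\<close> to \<open>a + h\<close>, so the previous bounds apply to the pair
    \<open>b\<close>, \<open>a + h\<close>, with the two diameters exchanged.\<close>
  have s2: "simpler ?l ?m (seg N a (b + int h))" unfolding simpler_def
  proof (intro allI impI conjI)
    fix T assume T: "type_triangulation X n T"
    have cn: "crossing_number T (seg N a (b + int h)) \<le> 2 * card (crossing_set T (seg N b (a + int h)))"
      using crossing_number_le[of T "seg N a (b + int h)"] card_crossing_bar[OF T, of "seg N b (a + int h)"]
        seg_in_segments[of b "a + int h" N] o Nh unfolding e2 by simp
    show "crossing_number T (seg N a (b + int h)) < crossing_number T ?l" if "?m \<in> T"
      using less'[OF T that o2] cn crossing_number_ge[of T ?l] unfolding e by linarith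
    show "crossing_number T (seg N a (b + int h)) < crossing_number T ?m" if "?l \<in> T"
      using less[OF T _ o2] that cn crossing_number_ge[of T ?m] unfolding e by linarith
  qed
  have dia: "diameter i j \<longleftrightarrow> j = i + int h" if "i < j" "j < i + int N" for i j using diameter_iff[OF A that] .
  have Y: "Y a b = xs a b" "Y a (b + int h) = xs a (b + int h)"
    using Y_eq[of a b] Y_eq[of a "b + int h"] dia[of a b] dia[of a "b + int h"] o Nh by simp_all
  have k1: "Poly_Mapping.keys (expo a b) \<subseteq> xl ` {u \<in> diagonals N. simpler ?l ?m u}"
    by (rule keys_expo_simpler[OF _ _ s1]) (use o Nh in linarith)+
  have k2: "Poly_Mapping.keys (expo a (b + int h)) \<subseteq> xl ` {u \<in> diagonals N. simpler ?l ?m u}"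
    by (rule keys_expo_simpler[OF _ _ s2]) (use o Nh in linarith)+
  have "mono_eval (\<lambda>v. v) (expo a b) + mono_eval (\<lambda>v. v) (expo a (b + int h)) = xl ?l * xl ?m"
    using exchange_3[OF A o] B unfolding Y_def[symmetric] Y by simp
  then show rel: "relation ?l ?m [expo a b, expo a (b + int h)]"
    unfolding relation_def using crossing_diagonals[OF q] k1 k2 by simp
  have "weight \<omega> e < Poly_Mapping.lookup \<omega> (xl ?l) + Poly_Mapping.lookup \<omega> (xl ?m)"
    if \<omega>: "positive \<omega>" and e: "e \<in> set [expo a b, expo a (b + int h)]" for \<omega> e
  proof -
    have "2 * Poly_Mapping.lookup \<omega> (xl ?l) = W \<omega> a (a + int h)" "2 * Poly_Mapping.lookup \<omega> (xl ?m) = W \<omega> b (b + int h)"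
      using lookup_diameter[OF _ B] crossing_diagonals[OF q] dia[of a "a + int h"] dia[of b "b + int h"] Nh hp by simp_all
    moreover have "W \<omega> (a + int h) (b + int h) = W \<omega> a b" by (rule W_half[OF A])
    moreover have "W \<omega> b (a + int h) = W \<omega> a (b + int h)"
    proof -
      have "W \<omega> b (a + int h) = W \<omega> (b + int h) (a + int h + int h)" by (rule W_half[OF A, symmetric])
      also have "a + int h + int h = a + int N" using Nh by simp
      finally show ?thesis by (simp only: W_shift W_commute[of \<omega> _ a])
    qed
    ultimately show ?thesis using e positive_ptolemy[OF \<omega> q] by (auto simp: W_def)
  qed
  then show "good (xl ?l) (xl ?m)" unfolding good_def using rel by blast
qed

end

text \<open>The counterpart of \<open>crosses_opposite_sides\<close> for the side that ends at
  \<open>c\<close>.\<close>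

lemma opposite_sides_cross:
  assumes N: "N = 2 * h" "h > 0" and o: "a < b" "b < c" "c < a + int h"
    and t: "t \<in> segments N" "crosses N t (seg N b c)" "crosses N t (seg N (b + int h) (c + int h))"
  shows "crosses N t (seg N a c)"
proof -
  have N0: "N > 0" using N by simp
  obtain p q where pq: "a \<le> p" "p < q" "q < a + int N" "t = seg N p q" using segments_window[OF N0 t(1), of a] .
  have cr: "crosses N (seg N p q) (seg N i j) \<longleftrightarrow> p < i \<and> i < q \<and> q < j \<or> i < p \<and> p < j \<and> j < q"
    if "a \<le> i" "i < j" "j < a + 2 * int h" for i j
    using crosses_window[OF N0 pq(1-3), of i j] that N by auto
  have h0: "int h > 0" using N by simp
  have f1: "crosses N (seg N p q) (seg N b c) \<longleftrightarrow> p < b \<and> b < q \<and> q < c \<or> b < p \<and> p < c \<and> c < q"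
    by (rule cr) (use o h0 in linarith)+
  have f2: "crosses N (seg N p q) (seg N (b + int h) (c + int h)) \<longleftrightarrow>
      p < b + int h \<and> b + int h < q \<and> q < c + int h \<or> b + int h < p \<and> p < c + int h \<and> c + int h < q"
    by (rule cr) (use o h0 in linarith)+
  have f3: "crosses N (seg N p q) (seg N a c) \<longleftrightarrow> p < a \<and> a < q \<and> q < c \<or> a < p \<and> p < c \<and> c < q"
    by (rule cr) (use o h0 in linarith)+
  show ?thesis
    using t(2,3) o pq(1-3) h0 unfolding pq(4) f1 f2 f3 by linarith
qed

context polygon_cluster
begin

lemma diameter_diagonal: "\<not> typeA \<Longrightarrow> seg N i (i + int h) \<in> diagonals N"
  using seg_diagonals_iff[of i "i + int h" N] int_N_h n_ge by (simp add: h_def)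

text \<open>Multiplicities differ on both sides: a diameter and a doubly counted segment are
  compared with other segments and diameters, in two triangulations. Each comparison therefore needs
  its own count.\<close>

lemma B_diameter_good:
  assumes B: typeB and o: "a < b" "b < c" "c < a + int h"
  shows "good (xs b (b + int h)) (xs a c)"
proof -
  note A = typeB_not_A[OF B]
  have Nh: "int N = 2 * int h" and hp: "int h > 0" using int_N_h[OF A] h_pos by simp_all
  let ?l = "seg N b (b + int h)" and ?m = "seg N a c"
  let ?c = "seg N c (c + int h)" and ?a = "seg N a (a + int h)"
  \<comment> \<open>The diameters at \<open>c\<close> and \<open>a\<close> occur to the first power
    here, so \<open>expo\<close>, which squares them, cannot be used for them.\<close>
  let ?ms = "[expo a b + Poly_Mapping.single (xl ?c) 1, expo b c + Poly_Mapping.single (xl ?a) 1]"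
  have q: "a < b" "b < c" "c < b + int h" "b + int h < a + int N" using o Nh by simp_all
  have cr: "crosses N ?m (seg N p q) \<longleftrightarrow> a < p \<and> p < c \<and> c < q \<or> p < a \<and> a < q \<and> q < c"
    if "a \<le> p" "p < q" "q < a + int N" for p q
    using crosses_window[OF N_pos, of a a c p q] that o Nh hp by auto
  have zl: "crosses N ?m ?l" by (rule crossesI[OF q])
  have barm: "bar ?m = seg N (a + int h) (c + int h)" by (rule bar_seg[OF A])
  have mne: "bar ?m \<noteq> ?m" by (rule bar_ne[OF A]) (use o Nh hp in linarith)+
  have mseg: "?m \<in> segments N" by (rule seg_in_segments) (use o Nh hp in linarith)+
  have cn_diam: "crossing_number T (seg N i (i + int h)) = card (crossing_set T (seg N i (i + int h)))" for T i
    using bar_diameter[OF A, of i] by (simp add: crossing_number_def mult_def)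
  have cn_m: "crossing_number T ?m = 2 * card (crossing_set T ?m)" for T
    using mne B by (simp add: crossing_number_def mult_def)
  have dc: "crosses N t ?l" if T: "type_triangulation X n T" "?m \<in> T" and t: "t \<in> T" and
    s: "s \<in> {?a, ?c, seg N a b, seg N b c, seg N (a + int h) (b + int h), seg N (b + int h) (c + int h)}" "crosses N t s" for T t s
  proof (rule diameter_crosses[OF N_h[OF A] h_pos o tri_segments[OF T(1) t] _ _ s])
    show "\<not> crosses N t ?m" by (rule triangulationD(2)[OF T(1) t T(2)])
    show "\<not> crosses N t (seg N (a + int h) (c + int h))"
      using triangulationD(2)[OF T(1) t triangulationD(4)[OF T(1,2)]] unfolding barm .
  qed
  have side: "simpler ?l ?m (seg N u v)" if uv: "u = a \<and> v = b \<or> u = b \<and> v = c" for u v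
    unfolding simpler_def
  proof (intro allI impI conjI)
    fix T assume T: "type_triangulation X n T"
    show "crossing_number T (seg N u v) < crossing_number T ?l" if m: "?m \<in> T"
    proof -
      have bar: "bar (seg N u v) = seg N (u + int h) (v + int h)" by (rule bar_seg[OF A])
      have "2 * card (crossing_set T (seg N u v)) < card (crossing_set T ?l)"
      proof (rule card_crossing_double_less[OF T _ _ _ m zl])
        show "seg N u v \<in> segments N" by (rule seg_in_segments) (use uv o Nh hp in linarith)+
        show "crosses N t ?l" if "t \<in> T" "crosses N t (seg N u v) \<or> crosses N t (bar (seg N u v))" for t
        proof -
          have "seg N u v \<in> {?a, ?c, seg N a b, seg N b c, seg N (a + int h) (b + int h), seg N (b + int h) (c + int h)}"
            "seg N (u + int h) (v + int h) \<in> {?a, ?c, seg N a b, seg N b c, seg N (a + int h) (b + int h), seg N (b + int h) (c + int h)}"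
            using uv by auto
          then show ?thesis using that(2) dc[OF T m that(1)] unfolding bar by blast
        qed
        show False if t: "t \<in> T" "crosses N t (seg N u v)" "crosses N t (bar (seg N u v))" for t
        proof -
          have ts: "t \<in> segments N" by (rule tri_segments[OF T t(1)])
          have "crosses N t ?m"
            using uv
          proof
            assume "u = a \<and> v = b"
            then show ?thesis
              using crosses_opposite_sides[OF N_h[OF A] h_pos, of a b t] o ts t(2) t(3)[unfolded bar] by auto
          next
            assume "u = b \<and> v = c"
            then show ?thesis
              using opposite_sides_cross[OF N_h[OF A] h_pos o ts] t(2) t(3)[unfolded bar] by auto
          qed
          then show False using triangulationD(2)[OF T t(1) m] by blast
        qed
        show "\<not> crosses N ?m (seg N u v)" "\<not> crosses N ?m (bar (seg N u v))"
          unfolding bar using uv o Nh hp cr[of u v] cr[of "u + int h" "v + int h"] by auto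
      qed
      then show ?thesis using crossing_number_le[of T "seg N u v"] crossing_number_ge[of T ?l] by linarith
    qed
    show "crossing_number T (seg N u v) < crossing_number T ?m" if l: "?l \<in> T"
    proof (rule crossing_number_less)
      show "card (crossing_set T (seg N u v)) < card (crossing_set T ?m)"
        by (rule card_crossing_side_less(1)[OF T q _ l]) (use uv in auto)
    qed (simp add: mne)
  qed
  have diam: "simpler ?l ?m (seg N u (u + int h))" if u: "u = a \<or> u = c" for u
    unfolding simpler_def cn_diam cn_m
  proof (intro allI impI conjI)
    fix T assume T: "type_triangulation X n T"
    let ?u = "seg N u (u + int h)"
    show "card (crossing_set T ?u) < card (crossing_set T ?l)" if m: "?m \<in> T"
    proof (rule card_crossing_less[OF T _ m zl])
      show "crosses N t ?l" if "t \<in> T" "crosses N t ?u" for t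
        by (rule dc[OF T m that(1) _ that(2)]) (use u in blast)
      show "\<not> crosses N ?m ?u" using u o Nh hp cr[of u "u + int h"] by auto
    qed
    show "card (crossing_set T ?u) < 2 * card (crossing_set T ?m)" if l: "?l \<in> T"
    proof -
      let ?A = "crossing_set T ?m" and ?B = "crossing_set T (bar ?m)"
      note fin = finite_crossing_set[OF T]
      \<comment> \<open>A member crossing the diameter at \<open>u\<close> crosses \<open>?m\<close>
        or its image. These two crossing sets have equal size and share \<open>?l\<close>, which
        makes the bound by twice that size strict.\<close>
      have "crossing_set T ?u \<subseteq> ?A \<union> ?B"
      proof
        fix t assume t: "t \<in> crossing_set T ?u"
        then have tT: "t \<in> T" and "crosses N t ?c \<or> crosses N t ?a" using u by (auto simp: crossing_set_def)
        then have "crosses N t ?m \<or> crosses N t (bar ?m)"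
          unfolding barm
          using diameter_crosses_side[OF N_h[OF A] h_pos o tri_segments[OF T tT] triangulationD(2)[OF T tT l]] by blast
        then show "t \<in> ?A \<union> ?B" using tT by (auto simp: crossing_set_def)
      qed
      then have "card (crossing_set T ?u) \<le> card (?A \<union> ?B)" using fin by (intro card_mono) auto
      moreover have "card (?A \<union> ?B) + card (?A \<inter> ?B) = 2 * card ?A"
        using card_Un_Int[OF fin fin, of ?m "bar ?m"] card_crossing_bar[OF T mseg] by simp
      moreover have "card (?A \<inter> ?B) > 0"
      proof -
        have "crosses N ?l (bar ?m)" using bar_crosses[OF crosses_sym[OF zl]] bar_diameter[OF A, of b] by simp
        then have "?l \<in> ?A \<inter> ?B" using l crosses_sym[OF zl] by (simp add: crossing_set_def)
        then show ?thesis using fin by (auto simp: card_gt_0_iff)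
      qed
      ultimately show ?thesis by linarith
    qed
  qed
  have D: "?l \<in> diagonals N" "?m \<in> diagonals N" using crossing_diagonals[OF q] by auto
  have Dac: "?a \<in> diagonals N" "?c \<in> diagonals N" by (rule diameter_diagonal[OF A])+
  have "Poly_Mapping.keys (expo a b) \<subseteq> xl ` {u \<in> diagonals N. simpler ?l ?m u}"
    "Poly_Mapping.keys (expo b c) \<subseteq> xl ` {u \<in> diagonals N. simpler ?l ?m u}"
    by (rule keys_expo_simpler, use o Nh hp in linarith, use o Nh hp in linarith, rule side, simp)+
  moreover have "{xl ?a, xl ?c} \<subseteq> xl ` {u \<in> diagonals N. simpler ?l ?m u}"
    using diam[of a] diam[of c] Dac by blast
  ultimately have keys: "\<forall>e\<in>set ?ms. Poly_Mapping.keys e \<subseteq> xl ` {u \<in> diagonals N. simpler ?l ?m u}"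
    by (simp add: keys_add_nat)
  have dia: "diameter i j \<longleftrightarrow> j = i + int h" if "i < j" "j < i + int N" for i j using diameter_iff[OF A that] .
  have Y: "Y a b = xs a b" "Y b c = xs b c"
    using Y_eq[of a b] Y_eq[of b c] dia[of a b] dia[of b c] o Nh hp by simp_all
  have "(\<Sum>e\<leftarrow>?ms. mono_eval (\<lambda>v. v) e) = Y a b * xl ?c + Y b c * xl ?a"
    by (simp add: mono_eval_add Y_def)
  also have "\<dots> = xl ?l * xl ?m" unfolding Y using B_diameter[OF B o] by simp
  finally have rel: "relation ?l ?m ?ms" unfolding relation_def using D keys by blast
  have "weight \<omega> e < Poly_Mapping.lookup \<omega> (xl ?l) + Poly_Mapping.lookup \<omega> (xl ?m)"
    if \<omega>: "positive \<omega>" and e: "e \<in> set ?ms" for \<omega> e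
  proof -
    have "2 * Poly_Mapping.lookup \<omega> (xs i (i + int h)) = W \<omega> i (i + int h)" for i
      using lookup_diameter[OF diameter_diagonal[OF A] B] dia[of i "i + int h"] Nh hp by simp
    from this[of a] this[of b] this[of c]
    have "2 * Poly_Mapping.lookup \<omega> (xl ?a) = W \<omega> a (a + int h)" "2 * Poly_Mapping.lookup \<omega> (xl ?l) = W \<omega> b (b + int h)"
      "2 * Poly_Mapping.lookup \<omega> (xl ?c) = W \<omega> c (c + int h)" .
    moreover have "Poly_Mapping.lookup \<omega> (xl ?m) = W \<omega> a c"
      using lookup_eq_W[OF D(2)] dia[of a c] o Nh hp by simp
    moreover have "e = expo a b + Poly_Mapping.single (xl ?c) 1 \<or> e = expo b c + Poly_Mapping.single (xl ?a) 1"
      using e by simp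
    ultimately show ?thesis using B_diameter_less[OF B \<omega> o] by (auto simp: weight_add W_def)
  qed
  then show ?thesis unfolding good_def using rel by blast
qed

text \<open>If \<open>m\<close> passes the antipode of \<open>i\<close>, its own antipode
  \<open>m - h\<close> falls between \<open>i\<close> and \<open>k\<close>, which is the
  configuration of a double crossing.\<close>

lemma B_minor_good:
  assumes B: typeB and o: "i < k" "k < j" "j < m" "m < i + int N" "j < i + int h" "m < k + int h"
  shows "good (xs i j) (xs k m)"
proof (cases "m \<le> i + int h")
  case True
  then show ?thesis using B_single_relation(2)[OF B o(1-3) True o(5)] by blast
next
  case False
  have "good (xs i j) (xs k (m - int h + int h))"
    by (rule B_double_good[OF B]) (use o False in linarith)+
  then show ?thesis by simp
qed

lemma crossing_good:
  assumes "crosses N l m"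
  shows "good (xl l) (xl m)"
proof -
  obtain a b c d where o: "a < b" "b < c" "c < d" "d < a + int N" and lm: "l = seg N a c" "m = seg N b d"
    using assms by (rule crossesE)
  show ?thesis
  proof (cases typeB)
    case False
    then show ?thesis using good_not_B(2)[OF False o] lm by simp
  next
    case B: True
    note A = typeB_not_A[OF B]
    have Nh: "int N = 2 * int h" and hp: "int h > 0" using int_N_h[OF A] h_pos by simp_all
    have half: "good (xs a c) (xs b d)"
      if o: "a < b" "b < c" "c < d" "d < a + int N" and c: "c = a + int h" for a b c d
    proof -
      have e: "seg N (a + int h) (a + int h + int h) = seg N a (a + int h)"
        using bar_diameter[OF A, of a] unfolding bar_seg[OF A] .
      consider "d = b + int h" | "d < b + int h" | "b + int h < d" by linarith
      then show ?thesis
      proof cases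
        case 1
        then show ?thesis using B_two_diameters(2)[OF B, of a b] o c by simp
      next
        case 2
        have "good (xs (a + int h) (a + int h + int h)) (xs b d)"
          by (rule B_diameter_good[OF B]) (use o c 2 in linarith)+
        then show ?thesis unfolding e c .
      next
        case 3
        have "good (xs a (a + int h)) (xs (d - int N) b)"
          by (rule B_diameter_good[OF B]) (use o c 3 Nh in linarith)+
        then show ?thesis unfolding c seg_shift_minus seg_commute[of N d b] .
      qed
    qed
    have rot: "xs b (a + int N) = xs a b" for a b unfolding seg_shift seg_commute[of N b a] ..
    \<comment> \<open>If neither segment is a diameter, moving endpoints by \<open>N\<close> reads
      each of them along its minor arc; the four cases say which of the two are read along the major
      arc at the outset.\<close>
    consider "c = a + int h" | "d = b + int h" | "c < a + int h" "d < b + int h" | "c < a + int h" "b + int h < d"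
      | "a + int h < c" "d < b + int h" | "a + int h < c" "b + int h < d" by linarith
    then have "good (xs a c) (xs b d)"
    proof cases
      case 1
      then show ?thesis by (rule half[OF o])
    next
      case 2
      have "good (xs b d) (xs c (a + int N))" by (rule half[OF rotate_quad[OF o] 2])
      then show ?thesis unfolding rot by (rule good_sym)
    next
      case 3
      then show ?thesis using B_minor_good[OF B o] by blast
    next
      case 4
      have "good (xs (d - int N) b) (xs a c)"
        by (rule B_minor_good[OF B]) (use o 4 Nh in linarith)+
      then show ?thesis unfolding seg_shift_minus seg_commute[of N d b] by (rule good_sym)
    next
      case 5
      have "good (xs b d) (xs c (a + int N))"
        by (rule B_minor_good[OF B]) (use o 5 Nh in linarith)+
      then show ?thesis unfolding rot by (rule good_sym)
    next
      case 6
      have "good (xs c (a + int N)) (xs d (b + int N))"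
        by (rule B_minor_good[OF B]) (use o 6 Nh in linarith)+
      then show ?thesis unfolding rot .
    qed
    then show ?thesis unfolding lm .
  qed
qed

section \<open>The open Groebner cone\<close>

definition rel_poly :: "('f \<Rightarrow>\<^sub>0 nat) list \<Rightarrow> ('f, 'k) mpoly" where
  "rel_poly ms = (\<Sum>m\<leftarrow>ms. Poly_Mapping.single m 1)"

lemma relation_poly:
  assumes "relation l m ms"
  shows "rel_poly ms \<in> carrier (mpoly_ring V)" "peval \<iota> (\<lambda>v. v) (rel_poly ms) = xl l * xl m"
    "Poly_Mapping.keys (rel_poly ms) = set ms"
proof -
  show k: "Poly_Mapping.keys (rel_poly ms) = set ms" unfolding rel_poly_def by (rule keys_sum_list_single)
  have "Poly_Mapping.keys e \<subseteq> V" if "e \<in> set ms" for e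
    using assms that unfolding relation_def V_eq by blast
  then show "rel_poly ms \<in> carrier (mpoly_ring V)" unfolding mpoly_carrier k by blast
  show "peval \<iota> (\<lambda>v. v) (rel_poly ms) = xl l * xl m"
    unfolding rel_poly_def sum_list_eval[OF emb] using assms unfolding relation_def by blast
qed

lemma positive_imp_initial_ideal:
  assumes "positive \<omega>"
  shows "initial_ideal V \<omega> (relation_ideal \<iota> V) = incompatibility_ideal V Cl"
proof (rule initial_ideal_eq_incompatibility_ideal[where size = crossing_size, OF V_cover cluster_indep])
  show "\<exists>T\<in>Cl. A \<subseteq> T" if "A \<subseteq> V" "\<forall>v\<in>A. \<forall>w\<in>A. common_cluster Cl v w" for A
    by (rule pairwise_common_cluster[OF that])
  show "\<exists>w\<in>T. \<not> common_cluster Cl v w" if "T \<in> Cl" "v \<in> V - T" for T v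
    by (rule cluster_maximal[OF that])
next
  fix v w assume vw: "v \<in> V" "w \<in> V" "\<not> common_cluster Cl v w"
  then obtain l0 m0 where "crosses N l0 m0" "v = xl l0" "w = xl m0" by (rule incompatible_crossing)
  then have "good v w" using crossing_good by blast
  then obtain l m ms where lm: "v = xl l" "w = xl m" and rel: "relation l m ms"
    and wt: "\<forall>\<omega>. positive \<omega> \<longrightarrow> (\<forall>e\<in>set ms. weight \<omega> e < Poly_Mapping.lookup \<omega> v + Poly_Mapping.lookup \<omega> w)"
    unfolding good_def by (elim exE conjE)
  note g = relation_poly[OF rel]
  have "crossing_size T u < crossing_size T v" if T: "T \<in> Cl" "w \<in> T" and e: "e \<in> set ms" "u \<in> Poly_Mapping.keys e" for T e u
  proof -
    obtain Tr where Tr: "type_triangulation X n Tr" "T = xl ` Tr" using T(1) unfolding clusters_eq by blast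
    have lmD: "l \<in> diagonals N" "m \<in> diagonals N" using rel unfolding relation_def by auto
    have "m \<in> Tr" using xl_mem[OF Tr(1) lmD(2)] T(2) lm(2) Tr(2) by simp
    obtain u' where u': "u' \<in> diagonals N" "simpler l m u'" "u = xl u'"
      using rel e unfolding relation_def by blast
    have "crossing_number Tr u' < crossing_number Tr l"
      using u'(2) Tr(1) \<open>m \<in> Tr\<close> unfolding simpler_def by blast
    then show ?thesis
      unfolding Tr(2) u'(3) lm(1) crossing_size_eq[OF Tr(1) u'(1)] crossing_size_eq[OF Tr(1) lmD(1)] .
  qed
  then show "\<exists>g\<in>carrier (mpoly_ring V). peval \<iota> (\<lambda>v. v) g = v * w \<and>
      (\<forall>m\<in>Poly_Mapping.keys g. weight \<omega> m < Poly_Mapping.lookup \<omega> v + Poly_Mapping.lookup \<omega> w \<and>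
        (\<forall>T\<in>Cl. w \<in> T \<longrightarrow> (\<forall>u\<in>Poly_Mapping.keys m. crossing_size T u < crossing_size T v)))"
    using g wt assms unfolding lm[symmetric] by (intro bexI[of _ "rel_poly ms"]) auto
qed

lemma standard_mono: "standard Cl' m \<Longrightarrow> Poly_Mapping.keys m' \<subseteq> Poly_Mapping.keys m \<Longrightarrow> standard Cl' m'"
  unfolding standard_def by blast

text \<open>The two segments are nested, hence do not cross. For the half-turn image of the outer
  one: it lies on the other side of the polygon, or is the outer segment itself when
  \<open>j + 1 = i + h\<close>, or is the inner segment when \<open>j = i + h\<close>.\<close>

lemma standard_exchange:
  assumes ij: "i + 2 \<le> j" "j \<le> i + int N - 2" and half: "typeA \<or> j \<le> i + int h"
  shows "standard Cl (expo i (j + 1) + expo (i + 1) j)"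
proof -
  let ?p = "seg N i (j + 1)" and ?q = "seg N (i + 1) j"
  have nc: "\<not> crosses N ?p ?q"
    using crosses_window[OF N_pos, of i i "j + 1" "i + 1" j] ij by auto
  have nc2: "\<not> crosses N (bar ?p) ?q"
  proof (cases typeA)
    case True
    then show ?thesis using nc by (simp add: bar_def)
  next
    case False
    have Nh: "int N = 2 * int h" and hp: "int h > 0" using int_N_h[OF False] h_pos by simp_all
    have b: "bar ?p = seg N (i + int h) (j + 1 + int h)" by (rule bar_seg[OF False])
    have jh: "j \<le> i + int h" using half False by simp
    consider "j + 1 < i + int h" | "j + 1 = i + int h" | "j = i + int h" using jh by linarith
    then show ?thesis
    proof cases
      case 1
      then show ?thesis unfolding b
        using crosses_window[OF N_pos, of i "i + int h" "j + 1 + int h" "i + 1" j] ij Nh hp by auto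
    next
      case 2
      have "seg N (i + int h) (j + 1 + int h) = seg N (i + int h) (i + int N)" using 2 Nh by (simp add: algebra_simps)
      also have "\<dots> = seg N i (i + int h)" unfolding seg_shift seg_commute[of N _ i] ..
      finally show ?thesis unfolding b
        using crosses_window[OF N_pos, of i i "i + int h" "i + 1" j] ij Nh hp 2 by auto
    next
      case 3
      have "seg N (i + int h) (j + 1 + int h) = seg N (i + int h) (i + 1 + int N)" using 3 Nh by (simp add: algebra_simps)
      also have "\<dots> = ?q" unfolding seg_shift seg_commute[of N _ "i + 1"] 3 ..
      finally show ?thesis unfolding b by (simp add: crosses_irrefl)
    qed
  qed
  have K: "u \<in> diagonals N \<and> (u = ?p \<or> u = ?q) \<Longrightarrow> w \<in> diagonals N \<and> (w = ?p \<or> w = ?q) \<Longrightarrow>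
      common_cluster Cl (xl u) (xl w)" for u w
  proof -
    assume u: "u \<in> diagonals N \<and> (u = ?p \<or> u = ?q)" and w: "w \<in> diagonals N \<and> (w = ?p \<or> w = ?q)"
    have s: "\<not> crosses N (bar u) u" if "u \<in> diagonals N" for u
      using not_crosses_bar[OF diagonals_segments[OF that]] crosses_sym by blast
    have pq: "common_cluster Cl (xl ?p) (xl ?q)" if "?p \<in> diagonals N" "?q \<in> diagonals N"
      using common_cluster_iff[OF that] nc nc2 by blast
    show ?thesis
    proof (cases "u = w")
      case True
      then show ?thesis using common_cluster_iff[of u u] u s crosses_irrefl by blast
    next
      case False
      then show ?thesis using pq u w common_cluster_sym[of Cl "xl ?p"] by auto
    qed
  qed
  show ?thesis unfolding standard_def
  proof (intro ballI)
    fix v w assume v: "v \<in> Poly_Mapping.keys (expo i (j + 1) + expo (i + 1) j)"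
      and w: "w \<in> Poly_Mapping.keys (expo i (j + 1) + expo (i + 1) j)"
    have "\<exists>u. v = xl u \<and> u \<in> diagonals N \<and> (u = ?p \<or> u = ?q)" if "v \<in> Poly_Mapping.keys (expo i (j + 1) + expo (i + 1) j)" for v
      using that keys_expo_diag[of v i "j + 1"] keys_expo_diag[of v "i + 1" j] ij unfolding keys_add_nat by auto
    from this[OF v] this[OF w] obtain u u' where "v = xl u" "w = xl u'"
      "u \<in> diagonals N \<and> (u = ?p \<or> u = ?q)" "u' \<in> diagonals N \<and> (u' = ?p \<or> u' = ?q)" by blast
    then show "common_cluster Cl v w" using K[of u u'] by simp
  qed
qed

lemma standard_zero: "standard Cl' 0"
  by (simp add: standard_def)

text \<open>Each Monge inequality compares the two sides of a relation for the crossing segments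
  \<open>[i, j]\<close> and \<open>[i + 1, j + 1]\<close>; the other monomial of that relation
  involves edges only, or in type B with two diameters also an edge. All monomials are standard, so
  the heaviest one must be the crossing product.\<close>

lemma initial_ideal_imp_positive:
  assumes eq: "initial_ideal V \<omega> (relation_ideal \<iota> V) = incompatibility_ideal V Cl"
  shows "positive \<omega>"
proof -
  have less: "weight \<omega> M < Poly_Mapping.lookup \<omega> (xl l) + Poly_Mapping.lookup \<omega> (xl m)"
    if rel: "relation l m ms" and cr: "crosses N l m" and std: "\<And>e. e \<in> set ms \<Longrightarrow> standard Cl e" and M: "M \<in> set ms" for l m ms M
  proof (rule initial_ideal_eq_imp_less[OF V_cover eq])
    have D: "l \<in> diagonals N" "m \<in> diagonals N" using rel unfolding relation_def by auto
    show "xl l \<in> V" "xl m \<in> V" using D xl_V by auto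
    show "\<not> common_cluster Cl (xl l) (xl m)" using common_cluster_iff[OF D] cr by blast
    show "rel_poly ms \<in> carrier (mpoly_ring V)" "peval \<iota> (\<lambda>v. v) (rel_poly ms) = xl l * xl m"
      by (rule relation_poly[OF rel])+
    show "standard Cl e" if "e \<in> Poly_Mapping.keys (rel_poly ms)" for e
      using std that unfolding relation_poly(3)[OF rel] .
    show "M \<in> Poly_Mapping.keys (rel_poly ms)" using M unfolding relation_poly(3)[OF rel] .
  qed
  have main: "W \<omega> i (j + 1) + W \<omega> (i + 1) j < W \<omega> i j + W \<omega> (i + 1) (j + 1)"
    if ij: "i + 2 \<le> j" "j \<le> i + int N - 2" and half: "typeA \<or> j \<le> i + int h" for i j
  proof -
    let ?M = "expo i (j + 1) + expo (i + 1) j"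
    have q: "i < i + 1" "i + 1 < j" "j < j + 1" "j + 1 < i + int N" using ij by simp_all
    note cr = crossesI[OF q] and D = crossing_diagonals[OF q]
    note std = standard_exchange[OF ij half]
    have Mw: "weight \<omega> ?M = W \<omega> i (j + 1) + W \<omega> (i + 1) j" by (simp add: weight_add W_def)
    have ms: "standard Cl e" if "e \<in> set [expo i (i + 1) + expo j (j + 1), ?M]" for e
      using that std standard_zero by (auto simp: expo_edge)
    have nd: "Poly_Mapping.lookup \<omega> (xs i j) = W \<omega> i j" "Poly_Mapping.lookup \<omega> (xs (i + 1) (j + 1)) = W \<omega> (i + 1) (j + 1)"
      if "\<not> typeB \<or> j \<noteq> i + int h"
    proof -
      have "\<not> typeB \<or> \<not> diameter i j" "\<not> typeB \<or> \<not> diameter (i + 1) (j + 1)"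
        using that diameter_iff[OF typeB_not_A, of i j] diameter_iff[OF typeB_not_A, of "i + 1" "j + 1"] q by auto
      then show "Poly_Mapping.lookup \<omega> (xs i j) = W \<omega> i j" "Poly_Mapping.lookup \<omega> (xs (i + 1) (j + 1)) = W \<omega> (i + 1) (j + 1)"
        using lookup_eq_W D by blast+
    qed
    consider "\<not> typeB" | "typeB" "j + 1 \<le> i + int h" | "typeB" "j = i + int h"
      using half typeB_not_A by linarith
    then show ?thesis
    proof cases
      case 1
      have "weight \<omega> ?M < Poly_Mapping.lookup \<omega> (xs i j) + Poly_Mapping.lookup \<omega> (xs (i + 1) (j + 1))"
        by (rule less[OF good_not_B(1)[OF 1 q] cr ms]) simp_all
      then show ?thesis using nd 1 Mw by simp
    next
      case 2
      have jh: "j < i + int h" using 2(2) by simp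
      have "weight \<omega> ?M < Poly_Mapping.lookup \<omega> (xs i j) + Poly_Mapping.lookup \<omega> (xs (i + 1) (j + 1))"
        by (rule less[OF B_single_relation(1)[OF 2(1) q(1-3) 2(2) jh] cr ms]) simp_all
      then show ?thesis using nd jh Mw by simp
    next
      case 3
      \<comment> \<open>For neighbouring diameters the exchange relation has a single segment where
        the Monge inequality has two. These two are images of each other, so doubling the inequality
        gives the claim, with each diameter counted twice.\<close>
      note A = typeB_not_A[OF 3(1)]
      have Nh: "int N = 2 * int h" and hp: "int h > 0" using int_N_h[OF A] h_pos by simp_all
      have o: "i < i + 1" "i + 1 < i + int h" using ij 3(2) by simp_all
      have j1: "j + 1 = i + 1 + int h" using 3(2) by simp
      have std': "standard Cl e" if "e \<in> set [expo i (i + 1), expo i (i + 1 + int h)]" for e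
        using that standard_mono[OF std] standard_zero by (auto simp: expo_edge j1 keys_add_nat)
      have cr': "crosses N (seg N i (i + int h)) (seg N (i + 1) (i + 1 + int h))"
        using cr unfolding j1 unfolding 3(2) .
      have "weight \<omega> (expo i (i + 1 + int h)) < Poly_Mapping.lookup \<omega> (xs i (i + int h)) + Poly_Mapping.lookup \<omega> (xs (i + 1) (i + 1 + int h))"
        by (rule less[OF B_two_diameters(1)[OF 3(1) o] cr' std']) simp_all
      moreover have "2 * Poly_Mapping.lookup \<omega> (xs k (k + int h)) = W \<omega> k (k + int h)" for k
        using lookup_diameter[OF diameter_diagonal[OF A] 3(1)] diameter_iff[OF A, of k "k + int h"] Nh hp by simp
      from this[of i] this[of "i + 1"] have "2 * Poly_Mapping.lookup \<omega> (xs i (i + int h)) = W \<omega> i (i + int h)"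
        "2 * Poly_Mapping.lookup \<omega> (xs (i + 1) (i + 1 + int h)) = W \<omega> (i + 1) (i + 1 + int h)" .
      moreover have "W \<omega> (i + 1) (i + int h) = W \<omega> i (i + 1 + int h)"
      proof -
        have "W \<omega> (i + 1) (i + int h) = W \<omega> (i + 1 + int h) (i + int h + int h)" by (rule W_half[OF A, symmetric])
        also have "i + int h + int h = i + int N" using Nh by simp
        finally show ?thesis by (simp only: W_shift W_commute[of \<omega> _ i])
      qed
      ultimately show ?thesis unfolding 3(2) using W_def[of \<omega> i "i + 1 + int h"] by (simp add: algebra_simps)
    qed
  qed
  show ?thesis unfolding positive_def
  proof (intro allI impI)
    fix i j assume ij: "i + 2 \<le> j \<and> j \<le> i + int N - 2"
    show "W \<omega> i (j + 1) + W \<omega> (i + 1) j < W \<omega> i j + W \<omega> (i + 1) (j + 1)"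
    proof (cases "typeA \<or> j \<le> i + int h")
      case True
      then show ?thesis using main ij by blast
    next
      case False
      have Nh: "int N = 2 * int h" using int_N_h False by simp
      \<comment> \<open>Exchanging the two polygon edges replaces \<open>(i, j)\<close> by
        \<open>(j, i + N)\<close>, which lies in the range already treated.\<close>
      have "W \<omega> j (i + int N + 1) + W \<omega> (j + 1) (i + int N) < W \<omega> j (i + int N) + W \<omega> (j + 1) (i + int N + 1)"
        by (rule main) (use ij False Nh in linarith)+
      moreover have "W \<omega> p (i + int N + 1) = W \<omega> (i + 1) p" "W \<omega> p (i + int N) = W \<omega> i p" for p
        using W_shift[of \<omega> p "i + 1"] W_shift[of \<omega> p i] W_commute[of \<omega> p] by (simp_all add: algebra_simps)
      ultimately show ?thesis by simp
    qed
  qed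
qed

theorem groebner_cone_eq:
  "groebner_cone \<iota> n S = closure {\<omega>. Poly_Mapping.keys \<omega> \<subseteq> V \<and> positive \<omega>}"
  unfolding groebner_cone_def Let_def
  using positive_imp_initial_ideal initial_ideal_imp_positive by (metis (mono_tags, lifting))

end

section \<open>Vectors as functions on pairs of vertices\<close>

lemma lookup_scaleR [simp]: "Poly_Mapping.lookup (c *\<^sub>R \<tau>) L = c *\<^sub>R Poly_Mapping.lookup \<tau> L"
  for \<tau> :: "'a \<Rightarrow>\<^sub>0 'b::real_vector"
proof -
  have "finite {i. c *\<^sub>R Poly_Mapping.lookup \<tau> i \<noteq> 0}"
    by (rule finite_subset[OF _ finite_keys[of \<tau>]]) (auto simp: in_keys_iff)
  then show ?thesis unfolding scaleR_poly_mapping_def by (simp add: lookup_Abs_poly_mapping)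
qed

lemma lookup_basis_vec: "Poly_Mapping.lookup (basis_vec L) L' = of_bool (L = L')"
  by (simp add: basis_vec_def lookup_single when_def)

text \<open>The same telescoping as in \<open>ptolemy_less\<close>, now with equalities; it
  describes the common kernel of the Monge functionals.\<close>

lemma ptolemy_eq:
  fixes W :: "int \<Rightarrow> int \<Rightarrow> real" and N :: int
  assumes flat: "\<And>i j. i + 2 \<le> j \<Longrightarrow> j \<le> i + N - 2 \<Longrightarrow> W i (j + 1) + W (i + 1) j = W i j + W (i + 1) (j + 1)"
    and o: "a < b" "b < c" "c < d" "d < a + N"
  shows "W a d + W b c = W a c + W b d"
proof -
  have row: "W i d + W (i + 1) c = W i c + W (i + 1) d" if "c < d" "i + 2 \<le> c" "d \<le> i + N - 1" for i c d
    using that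
  proof (induction d rule: int_gr_induct)
    case base
    then show ?case using flat[of i c] by simp
  next
    case (step d)
    then have "W i d + W (i + 1) c = W i c + W (i + 1) d" by simp
    moreover have "W i (d + 1) + W (i + 1) d = W i d + W (i + 1) (d + 1)" using step by (intro flat) auto
    ultimately show ?case by linarith
  qed
  show ?thesis using o
  proof (induction b rule: int_gr_induct)
    case base
    then show ?case using row[of c d a] by simp
  next
    case (step b)
    then have "W a d + W b c = W a c + W b d" by simp
    moreover have "W b d + W (b + 1) c = W b c + W (b + 1) d" using step by (intro row) auto
    ultimately show ?case by linarith
  qed
qed

context polygon_cluster
begin

section \<open>Indicator functions of vertices and arcs modulo \<open>N\<close>\<close>

definition ind :: "int \<Rightarrow> int \<Rightarrow> real" where
  "ind z i = of_bool (z mod int N = i mod int N)"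

text \<open>Defined as a sum over integers so that it is additive in the length and compatible with
  translation; for \<open>0 \<le> m\<close> and \<open>m \<le> N\<close> it is the 0-1 indicator of
  the \<open>m\<close> consecutive vertices from \<open>s\<close> on.\<close>

definition arc_ind :: "int \<Rightarrow> int \<Rightarrow> int \<Rightarrow> real" where
  "arc_ind s m i = (\<Sum>z\<in>{s..<s + m}. ind z i)"

lemma ind_commute: "ind z i = ind i z" by (auto simp: ind_def)

lemma ind_nonneg: "ind z i \<ge> 0" by (simp add: ind_def)

lemma ind_add: "ind (z + k) (i + k) = ind z i"
proof -
  have "(z + k) mod int N = (i + k) mod int N \<longleftrightarrow> z mod int N = i mod int N"
    by (simp add: mod_eq_dvd_iff)
  then show ?thesis by (simp add: ind_def)
qed

lemma ind_shift: "ind (z + int N) i = ind z i" "ind z (i + int N) = ind z i"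
  by (simp_all add: ind_def)

lemma ind_window: "\<bar>z - i\<bar> < int N \<Longrightarrow> ind z i = of_bool (z = i)"
  using mod_window[of z "int N" i] by (auto simp: ind_def)

lemma arc_ind_eq:
  assumes "0 \<le> m" "m \<le> int N"
  shows "arc_ind s m i = of_bool ((i - s) mod int N < m)"
proof -
  let ?z = "s + (i - s) mod int N"
  have b: "0 \<le> (i - s) mod int N" "(i - s) mod int N < int N" using N_pos by simp_all
  have z: "?z mod int N = i mod int N" by (simp add: mod_simps)
  have "ind w i = of_bool (w = ?z)" if "w \<in> {s..<s + m}" for w
  proof -
    have "ind w i = ind w ?z" unfolding ind_def z ..
    also have "\<dots> = of_bool (w = ?z)"
    proof (rule ind_window)
      have "s \<le> w" "w < s + m" using that by simp_all
      then show "\<bar>w - ?z\<bar> < int N" using assms b by linarith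
    qed
    finally show ?thesis .
  qed
  then have "arc_ind s m i = (\<Sum>w\<in>{s..<s + m}. if w = ?z then 1 else 0)"
    unfolding arc_ind_def by (intro sum.cong) auto
  also have "\<dots> = of_bool ((i - s) mod int N < m)" using b by simp
  finally show ?thesis .
qed

lemma arc_ind_add:
  assumes "0 \<le> m" "0 \<le> k"
  shows "arc_ind s (m + k) i = arc_ind s m i + arc_ind (s + m) k i"
proof -
  have "{s..<s + (m + k)} = {s..<s + m} \<union> {s + m..<s + m + k}" using assms by auto
  then show ?thesis unfolding arc_ind_def by (simp add: sum.union_disjoint)
qed

lemma arc_ind_1: "arc_ind s 1 i = ind s i"
proof -
  have "{s..<s + 1} = {s}" by auto
  then show ?thesis by (simp add: arc_ind_def)
qed

lemma arc_ind_0: "arc_ind s 0 i = 0" by (simp add: arc_ind_def)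

lemma arc_ind_full: "arc_ind s (int N) i = 1"
  using arc_ind_eq[of "int N" s i] N_pos by simp

lemma arc_ind_translate: "arc_ind (s + k) m (i + k) = arc_ind s m i"
proof -
  have "arc_ind (s + k) m (i + k) = (\<Sum>z\<in>{s..<s + m}. ind (z + k) (i + k))"
    unfolding arc_ind_def
    by (rule sum.reindex_bij_witness[where i = "\<lambda>z. z + k" and j = "\<lambda>z. z - k"]) auto
  then show ?thesis by (simp add: ind_add arc_ind_def)
qed

lemma arc_ind_suc: "arc_ind s m (i + 1) = arc_ind (s - 1) m i"
  using arc_ind_translate[of "s - 1" 1 m i] by simp

text \<open>Extending the arc by the vertex before its start can be computed in two ways; comparing
  them shows that the difference is supported at the two ends of the arc.\<close>

lemma arc_ind_diff: "m \<ge> 0 \<Longrightarrow> arc_ind s m i - arc_ind s m (i + 1) = ind (s + m - 1) i - ind (s - 1) i"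
proof -
  assume m: "m \<ge> 0"
  have "arc_ind (s - 1) (m + 1) i = arc_ind (s - 1) m i + ind (s + m - 1) i"
    using arc_ind_add[OF m, of 1 "s - 1" i] by (simp add: arc_ind_1 algebra_simps)
  moreover have "arc_ind (s - 1) (1 + m) i = ind (s - 1) i + arc_ind s m i"
    using arc_ind_add[OF _ m, of 1 "s - 1" i] by (simp add: arc_ind_1)
  ultimately show ?thesis unfolding arc_ind_suc by (simp add: add.commute)
qed

lemma arc_ind_half: "\<not> typeA \<Longrightarrow> arc_ind s (int h) i + arc_ind s (int h) (i + int h) = 1"
proof -
  assume A: "\<not> typeA"
  have Nh: "int N = 2 * int h" by (rule int_N_h[OF A])
  have "arc_ind s (int h) (i + int h) = arc_ind (s + int h) (int h) i"
  proof -
    have "arc_ind (s + int h) (int h) i = arc_ind (s + int h + int h) (int h) (i + int h)"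
      by (rule arc_ind_translate[symmetric])
    also have "s + int h + int h = s + int N" using Nh by simp
    also have "arc_ind (s + int N) (int h) (i + int h) = arc_ind (s + int N) (int h) (i + int h + int N)"
      unfolding arc_ind_def ind_shift ..
    also have "\<dots> = arc_ind s (int h) (i + int h)" by (rule arc_ind_translate)
    finally show ?thesis by simp
  qed
  moreover have "arc_ind s (int h + int h) i = arc_ind s (int h) i + arc_ind (s + int h) (int h) i"
    by (rule arc_ind_add) simp_all
  moreover have "int h + int h = int N" using Nh by simp
  ultimately show ?thesis using arc_ind_full[of s i] by simp
qed

section \<open>Monge functionals on vectors indexed by labels\<close>

text \<open>The analogue of \<open>W\<close> for label vectors, with diameters doubled in type B.
  Edge coordinates are kept, since the vectors \<open>v\<close> and \<open>E\<close> have
  them.\<close>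

definition U :: "lvec \<Rightarrow> int \<Rightarrow> int \<Rightarrow> real" where
  "U \<tau> i j = (if typeB \<and> diameter i j then 2 else 1) * Poly_Mapping.lookup \<tau> (label X n (seg N i j))"

lemma U_add: "U (\<sigma> + \<tau>) i j = U \<sigma> i j + U \<tau> i j"
  by (simp add: U_def lookup_add distrib_left)
lemma U_diff: "U (\<sigma> - \<tau>) i j = U \<sigma> i j - U \<tau> i j"
  by (simp add: U_def lookup_minus right_diff_distrib)
lemma U_scaleR: "U (c *\<^sub>R \<tau>) i j = c * U \<tau> i j"
  by (simp add: U_def)
lemma U_zero: "U 0 i j = 0"
  by (simp add: U_def)
lemma U_sum: "U (\<Sum>a\<in>A. f a) i j = (\<Sum>a\<in>A. U (f a) i j)"
  by (simp add: U_def lookup_sum sum_distrib_left)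

lemma U_commute: "U \<tau> i j = U \<tau> j i"
  unfolding U_def diameter_def seg_commute[of N i j] ..
lemma U_shift: "U \<tau> i (j + int N) = U \<tau> i j"
  by (simp add: U_def diameter_def seg_shift)
lemma U_half: "\<not> typeA \<Longrightarrow> U \<tau> (i + int h) (j + int h) = U \<tau> i j"
  using label_bar_seg[of i j] by (simp add: U_def diameter_half bar_seg)

text \<open>The mixed second difference of \<open>U\<close>, attached to the polygon edges starting
  at \<open>i\<close> and \<open>j\<close>; it vanishes on every sum of a function of
  \<open>i\<close> and a function of \<open>j\<close>.\<close>

definition mo :: "lvec \<Rightarrow> int \<Rightarrow> int \<Rightarrow> real" where
  "mo \<tau> i j = U \<tau> i j + U \<tau> (i + 1) (j + 1) - U \<tau> i (j + 1) - U \<tau> (i + 1) j"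

lemma mo_add: "mo (\<sigma> + \<tau>) i j = mo \<sigma> i j + mo \<tau> i j"
  by (simp add: mo_def U_add)
lemma mo_diff: "mo (\<sigma> - \<tau>) i j = mo \<sigma> i j - mo \<tau> i j"
  by (simp add: mo_def U_diff)
lemma mo_scaleR: "mo (c *\<^sub>R \<tau>) i j = c * mo \<tau> i j"
  by (simp add: mo_def U_scaleR algebra_simps)
lemma mo_zero: "mo 0 i j = 0"
  by (simp add: mo_def U_zero)
lemma mo_sum: "mo (\<Sum>a\<in>A. f a) i j = (\<Sum>a\<in>A. mo (f a) i j)"
  by (simp add: mo_def U_sum sum.distrib sum_subtractf)

lemma mo_commute: "mo \<tau> i j = mo \<tau> j i"
  unfolding mo_def U_commute[of \<tau> i j] U_commute[of \<tau> "i + 1" "j + 1"] U_commute[of \<tau> i "j + 1"]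
    U_commute[of \<tau> "i + 1" j] by simp
lemma mo_shift: "mo \<tau> i (j + int N) = mo \<tau> i j"
proof -
  have "j + int N + 1 = j + 1 + int N" by simp
  then show ?thesis unfolding mo_def by (simp only: U_shift)
qed
lemma mo_half: "\<not> typeA \<Longrightarrow> mo \<tau> (i + int h) (j + int h) = mo \<tau> i j"
proof -
  assume A: "\<not> typeA"
  have "k + int h + 1 = k + 1 + int h" for k by simp
  then show ?thesis unfolding mo_def by (simp only: U_half[OF A])
qed

lemma mo_mod:
  assumes "ind i s \<noteq> 0" "ind j t \<noteq> 0"
  shows "mo \<tau> i j = mo \<tau> s t"
proof -
  have eq: "i mod int N = s mod int N" "j mod int N = t mod int N" using assms by (auto simp: ind_def)
  have one: "(i + 1) mod int N = (s + 1) mod int N" "(j + 1) mod int N = (t + 1) mod int N"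
    using eq by (metis mod_add_left_eq)+
  have e: "U \<tau> a b = U \<tau> c d" if "a mod int N = c mod int N" "b mod int N = d mod int N" for a b c d
  proof -
    have s: "seg N a b = seg N c d" using that by (simp add: seg_def)
    show ?thesis unfolding U_def diameter_def s ..
  qed
  show ?thesis unfolding mo_def e[OF eq] e[OF one] e[OF eq(1) one(2)] e[OF one(1) eq(2)] ..
qed

text \<open>Number of ways to identify the pair of edges \<open>i, j\<close> with the pair \<open>s, t\<close> by the symmetries.\<close>

definition pair_count :: "int \<Rightarrow> int \<Rightarrow> int \<Rightarrow> int \<Rightarrow> real" where
  "pair_count i j s t = ind i s * ind j t + ind i t * ind j s +
     (if typeA then 0 else ind (i + int h) s * ind (j + int h) t + ind (i + int h) t * ind (j + int h) s)"

lemma pair_count_nonneg: "pair_count i j s t \<ge> 0"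
  unfolding pair_count_def using ind_nonneg by (simp add: add_nonneg_nonneg)

lemma pair_count_self: "pair_count s t s t > 0"
proof -
  have "ind s s = 1" "ind t t = 1" by (simp_all add: ind_def)
  then show ?thesis unfolding pair_count_def using ind_nonneg
    by (simp add: add_pos_nonneg add_nonneg_nonneg)
qed

lemma pair_count_cases:
  assumes "pair_count i j s t \<noteq> 0"
  obtains "ind i s \<noteq> 0" "ind j t \<noteq> 0" | "ind i t \<noteq> 0" "ind j s \<noteq> 0"
  | "\<not> typeA" "ind (i + int h) s \<noteq> 0" "ind (j + int h) t \<noteq> 0"
  | "\<not> typeA" "ind (i + int h) t \<noteq> 0" "ind (j + int h) s \<noteq> 0"
proof -
  have "ind i s * ind j t \<noteq> 0 \<or> ind i t * ind j s \<noteq> 0 \<or>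
      \<not> typeA \<and> ind (i + int h) s * ind (j + int h) t \<noteq> 0 \<or> \<not> typeA \<and> ind (i + int h) t * ind (j + int h) s \<noteq> 0"
    using assms unfolding pair_count_def by (cases typeA) auto
  then show ?thesis using that unfolding mult_eq_0_iff by argo
qed

lemma mo_pair_count:
  assumes "pair_count i j s t \<noteq> 0"
  shows "mo \<tau> i j = mo \<tau> s t"
  using assms
proof (cases rule: pair_count_cases)
  case 1
  then show ?thesis by (rule mo_mod)
next
  case 2
  then show ?thesis using mo_mod[of i t j s] mo_commute[of \<tau> s t] by simp
next
  case 3
  then show ?thesis using mo_mod[of "i + int h" s "j + int h" t] mo_half[of \<tau> i j] by simp
next
  case 4
  then show ?thesis using mo_mod[of "i + int h" t "j + int h" s] mo_half[of \<tau> i j] mo_commute[of \<tau> s t] by simp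
qed

lemma ind_congL: "ind s s' \<noteq> 0 \<Longrightarrow> ind u s = ind u s'"
  by (auto simp: ind_def)

lemma ind_half_swap:
  assumes "\<not> typeA" "ind (s + int h) s' \<noteq> 0"
  shows "ind (u + int h) s = ind u s'" "ind u s = ind (u + int h) s'"
proof -
  have "ind (u + int h) s = ind (u + int h + int h) (s + int h)" by (rule ind_add[symmetric])
  also have "u + int h + int h = u + int N" using int_N_h[OF assms(1)] by simp
  also have "ind (u + int N) (s + int h) = ind u s'" unfolding ind_shift by (rule ind_congL[OF assms(2)])
  finally show "ind (u + int h) s = ind u s'" .
  have "ind u s = ind (u + int h) (s + int h)" by (rule ind_add[symmetric])
  also have "\<dots> = ind (u + int h) s'" by (rule ind_congL[OF assms(2)])
  finally show "ind u s = ind (u + int h) s'" .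
qed

text \<open>Pairs of edges related by a symmetry are hit equally often; together with the triviality
  of the common kernel this identifies the vectors \<open>v_tilde\<close> of symmetric
  segments.\<close>

lemma pair_count_cong:
  assumes "pair_count s t s' t' \<noteq> 0"
  shows "pair_count u w s t = pair_count u w s' t'"
  using assms
proof (cases rule: pair_count_cases)
  case 1
  then show ?thesis unfolding pair_count_def by (simp add: ind_congL[of s s'] ind_congL[of t t'])
next
  case 2
  then show ?thesis unfolding pair_count_def by (simp add: ind_congL[of s t'] ind_congL[of t s'])
next
  case 3
  then show ?thesis unfolding pair_count_def
    by (simp add: ind_half_swap[OF 3(1,2), of u] ind_half_swap[OF 3(1,2), of w]
      ind_half_swap[OF 3(1,3), of u] ind_half_swap[OF 3(1,3), of w])
next
  case 4
  then show ?thesis unfolding pair_count_def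
    by (simp add: ind_half_swap[OF 4(1,2), of u] ind_half_swap[OF 4(1,2), of w]
      ind_half_swap[OF 4(1,3), of u] ind_half_swap[OF 4(1,3), of w])
qed

subsection \<open>Lengths and arcs\<close>

lemma vx_eq_iff: "vx a = vx b \<longleftrightarrow> a mod int N = b mod int N"
  by (rule nat_mod_eq_iff[OF N_pos])

lemma arc_vx: "arc N (vx a) (vx b) = nat ((b - a) mod int N)"
  by (rule arc_mod[OF N_pos])

lemma seg_arcs:
  assumes "p < q" "q < p + int N"
  shows "vx p \<noteq> vx q" "arc N (vx p) (vx q) = nat (q - p)" "arc N (vx q) (vx p) = nat (int N - (q - p))"
proof -
  show "vx p \<noteq> vx q" unfolding vx_eq_iff using mod_window[of p "int N" q] assms by auto
  show "arc N (vx p) (vx q) = nat (q - p)" unfolding arc_vx using assms by (simp add: mod_pos_pos_trivial)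
  have "(p - q) mod int N = (p - q + int N) mod int N" by simp
  also have "\<dots> = p - q + int N" using assms by (intro mod_pos_pos_trivial) auto
  finally show "arc N (vx q) (vx p) = nat (int N - (q - p))" unfolding arc_vx by (simp add: algebra_simps)
qed

lemma len_seg:
  assumes "p < q" "q < p + int N"
  shows "len N (seg N p q) = nat (min (q - p) (int N - (q - p)))"
proof -
  have two: "{f i j | i j. i \<in> {a, b} \<and> j \<in> {a, b} \<and> i \<noteq> j} = {f a b, f b a}" if "a \<noteq> b" for a b and f :: "nat \<Rightarrow> nat \<Rightarrow> nat"
    using that by auto
  have "{arc N i j | i j. i \<in> seg N p q \<and> j \<in> seg N p q \<and> i \<noteq> j} = {nat (q - p), nat (int N - (q - p))}"
    unfolding seg_vx[symmetric] two[OF seg_arcs(1)[OF assms]] seg_arcs(2,3)[OF assms] ..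
  then show ?thesis unfolding len_def using assms by (simp add: min_def nat_le_iff)
qed

lemma nonmaximal_seg:
  assumes "p < q" "q < p + int (N div 2)"
  shows "seg N p q \<in> nonmaximal N" "len N (seg N p q) = nat (q - p)" "delta_minus N (seg N p q) = vx p"
    "delta_plus N (seg N p q) = vx q"
proof -
  have "2 * (q - p) < 2 * int (N div 2)" using assms by simp
  also have "\<dots> \<le> int N" by (simp add: zdiv_int)
  finally have lt: "2 * (q - p) < int N" .
  then have o: "p < q" "q < p + int N" using assms by auto
  show l: "len N (seg N p q) = nat (q - p)" unfolding len_seg[OF o] using lt by simp
  then show "seg N p q \<in> nonmaximal N"
    unfolding nonmaximal_def using seg_in_segments[OF o] assms by simp
  note a = seg_arcs[OF o]
  have less: "arc N (vx p) (vx q) < arc N (vx q) (vx p)" unfolding a(2,3) using lt o by simp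
  show "delta_minus N (seg N p q) = vx p"
    unfolding delta_minus_def seg_vx[symmetric] by (rule the_equality) (use less a(1) in auto)
  show "delta_plus N (seg N p q) = vx q"
    unfolding delta_plus_def seg_vx[symmetric] by (rule the_equality) (use less a(1) in auto)
qed

lemma nonmaximalE:
  assumes "l \<in> nonmaximal N"
  obtains p q where "p < q" "q < p + int (N div 2)" "l = seg N p q"
proof -
  have l: "l \<in> segments N" "len N l < N div 2" using assms by (auto simp: nonmaximal_def)
  obtain i j where ij: "i < j" "j < i + int N" "l = seg N i j" by (rule segI[OF l(1) N_pos])
  have "nat (min (j - i) (int N - (j - i))) < N div 2" using l(2) unfolding ij(3) len_seg[OF ij(1,2)] .
  then consider "j - i < int (N div 2)" | "int N - (j - i) < int (N div 2)" by linarith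
  then show ?thesis
  proof cases
    case 1
    then show ?thesis using that[of i j] ij by simp
  next
    case 2
    have "l = seg N j (i + int N)" unfolding ij(3) seg_shift by (rule seg_commute)
    then show ?thesis using that[of j "i + int N"] ij 2 by simp
  qed
qed

lemma vx_add: "(vx p + k) mod N = vx (p + int k)"
proof -
  have "int ((vx p + k) mod N) = (p + int k) mod int N"
    using N_pos by (simp add: zmod_int mod_simps)
  then show ?thesis by simp
qed

lemma minor_arc_seg:
  assumes "p < q" "q < p + int (N div 2)"
  shows "minor_arc N (seg N p q) = vx ` {p..q}"
proof -
  have "minor_arc N (seg N p q) = {vx (p + int k) | k. k \<le> nat (q - p)}"
    unfolding minor_arc_def nonmaximal_seg[OF assms] vx_add ..
  also have "\<dots> = vx ` {p..q}"
  proof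
    show "{vx (p + int k) | k. k \<le> nat (q - p)} \<subseteq> vx ` {p..q}"
    proof
      fix y assume "y \<in> {vx (p + int k) | k. k \<le> nat (q - p)}"
      then obtain k where k: "y = vx (p + int k)" "k \<le> nat (q - p)" by blast
      have "p + int k \<in> {p..q}" using k(2) assms by auto
      then show "y \<in> vx ` {p..q}" unfolding k(1) by (rule imageI)
    qed
    show "vx ` {p..q} \<subseteq> {vx (p + int k) | k. k \<le> nat (q - p)}"
    proof
      fix y assume "y \<in> vx ` {p..q}"
      then obtain z where "z \<in> {p..q}" "y = vx z" by blast
      then show "y \<in> {vx (p + int k) | k. k \<le> nat (q - p)}"
        unfolding mem_Collect_eq by (intro exI[of _ "nat (z - p)"]) (simp add: nat_mono)
    qed
  qed
  finally show ?thesis .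
qed

lemma in_arc:
  assumes "p \<le> q" "q < p + int N"
  shows "(of_bool (vx z \<in> vx ` {p..q}) :: real) = arc_ind p (q - p + 1) z"
proof -
  have "vx z \<in> vx ` {p..q} \<longleftrightarrow> (z - p) mod int N < q - p + 1"
  proof
    assume "vx z \<in> vx ` {p..q}"
    then obtain w where w: "p \<le> w" "w \<le> q" "z mod int N = w mod int N" using vx_eq_iff by auto
    have "(z - p) mod int N = (w - p) mod int N" using w(3) by (metis mod_diff_left_eq)
    also have "\<dots> = w - p" using w assms by (intro mod_pos_pos_trivial) auto
    finally show "(z - p) mod int N < q - p + 1" using w by simp
  next
    assume lt: "(z - p) mod int N < q - p + 1"
    let ?w = "p + (z - p) mod int N"
    have "vx z = vx ?w" unfolding vx_eq_iff by (simp add: mod_simps)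
    moreover have "?w \<in> {p..q}" using lt N_pos by simp
    ultimately show "vx z \<in> vx ` {p..q}" by blast
  qed
  then show ?thesis using arc_ind_eq[of "q - p + 1" p z] assms by simp
qed

lemma mem_seg: "vx k \<in> seg N i j \<longleftrightarrow> k mod int N = i mod int N \<or> k mod int N = j mod int N"
  unfolding seg_vx[symmetric] using vx_eq_iff by auto

lemma finite_F_set: "finite (F_set N l)"
  unfolding F_set_def by (rule finite_subset[OF _ finite_segments]) auto

lemma diameter_iff_bar: "i < j \<Longrightarrow> j < i + int N \<Longrightarrow> \<not> typeA \<Longrightarrow> bar (seg N i j) = seg N i j \<longleftrightarrow> j = i + int h"
  using diameter_iff[of i j] by (simp add: diameter_def)

subsection \<open>The vectors \<open>v\<close> and \<open>E\<close>\<close>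

text \<open>A label is hit by a segment on the minor arc or by one whose image is the given segment.
  Both conditions factor over the endpoints, and this product form is what makes second differences
  easy to compute.\<close>

lemma U_v_vec:
  assumes pq: "p < q" "q < p + int (N div 2)" and ij: "i < j" "j < i + int N"
  shows "U (v_vec X n (seg N p q)) i j = - (arc_ind p (q - p + 1) i * arc_ind p (q - p + 1) j) -
    (if typeA then 0 else arc_ind p (q - p + 1) (i + int h) * arc_ind p (q - p + 1) (j + int h))"
proof -
  let ?F = "F_set N (seg N p q)" and ?s = "seg N i j" and ?a = "\<lambda>z. arc_ind p (q - p + 1) z"
  have s: "?s \<in> segments N" by (rule seg_in_segments[OF ij])
  have pqN: "p \<le> q" "q < p + int N" using pq by linarith+
  have F: "seg N a b \<in> ?F \<longleftrightarrow> vx a \<in> vx ` {p..q} \<and> vx b \<in> vx ` {p..q}" if "seg N a b \<in> segments N" for a b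
    unfolding F_set_def mem_Collect_eq minor_arc_seg[OF pq] using that unfolding seg_vx[symmetric] by simp
  have aF: "(of_bool (seg N a b \<in> ?F) :: real) = ?a a * ?a b" if "seg N a b \<in> segments N" for a b
    unfolding F[OF that] in_arc[OF pqN, symmetric] by simp
  have Fseg: "m \<in> segments N" if "m \<in> ?F" for m using that by (simp add: F_set_def)
  have "Poly_Mapping.lookup (v_vec X n (seg N p q)) (label X n ?s) = - (\<Sum>m\<in>?F. of_bool (label X n m = label X n ?s))"
    by (simp add: v_vec_def lookup_sum lookup_basis_vec)
  also have "(\<Sum>m\<in>?F. of_bool (label X n m = label X n ?s) :: real) = (\<Sum>m\<in>?F. of_bool (m = ?s \<or> m = bar ?s))"
  proof (intro sum.cong refl)
    fix m assume "m \<in> ?F"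
    then have "label X n m = label X n ?s \<longleftrightarrow> m = ?s \<or> m = bar ?s"
      using label_eq_iff[OF s Fseg, of m] by (simp only: eq_commute)
    then show "(of_bool (label X n m = label X n ?s) :: real) = of_bool (m = ?s \<or> m = bar ?s)"
      by (simp only:)
  qed
  finally have lk: "Poly_Mapping.lookup (v_vec X n (seg N p q)) (label X n ?s) = - (\<Sum>m\<in>?F. of_bool (m = ?s \<or> m = bar ?s))" .
  have single: "(\<Sum>m\<in>?F. of_bool (m = z)) = (of_bool (z \<in> ?F) :: real)" for z
    using finite_F_set[of "seg N p q"] by (simp add: of_bool_def)
  show ?thesis
  proof (cases typeA)
    case True
    then have "bar ?s = ?s" "\<not> typeB" using typeB_not_A by (auto simp: bar_def)
    then show ?thesis using lk single[of ?s] aF[OF s] True by (simp add: U_def)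
  next
    case False
    note A = False
    have Nh: "N div 2 = h" "int N = 2 * int h" using N_h[OF A] by simp_all
    have bs: "bar ?s = seg N (i + int h) (j + int h)" by (rule bar_seg[OF A])
    have bseg: "seg N (i + int h) (j + int h) \<in> segments N" using bar_segments[OF s] unfolding bs .
    show ?thesis
    proof (cases "j = i + int h")
      case True
      \<comment> \<open>The minor arc has at most \<open>h\<close> vertices and cannot contain a
        vertex together with its antipode, so neither side of the formula sees a diameter.\<close>
      have "?a i * ?a j = 0"
      proof -
        have "?a i + ?a j \<le> arc_ind p (int h) i + arc_ind p (int h) (i + int h)"
        proof -
          have le: "?a z \<le> arc_ind p (int h) z" for z
          proof -
            have "arc_ind p (q - p + 1 + (int h - (q - p + 1))) z = ?a z + arc_ind (p + (q - p + 1)) (int h - (q - p + 1)) z"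
              by (rule arc_ind_add) (use pq Nh in linarith)+
            moreover have "arc_ind (p + (q - p + 1)) (int h - (q - p + 1)) z \<ge> 0"
              unfolding arc_ind_def by (intro sum_nonneg) (simp add: ind_nonneg)
            ultimately show ?thesis by simp
          qed
          then show ?thesis unfolding True by (intro add_mono)
        qed
        also have "\<dots> = 1" by (rule arc_ind_half[OF A])
        finally have "?a i + ?a j \<le> 1" .
        moreover have "?a i = 0 \<or> ?a i = 1" "?a j = 0 \<or> ?a j = 1"
          unfolding in_arc[OF pqN, symmetric] by auto
        ultimately show ?thesis by auto
      qed
      moreover have "?a (j + int h) = ?a i"
      proof -
        have "j + int h = i + int N" using True Nh by simp
        then show ?thesis unfolding in_arc[OF pqN, symmetric] by (simp add: vx_eq_iff)
      qed
      moreover have "bar ?s = ?s" using diameter_iff_bar[OF ij A] True by simp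
      ultimately show ?thesis using lk single[of ?s] aF[OF s] A True by (simp add: U_def)
    next
      case nd: False
      have ne: "bar ?s \<noteq> ?s" using diameter_iff_bar[OF ij A] nd by simp
      have "(\<Sum>m\<in>?F. of_bool (m = ?s \<or> m = bar ?s)) = (\<Sum>m\<in>?F. of_bool (m = ?s) + (of_bool (m = bar ?s) :: real))"
        using ne by (intro sum.cong) auto
      also have "\<dots> = of_bool (?s \<in> ?F) + of_bool (bar ?s \<in> ?F)" by (simp only: sum.distrib single)
      finally have "Poly_Mapping.lookup (v_vec X n (seg N p q)) (label X n ?s) =
          - (?a i * ?a j) - ?a (i + int h) * ?a (j + int h)"
        using lk aF[OF s] aF[OF bseg] unfolding bs by simp
      moreover have "\<not> diameter i j" using ne by (simp add: diameter_def)
      ultimately show ?thesis using A by (simp add: U_def)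
    qed
  qed
qed

lemma len_diameter: "l \<in> segments N \<Longrightarrow> \<not> typeA \<Longrightarrow> 2 * len N l = N \<longleftrightarrow> bar l = l"
proof -
  assume l: "l \<in> segments N" and A: "\<not> typeA"
  obtain i j where ij: "i < j" "j < i + int N" "l = seg N i j" by (rule segI[OF l N_pos])
  have Nh: "N = 2 * h" by (rule N_h[OF A])
  show ?thesis unfolding ij(3) len_seg[OF ij(1,2)] diameter_iff_bar[OF ij(1,2) A]
    using Nh ij by (auto simp: min_def)
qed

text \<open>For diameters the two normalisations meet: type B has coefficient 1, doubled by
  \<open>U\<close>, and type C has coefficient 2. The result is a sum of functions of single
  endpoints.\<close>

lemma U_E_vertex:
  assumes ij: "i < j" "j < i + int N"
  shows "U (E_vertex X n (vx k)) i j = ind k i + ind k j + (if typeA then 0 else ind k (i + int h) + ind k (j + int h))"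
proof -
  let ?s = "seg N i j"
  have s: "?s \<in> segments N" by (rule seg_in_segments[OF ij])
  have ijne: "i mod int N \<noteq> j mod int N" using mod_window[of i "int N" j] ij by auto
  show ?thesis
  proof (cases typeA)
    case True
    have X: "X = Type_A" using True by (simp only: typeA_def)
    have bar: "bar l = l" for l using True by (simp add: bar_def)
    have E: "E_vertex X n (vx k) = (\<Sum>l | l \<in> segments N \<and> vx k \<in> l. basis_vec (label X n l))"
      unfolding E_vertex_def Let_def if_P[OF X] ..
    have fin: "finite {l. l \<in> segments N \<and> vx k \<in> l}" using finite_segments by simp
    have "Poly_Mapping.lookup (E_vertex X n (vx k)) (label X n ?s) =
        (\<Sum>l | l \<in> segments N \<and> vx k \<in> l. if l = ?s then 1 else 0)"
      unfolding E lookup_sum lookup_basis_vec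
      using label_eq_iff[OF _ s] bar by (intro sum.cong) auto
    also have "\<dots> = of_bool (vx k \<in> ?s)" using fin s by simp
    also have "\<dots> = ind k i + ind k j" unfolding mem_seg ind_def using ijne by auto
    finally show ?thesis using True typeB_not_A by (auto simp: U_def)
  next
    case A: False
    have X: "X \<noteq> Type_A" using A unfolding typeA_def .
    have Nh: "N = 2 * h" "int N = 2 * int h" using N_h[OF A] by simp_all
    let ?c = "if X = Type_B then 1 else 2 :: real" and ?d = "seg N k (k + int h)"
    let ?M = "{L. L \<in> label X n ` {l \<in> segments N. 2 * len N l \<noteq> N} \<and> vx k \<in> \<Union> L}"
    have d: "{vx k, antipode N (vx k)} = ?d" unfolding antipode_vx[OF A] seg_vx ..
    have E: "E_vertex X n (vx k) = ?c *\<^sub>R basis_vec (label X n ?d) + (\<Sum>L\<in>?M. basis_vec L)"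
      unfolding E_vertex_def Let_def if_not_P[OF X] d ..
    have dseg: "?d \<in> segments N" by (rule seg_in_segments) (use Nh h_pos in linarith)+
    have bd: "bar ?d = ?d" by (rule bar_diameter[OF A])
    have fin: "finite ?M" using finite_segments by simp
    have lk: "Poly_Mapping.lookup (E_vertex X n (vx k)) (label X n ?s) =
        ?c * of_bool (?d = ?s) + of_bool (label X n ?s \<in> ?M)"
    proof -
      have "(label X n ?d = label X n ?s) \<longleftrightarrow> ?d = ?s"
        using label_eq_iff[OF dseg s] bd by auto
      moreover have "(\<Sum>L\<in>?M. of_bool (L = label X n ?s)) = (of_bool (label X n ?s \<in> ?M) :: real)"
        using fin by (simp add: of_bool_def del: mem_Collect_eq)
      ultimately show ?thesis unfolding E lookup_add lookup_sum lookup_basis_vec lookup_scaleR by simp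
    qed
    have "label X n ?s \<in> label X n ` {l \<in> segments N. 2 * len N l \<noteq> N} \<longleftrightarrow> bar ?s \<noteq> ?s"
    proof
      assume "label X n ?s \<in> label X n ` {l \<in> segments N. 2 * len N l \<noteq> N}"
      then obtain l where l: "l \<in> segments N" "2 * len N l \<noteq> N" "label X n ?s = label X n l" by blast
      then have "l = ?s \<or> l = bar ?s" "bar l \<noteq> l" using label_eq_iff[OF s l(1)] len_diameter[OF l(1) A] by auto
      then show "bar ?s \<noteq> ?s" using bar_bar[OF s] by auto
    next
      assume "bar ?s \<noteq> ?s"
      then show "label X n ?s \<in> label X n ` {l \<in> segments N. 2 * len N l \<noteq> N}"
        using s len_diameter[OF s A] by blast
    qed
    moreover have "\<Union> (label X n ?s) = ?s \<union> seg N (i + int h) (j + int h)"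
      unfolding label_eq bar_seg[OF A] by auto
    ultimately have M: "label X n ?s \<in> ?M \<longleftrightarrow> bar ?s \<noteq> ?s \<and> (vx k \<in> ?s \<or> vx k \<in> seg N (i + int h) (j + int h))"
      unfolding mem_Collect_eq by (simp only: Un_iff)
    have dia: "bar ?s = ?s \<longleftrightarrow> j = i + int h" by (rule diameter_iff_bar[OF ij A])
    show ?thesis
    proof (cases "j = i + int h")
      case True
      have e: "?d = ?s \<longleftrightarrow> k mod int N = i mod int N \<or> k mod int N = (i + int h) mod int N"
      proof
        assume "?d = ?s"
        moreover have "vx k \<in> ?d" unfolding mem_seg by simp
        ultimately show "k mod int N = i mod int N \<or> k mod int N = (i + int h) mod int N"
          using True mem_seg by simp
      next
        assume k: "k mod int N = i mod int N \<or> k mod int N = (i + int h) mod int N"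
        have "(k + int h) mod int N = (i + int h) mod int N" if "k mod int N = i mod int N"
          using that by (metis mod_add_left_eq)
        moreover have "(k + int h) mod int N = i mod int N" if k': "k mod int N = (i + int h) mod int N"
        proof -
          have "(k + int h) mod int N = (i + int h + int h) mod int N" using k' by (metis mod_add_left_eq)
          also have "i + int h + int h = i + int N" using Nh by simp
          finally show ?thesis by simp
        qed
        ultimately show "?d = ?s" using k unfolding True seg_def by auto
      qed
      have ne: "i mod int N \<noteq> (i + int h) mod int N" using ijne True by simp
      have "ind k (j + int h) = ind k i"
      proof -
        have "j + int h = i + int N" using True Nh by simp
        then show ?thesis by (simp only: ind_shift)
      qed
      moreover have "of_bool (?d = ?s) = ind k i + ind k (i + int h)"
        unfolding e ind_def using ne by auto
      moreover have "U (E_vertex X n (vx k)) i j = 2 * of_bool (?d = ?s)"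
      proof -
        have dm: "diameter i j" using A dia True by (simp add: diameter_def)
        have "label X n ?s \<notin> ?M" unfolding M using dia True by simp
        then have "Poly_Mapping.lookup (E_vertex X n (vx k)) (label X n ?s) = ?c * of_bool (?d = ?s)"
          unfolding lk by (simp only: of_bool_eq(1) add_0_right)
        moreover have "(if typeB \<and> diameter i j then 2 else 1) * ?c = 2"
          unfolding typeB_def[symmetric] using dm by (cases typeB) simp_all
        ultimately show ?thesis unfolding U_def by (metis mult.assoc)
      qed
      ultimately show ?thesis using A True by simp
    next
      case nd: False
      have "?d \<noteq> ?s" using bd dia nd by auto
      moreover have "\<not> diameter i j" using dia nd by (simp add: diameter_def)
      ultimately have U: "U (E_vertex X n (vx k)) i j = of_bool (vx k \<in> ?s \<or> vx k \<in> seg N (i + int h) (j + int h))"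
        unfolding U_def lk M using dia nd by simp
      have w: "a mod int N \<noteq> b mod int N" if "a < b" "b < a + int N" for a b
        using mod_window[of a "int N" b] that by auto
      have ne: "i mod int N \<noteq> (i + int h) mod int N" "j mod int N \<noteq> (j + int h) mod int N"
        "(i + int h) mod int N \<noteq> (j + int h) mod int N"
        using w[of i "i + int h"] w[of j "j + int h"] w[of "i + int h" "j + int h"] Nh h_pos ij by simp_all
      have ne2: "j mod int N \<noteq> (i + int h) mod int N"
        using w[of j "i + int h"] w[of "i + int h" j] nd Nh h_pos ij by (cases "j < i + int h") auto
      have ne3: "i mod int N \<noteq> (j + int h) mod int N"
      proof
        assume "i mod int N = (j + int h) mod int N"
        then have "(i + int h) mod int N = (j + int h + int h) mod int N" by (metis mod_add_left_eq)
        also have "j + int h + int h = j + int N" using Nh by simp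
        finally show False using ne2 by simp
      qed
      show ?thesis unfolding U mem_seg ind_def using A ijne ne ne2 ne3
        by (cases "k mod int N = i mod int N"; cases "k mod int N = j mod int N";
            cases "k mod int N = (i + int h) mod int N") simp_all
    qed
  qed
qed

lemma mo_E_vertex:
  assumes "i + 2 \<le> j" "j \<le> i + int N - 2"
  shows "mo (E_vertex X n (vx k)) i j = 0"
proof -
  have e: "i + 1 + int h = i + int h + 1" "j + 1 + int h = j + int h + 1" by simp_all
  show ?thesis unfolding mo_def
    using U_E_vertex[of i j k] U_E_vertex[of "i + 1" "j + 1" k] U_E_vertex[of i "j + 1" k] U_E_vertex[of "i + 1" j k] assms
    by (simp add: e)
qed

text \<open>The second difference of a product is the product of the first differences, each
  supported at the two ends of the arc. Minus the product of opposite signs contributes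
  \<open>+1\<close> for each matching of the two edges.\<close>

lemma mo_v_vec:
  assumes pq: "p < q" "q < p + int (N div 2)" and ij: "i + 2 \<le> j" "j \<le> i + int N - 2"
  shows "mo (v_vec X n (seg N p q)) i j = pair_count i j (p - 1) q"
proof -
  let ?a = "arc_ind p (q - p + 1)"
  have d: "?a z - ?a (z + 1) = ind q z - ind (p - 1) z" for z
    using arc_ind_diff[of "q - p + 1" p z] pq by simp
  define a where "a = ?a"
  note u = U_v_vec[OF pq, folded a_def]
  have e: "i + 1 + int h = i + int h + 1" "j + 1 + int h = j + int h + 1" by simp_all
  have "mo (v_vec X n (seg N p q)) i j = - ((?a i - ?a (i + 1)) * (?a j - ?a (j + 1))) -
     (if typeA then 0 else (?a (i + int h) - ?a (i + int h + 1)) * (?a (j + int h) - ?a (j + int h + 1)))"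
    unfolding mo_def a_def[symmetric]
    using u[of i j] u[of "i + 1" "j + 1"] u[of i "j + 1"] u[of "i + 1" j] ij
    by (cases typeA) (simp_all add: e algebra_simps)
  also have "\<dots> = - ((ind q i - ind (p - 1) i) * (ind q j - ind (p - 1) j)) -
     (if typeA then 0 else (ind q (i + int h) - ind (p - 1) (i + int h)) * (ind q (j + int h) - ind (p - 1) (j + int h)))"
    unfolding d ..
  also have "\<dots> = pair_count i j (p - 1) q"
  proof -
    \<comment> \<open>Distinct vertices cannot both match one end of the arc, so only the mixed
      terms of the product remain.\<close>
    have z: "ind z i * ind z j = 0" "ind z (i + int h) * ind z (j + int h) = 0" for z
    proof -
      have ne: "i mod int N \<noteq> j mod int N" using mod_window[of i "int N" j] ij by auto
      have "(i + int h) mod int N \<noteq> (j + int h) mod int N" using mod_window[of "i + int h" "int N" "j + int h"] ij by auto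
      then show "ind z i * ind z j = 0" "ind z (i + int h) * ind z (j + int h) = 0" using ne by (auto simp: ind_def)
    qed
    show ?thesis unfolding pair_count_def ind_commute[of i] ind_commute[of j] ind_commute[of "i + int h"] ind_commute[of "j + int h"]
      using z[of q] z[of "p - 1"] by (cases typeA) (auto simp: algebra_simps)
  qed
  finally show ?thesis .
qed

end

section \<open>Simplicial cones and closures of open polyhedral cones\<close>

lemma subspace_keys: "subspace {\<tau> :: 'a \<Rightarrow>\<^sub>0 real. Poly_Mapping.keys \<tau> \<subseteq> A}"
  unfolding subspace_def by (auto simp: in_keys_iff subset_iff lookup_add) (metis add_0)

text \<open>The functionals are biorthogonal to \<open>R\<close> up to positive factors and separate
  points of \<open>T\<close>. Hence they give the coordinates with respect to \<open>R\<close>, and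
  the inequalities say that these coordinates are nonnegative.\<close>

lemma simplicial_cone_dual_basis:
  fixes R T :: "'a::real_vector set" and M :: "'a \<Rightarrow> 'a \<Rightarrow> real"
  assumes T: "subspace T" "R \<subseteq> T" and fin: "finite R"
    and lin: "\<And>w. w \<in> R \<Longrightarrow> linear (M w)"
    and pos: "\<And>w. w \<in> R \<Longrightarrow> M w w > 0"
    and orth: "\<And>w w'. w \<in> R \<Longrightarrow> w' \<in> R \<Longrightarrow> w \<noteq> w' \<Longrightarrow> M w w' = 0"
    and sep: "\<And>\<tau>. \<tau> \<in> T \<Longrightarrow> (\<And>w. w \<in> R \<Longrightarrow> M w \<tau> = 0) \<Longrightarrow> \<tau> = 0"
  defines "C \<equiv> {\<tau> \<in> T. \<forall>w\<in>R. M w \<tau> \<ge> 0}"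
  shows "pointed C \<and> simplicial_cone_generated_by C R"
proof -
  have comb: "M w (\<Sum>w'\<in>R. a w' *\<^sub>R w') = a w * M w w" if w: "w \<in> R" for a w
  proof -
    have "M w (\<Sum>w'\<in>R. a w' *\<^sub>R w') = (\<Sum>w'\<in>R. a w' * M w w')"
      by (simp add: linear_sum[OF lin[OF w]] linear_scale[OF lin[OF w]])
    also have "\<dots> = (\<Sum>w'\<in>R. if w' = w then a w * M w w else 0)"
      using orth[OF w] by (intro sum.cong) auto
    finally show ?thesis using fin w by simp
  qed
  have sumT: "(\<Sum>w\<in>R. a w *\<^sub>R w) \<in> T" for a
    using T by (intro subspace_sum subspace_scale) auto
  have zero: "0 \<in> C" unfolding C_def using subspace_0[OF T(1)] linear_0[OF lin] by simp
  have pointed: "pointed C"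
    unfolding pointed_def
  proof
    show "C \<inter> uminus ` C \<subseteq> {0}"
    proof
      fix \<tau> assume "\<tau> \<in> C \<inter> uminus ` C"
      then obtain \<sigma> where s: "\<tau> \<in> C" "\<sigma> \<in> C" "\<tau> = - \<sigma>" by blast
      have "M w \<tau> = 0" if w: "w \<in> R" for w
      proof -
        have "M w \<tau> \<ge> 0" "M w \<sigma> \<ge> 0" using s w by (simp_all add: C_def)
        then show ?thesis unfolding s(3) using linear_neg[OF lin[OF w], of \<sigma>] by simp
      qed
      then show "\<tau> \<in> {0}" using sep[of \<tau>] s(1) by (simp add: C_def)
    qed
    have "0 \<in> uminus ` C" using imageI[OF zero, of uminus] by simp
    then show "{0} \<subseteq> C \<inter> uminus ` C" using zero by simp
  qed
  have "independent R"
  proof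
    assume "dependent R"
    then obtain a w where a: "w \<in> R" "a w \<noteq> 0" "(\<Sum>w\<in>R. a w *\<^sub>R w) = 0"
      unfolding dependent_finite[OF fin] by blast
    have "a w * M w w = 0" using comb[OF a(1), of a] linear_0[OF lin[OF a(1)]] a(3) by simp
    then show False using pos[OF a(1)] a(2) by simp
  qed
  moreover have "C = convex_cone hull R"
  proof
    have cc: "convex_cone (convex_cone hull R)" by (rule convex_cone_convex_cone_hull)
    show "C \<subseteq> convex_cone hull R"
    proof
      fix \<tau> assume t: "\<tau> \<in> C"
      \<comment> \<open>The coefficients are the normalised dual coordinates; the difference to
        \<open>\<tau>\<close> is killed by all functionals.\<close>
      let ?s = "\<Sum>w\<in>R. (M w \<tau> / M w w) *\<^sub>R w"
      have "\<tau> - ?s = 0"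
      proof (rule sep)
        show "\<tau> - ?s \<in> T" using t sumT by (intro subspace_diff[OF T(1)]) (auto simp: C_def)
        show "M w (\<tau> - ?s) = 0" if w: "w \<in> R" for w
          unfolding linear_diff[OF lin[OF w]] comb[OF w] using pos[OF w] by simp
      qed
      then have eq: "\<tau> = ?s" by simp
      have hull: "(\<Sum>w\<in>B. (M w \<tau> / M w w) *\<^sub>R w) \<in> convex_cone hull R" if "B \<subseteq> R" for B
        using finite_subset[OF that fin] that
      proof (induction B rule: finite_induct)
        case empty
        show ?case using convex_cone_contains_0[OF cc] by simp
      next
        case (insert w B)
        have w: "w \<in> R" using insert by simp
        have "M w \<tau> / M w w \<ge> 0" using t w pos[OF w] by (simp add: C_def)
        then have "(M w \<tau> / M w w) *\<^sub>R w \<in> convex_cone hull R"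
          using convex_cone_scaleR[OF cc] hull_inc[OF w] by blast
        then show ?case using insert convex_cone_add[OF cc] by simp
      qed
      show "\<tau> \<in> convex_cone hull R" by (subst eq, rule hull) (rule order_refl)
    qed
    show "convex_cone hull R \<subseteq> C"
    proof (rule hull_minimal)
      show "R \<subseteq> C"
      proof
        fix w assume w: "w \<in> R"
        have "M w' w \<ge> 0" if "w' \<in> R" for w'
          using pos[OF w] orth[OF that w] by (cases "w' = w") simp_all
        then show "w \<in> C" using w T(2) by (auto simp: C_def)
      qed
      show "convex_cone C"
        unfolding convex_cone_iff
      proof (intro conjI ballI allI impI)
        show "0 \<in> C" by (rule zero)
        show "\<sigma> + \<tau> \<in> C" if "\<sigma> \<in> C" "\<tau> \<in> C" for \<sigma> \<tau>
          using that subspace_add[OF T(1), of \<sigma> \<tau>] by (simp add: C_def linear_add[OF lin])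
        show "c *\<^sub>R \<tau> \<in> C" if "\<tau> \<in> C" "0 \<le> c" for \<tau> c
          using that subspace_scale[OF T(1), of \<tau> c] by (simp add: C_def linear_scale[OF lin])
      qed
    qed
  qed
  ultimately show ?thesis using pointed fin by (simp add: simplicial_cone_generated_by_def)
qed

text \<open>The metric is the sum of the coordinate distances, so each coordinate is
  1-Lipschitz.\<close>

lemma continuous_on_lookup: "continuous_on A (\<lambda>\<omega> :: 'a \<Rightarrow>\<^sub>0 real. Poly_Mapping.lookup \<omega> v)"
proof -
  have le: "dist (Poly_Mapping.lookup \<omega> v) (Poly_Mapping.lookup \<sigma> v) \<le> dist \<omega> \<sigma>" for \<omega> \<sigma> :: "'a \<Rightarrow>\<^sub>0 real"
  proof (cases "v \<in> Poly_Mapping.keys \<omega> \<union> Poly_Mapping.keys \<sigma>")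
    case True
    then show ?thesis unfolding dist_poly_mapping_def by (intro member_le_sum) auto
  qed (simp add: in_keys_iff)
  show ?thesis unfolding continuous_on_iff using le_less_trans[OF le] by blast
qed

text \<open>A point satisfying the weak inequalities is approached from the strict region by adding
  small positive multiples of the interior point \<open>\<omega>0\<close>.\<close>

lemma closure_strict:
  fixes f :: "'i \<Rightarrow> 'a::real_normed_vector \<Rightarrow> real"
  assumes "closed T" "subspace T" and cont: "\<And>i. i \<in> I \<Longrightarrow> continuous_on UNIV (f i)"
    and lin: "\<And>i. i \<in> I \<Longrightarrow> linear (f i)"
    and inner: "\<omega>0 \<in> T" "\<And>i. i \<in> I \<Longrightarrow> f i \<omega>0 > 0"
  shows "closure {\<omega> \<in> T. \<forall>i\<in>I. f i \<omega> > 0} = {\<omega> \<in> T. \<forall>i\<in>I. f i \<omega> \<ge> 0}"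
proof
  have "{\<omega> \<in> T. \<forall>i\<in>I. f i \<omega> \<ge> 0} = T \<inter> (\<Inter>i\<in>I. {\<omega>. 0 \<le> f i \<omega>})" by auto
  also have "closed \<dots>"
    using assms(1) cont by (intro closed_Int closed_INT ballI closed_Collect_le continuous_on_const)
  finally show "closure {\<omega> \<in> T. \<forall>i\<in>I. f i \<omega> > 0} \<subseteq> {\<omega> \<in> T. \<forall>i\<in>I. f i \<omega> \<ge> 0}"
    by (intro closure_minimal) (auto intro: less_imp_le)
  show "{\<omega> \<in> T. \<forall>i\<in>I. f i \<omega> \<ge> 0} \<subseteq> closure {\<omega> \<in> T. \<forall>i\<in>I. f i \<omega> > 0}"
  proof
    fix \<omega> assume w: "\<omega> \<in> {\<omega> \<in> T. \<forall>i\<in>I. f i \<omega> \<ge> 0}"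
    have "\<exists>y\<in>{\<omega> \<in> T. \<forall>i\<in>I. f i \<omega> > 0}. dist y \<omega> < e" if e: "e > 0" for e
    proof -
      \<comment> \<open>The summand 1 avoids division by zero and makes the displacement strictly
        smaller than \<open>e\<close>.\<close>
      define c where "c = e / (norm \<omega>0 + 1)"
      have c: "c > 0" using e by (simp add: c_def add_nonneg_pos)
      have "c * norm \<omega>0 < c * (norm \<omega>0 + 1)" using c by simp
      also have "\<dots> = e" unfolding c_def by (simp add: add_nonneg_eq_0_iff)
      finally have "c * norm \<omega>0 < e" .
      then have "dist (\<omega> + c *\<^sub>R \<omega>0) \<omega> < e" using c by (simp add: dist_norm)
      moreover have "\<omega> + c *\<^sub>R \<omega>0 \<in> T"
        using w inner(1) by (intro subspace_add subspace_scale assms(2)) auto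
      moreover have "f i (\<omega> + c *\<^sub>R \<omega>0) > 0" if i: "i \<in> I" for i
        unfolding linear_add[OF lin[OF i]] linear_scale[OF lin[OF i]]
        using w i inner(2)[OF i] c by (simp add: add_nonneg_pos)
      ultimately show ?thesis by blast
    qed
    then show "\<omega> \<in> closure {\<omega> \<in> T. \<forall>i\<in>I. f i \<omega> > 0}" unfolding closure_approachable by blast
  qed
qed

lemma closed_keys: "closed {\<omega> :: 'a \<Rightarrow>\<^sub>0 real. Poly_Mapping.keys \<omega> \<subseteq> A}"
proof -
  have "{\<omega> :: 'a \<Rightarrow>\<^sub>0 real. Poly_Mapping.keys \<omega> \<subseteq> A} = (\<Inter>v\<in>- A. {\<omega>. Poly_Mapping.lookup \<omega> v = 0})"
    by (auto simp: in_keys_iff)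
  also have "closed \<dots>"
    by (intro closed_INT ballI closed_Collect_eq continuous_on_lookup continuous_on_const)
  finally show ?thesis .
qed

context polygon_cluster
begin

section \<open>Coordinates of the vectors \<open>v_tilde\<close>\<close>

text \<open>Two consecutive vertices both lie on an arc of \<open>m + 1\<close> vertices exactly
  when the first starts one of its \<open>m\<close> edges; \<open>m + 1 < N\<close> excludes an edge
  closing up the boundary.\<close>

lemma arc_ind_mult:
  assumes "0 \<le> m" "m + 1 < int N"
  shows "arc_ind p (m + 1) i * arc_ind p (m + 1) (i + 1) = arc_ind p m i"
proof -
  let ?t = "(i - p) mod int N"
  have t: "0 \<le> ?t" "?t < int N" using N_pos by simp_all
  have s: "(i + 1 - p) mod int N = (?t + 1) mod int N" by (simp add: mod_simps algebra_simps)
  have "arc_ind p (m + 1) i * arc_ind p (m + 1) (i + 1) = of_bool (?t < m + 1 \<and> (?t + 1) mod int N < m + 1)"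
    unfolding of_bool_conj s[symmetric] using arc_ind_eq[of "m + 1" p i] arc_ind_eq[of "m + 1" p "i + 1"] assms by simp
  also have "?t < m + 1 \<and> (?t + 1) mod int N < m + 1 \<longleftrightarrow> ?t < m"
  proof (cases "?t + 1 < int N")
    case True
    then have "(?t + 1) mod int N = ?t + 1" using t by (intro mod_pos_pos_trivial) auto
    then show ?thesis by linarith
  next
    case False
    then show ?thesis using t assms by linarith
  qed
  also have "of_bool (?t < m) = arc_ind p m i" using arc_ind_eq[of m p i] assms by simp
  finally show ?thesis .
qed

text \<open>In types B and C a label contains an edge and its image, so a function of edges enters
  symmetrised under the half-turn.\<close>

definition BC :: "(int \<Rightarrow> real) \<Rightarrow> int \<Rightarrow> real" where
  "BC f i = f i + (if typeA then 0 else f (i + int h))"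

lemma U_v_vec_edge:
  assumes pq: "p < q" "q < p + int (N div 2)"
  shows "U (v_vec X n (seg N p q)) i (i + 1) = - BC (arc_ind p (q - p)) i"
proof -
  have "q - p + 1 < int N"
  proof -
    have "2 * (q - p) < 2 * int (N div 2)" using assms by simp
    also have "\<dots> \<le> int N" by (simp add: zdiv_int)
    finally have lt: "2 * (q - p) < int N" .
    have "q - p + 1 \<le> 2 * (q - p)" using pq(1) by simp
    then show ?thesis using lt by (rule le_less_trans)
  qed
  then have m: "arc_ind p (q - p + 1) k * arc_ind p (q - p + 1) (k + 1) = arc_ind p (q - p) k" for k
    using arc_ind_mult[of "q - p" p k] pq by simp
  have e: "i + 1 + int h = i + int h + 1" by simp
  have "U (v_vec X n (seg N p q)) i (i + 1) = - (arc_ind p (q - p + 1) i * arc_ind p (q - p + 1) (i + 1)) -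
    (if typeA then 0 else arc_ind p (q - p + 1) (i + int h) * arc_ind p (q - p + 1) (i + int h + 1))"
    using U_v_vec[OF pq, of i "i + 1"] N_ge unfolding e by simp
  then show ?thesis unfolding m BC_def by simp
qed

text \<open>The common form of \<open>E_seg\<close> and \<open>E_bar\<close>: every second vertex
  after \<open>p\<close>, beginning with \<open>p + 1\<close>.\<close>

definition E_alt :: "int \<Rightarrow> nat \<Rightarrow> lvec" where
  "E_alt p r = (\<Sum>k = 1..r. E_vertex X n ((vx p + 2 * k - 1) mod N))"

lemma vx_alt: "k \<ge> 1 \<Longrightarrow> (vx p + 2 * k - 1) mod N = vx (p + 2 * int k - 1)"
proof -
  assume k: "k \<ge> 1"
  then have "vx p + 2 * k - 1 = vx p + (2 * k - 1)" by simp
  moreover have "int (2 * k - 1) = 2 * int k - 1" using k by simp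
  ultimately show ?thesis using vx_add[of p "2 * k - 1"] by (simp add: algebra_simps)
qed

lemma E_alt_Suc: "E_alt p (Suc r) = E_alt p r + E_vertex X n (vx (p + 2 * int r + 1))"
  using vx_alt[of "Suc r" p] by (simp add: E_alt_def algebra_simps)

lemma U_E_vertex_edge: "U (E_vertex X n (vx k)) i (i + 1) = BC (\<lambda>z. ind k z + ind (k - 1) z) i"
proof -
  have s: "ind k (z + 1) = ind (k - 1) z" for z using ind_add[of "k - 1" 1 z] by simp
  have e: "i + 1 + int h = i + int h + 1" by simp
  show ?thesis using U_E_vertex[of i "i + 1" k] N_ge unfolding e s by (simp add: BC_def)
qed

text \<open>Each chosen vertex covers its two incident edges, and consecutive choices are two steps
  apart; so \<open>r\<close> of them cover the first \<open>2 * r\<close> edges after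
  \<open>p\<close> once each.\<close>

lemma U_E_alt_edge: "U (E_alt p r) i (i + 1) = BC (arc_ind p (2 * int r)) i"
proof (induction r)
  case 0
  then show ?case by (simp add: E_alt_def U_zero BC_def arc_ind_0)
next
  case (Suc r)
  have e: "arc_ind p (2 * int (Suc r)) z = arc_ind p (2 * int r) z + (ind (p + 2 * int r + 1) z + ind (p + 2 * int r + 1 - 1) z)" for z
  proof -
    have "arc_ind p (2 * int r + 1 + 1) z = arc_ind p (2 * int r) z + ind (p + 2 * int r) z + ind (p + (2 * int r + 1)) z"
      using arc_ind_add[of "2 * int r + 1" 1 p z] arc_ind_add[of "2 * int r" 1 p z] by (simp add: arc_ind_1)
    moreover have "2 * int (Suc r) = 2 * int r + 1 + 1" by simp
    ultimately show ?thesis by (simp add: algebra_simps)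
  qed
  show ?case unfolding E_alt_Suc U_add Suc U_E_vertex_edge BC_def e by simp
qed

lemma E_seg_eq:
  assumes pq: "p < q" "q < p + int (N div 2)"
  shows "E_seg X n (seg N p q) = E_alt p (nat (q - p) div 2)"
  unfolding E_seg_def E_alt_def Let_def nonmaximal_seg[OF pq] ..

lemma E_bar_eq:
  assumes pq: "p < q" "q < p + int (N div 2)"
  shows "E_bar X n (seg N p q) = E_alt q ((N - nat (q - p)) div 2)"
  unfolding E_bar_def E_alt_def Let_def nonmaximal_seg[OF pq] ..

lemma E_total_eq: "E_total X n = (\<Sum>k\<in>{0..<int N}. E_vertex X n (vx k))"
  unfolding E_total_def
  by (rule sum.reindex_bij_witness[where i = nat and j = int]) auto

text \<open>An edge has two endpoints, and its label in types B and C involves four vertices. This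
  is the origin of the factors 1/2 and 1/4 in \<open>v_tilde\<close>, which normalise the value on
  every edge to 1.\<close>

lemma U_E_total_edge: "U (E_total X n) i (i + 1) = (if typeA then 2 else 4)"
proof -
  have one: "(\<Sum>k\<in>{0..<int N}. ind k z) = 1" for z
    using arc_ind_full[of 0 z] by (simp add: arc_ind_def)
  have two: "(\<Sum>k\<in>{0..<int N}. ind (k - 1) z) = 1" for z
  proof -
    have "ind (k - 1) z = ind k (z + 1)" for k using ind_add[of "k - 1" 1 z] by simp
    then show ?thesis using one[of "z + 1"] by simp
  qed
  show ?thesis unfolding E_total_eq U_sum U_E_vertex_edge BC_def
    by (cases typeA) (simp_all add: sum.distrib one two)
qed

lemma mo_E_alt: "i + 2 \<le> j \<Longrightarrow> j \<le> i + int N - 2 \<Longrightarrow> mo (E_alt p r) i j = 0"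
  by (induction r) (simp_all add: E_alt_Suc mo_add mo_E_vertex, simp add: E_alt_def mo_zero)

lemma mo_E_total: "i + 2 \<le> j \<Longrightarrow> j \<le> i + int N - 2 \<Longrightarrow> mo (E_total X n) i j = 0"
  unfolding E_total_eq mo_sum by (intro sum.neutral ballI mo_E_vertex)

abbreviation "LS \<equiv> {\<tau> :: lvec. Poly_Mapping.keys \<tau> \<subseteq> label X n ` segments N}"

lemma basis_vec_LS: "l \<in> segments N \<Longrightarrow> basis_vec (label X n l) \<in> LS"
  by (simp add: basis_vec_def)

lemma v_vec_LS: "v_vec X n l \<in> LS"
  unfolding v_vec_def
  by (intro subspace_neg[OF subspace_keys] subspace_sum[OF subspace_keys] basis_vec_LS) (simp add: F_set_def)

lemma E_vertex_LS: "E_vertex X n (vx k) \<in> LS"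
proof (cases typeA)
  case True
  then have X: "X = Type_A" by (simp only: typeA_def)
  show ?thesis unfolding E_vertex_def Let_def if_P[OF X]
    by (intro subspace_sum[OF subspace_keys] basis_vec_LS) simp
next
  case A: False
  then have X: "X \<noteq> Type_A" by (simp only: typeA_def not_False_eq_True)
  have d: "{vx k, antipode N (vx k)} \<in> segments N"
    unfolding antipode_vx[OF A] seg_vx
    by (rule seg_in_segments) (use int_N_h[OF A] h_pos in linarith)+
  have s: "basis_vec L \<in> LS" if "L \<in> {L. L \<in> label X n ` {l \<in> segments N. 2 * len N l \<noteq> N} \<and> vx k \<in> \<Union> L}" for L
  proof -
    have "L \<in> label X n ` segments N" using that by auto
    then obtain l where "l \<in> segments N" "L = label X n l" by (rule imageE)
    then show ?thesis using basis_vec_LS by simp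
  qed
  show ?thesis unfolding E_vertex_def Let_def if_not_P[OF X]
    by (intro subspace_add[OF subspace_keys] subspace_scale[OF subspace_keys] subspace_sum[OF subspace_keys]
        basis_vec_LS[OF d] s)
qed

lemma E_alt_LS: "E_alt p r \<in> LS"
proof (induction r)
  case 0
  then show ?case by (simp add: E_alt_def)
next
  case (Suc r)
  then show ?case unfolding E_alt_Suc by (intro subspace_add[OF subspace_keys] E_vertex_LS)
qed

lemma E_total_LS: "E_total X n \<in> LS"
  unfolding E_total_eq by (intro subspace_sum[OF subspace_keys] E_vertex_LS)

lemma v_tilde_eq:
  assumes pq: "p < q" "q < p + int (N div 2)"
  shows "v_tilde X n (seg N p q) =
    (if even (q - p) then v_vec X n (seg N p q) + E_alt p (nat (q - p) div 2)
     else if typeA then v_vec X n (seg N p q) + (1/2) *\<^sub>R E_total X n - E_alt q ((N - nat (q - p)) div 2)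
     else v_vec X n (seg N p q) + (1/4) *\<^sub>R E_total X n - E_alt q (nat (p + int h - q) div 2))"
proof -
  have ev: "even (nat (q - p)) \<longleftrightarrow> even (q - p)" using pq by (simp add: even_nat_iff)
  have "E_seg X n {vx q, antipode N (vx p)} = E_alt q (nat (p + int h - q) div 2)" if A: "\<not> typeA"
  proof -
    have "q < p + int h" "p + int h < q + int (N div 2)" using pq N_h[OF A] by auto
    then show ?thesis unfolding antipode_vx[OF A] seg_vx by (rule E_seg_eq)
  qed
  then show ?thesis
    unfolding v_tilde_def Let_def nonmaximal_seg[OF pq] ev E_seg_eq[OF pq] E_bar_eq[OF pq] typeA_def[symmetric]
    by (cases typeA) simp_all
qed

text \<open>On edges \<open>v\<close> is minus the indicator of the minor arc. For even length the
  alternating vertices on that arc cancel it; for odd length the constant 1 is added and a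
  complementary arc, which has even length, is subtracted.\<close>

lemma U_v_tilde_edge:
  assumes pq: "p < q" "q < p + int (N div 2)"
  shows "U (v_tilde X n (seg N p q)) i (i + 1) = 0"
proof (cases "even (q - p)")
  case True
  then have "2 * int (nat (q - p) div 2) = q - p" using pq by (simp add: even_nat_iff zdiv_int)
  then show ?thesis unfolding v_tilde_eq[OF pq] using True
    by (simp add: U_add U_v_vec_edge[OF pq] U_E_alt_edge)
next
  case odd: False
  show ?thesis
  proof (cases typeA)
    case A: True
    have "2 * (q - p) < 2 * int (N div 2)" using assms by simp
    also have "\<dots> \<le> int N" by (simp add: zdiv_int)
    finally have lt: "q - p < int N" using pq by simp
    \<comment> \<open>Since \<open>n\<close> is even, \<open>N = n + 3\<close> is odd, so the arc
      complementary to an odd one has an even number of edges.\<close>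
    have "odd N" using A even by (simp add: typeA_def polygon_size_def)
    then have "even (int N - (q - p))" using odd by simp
    moreover have "int (N - nat (q - p)) = int N - (q - p)" using lt pq by simp
    ultimately have e: "2 * int ((N - nat (q - p)) div 2) = int N - (q - p)" by (simp add: zdiv_int)
    have "arc_ind p (q - p + (int N - (q - p))) i = arc_ind p (q - p) i + arc_ind (p + (q - p)) (int N - (q - p)) i"
      by (rule arc_ind_add) (use lt pq in auto)
    then have "arc_ind p (q - p) i + arc_ind q (int N - (q - p)) i = 1" using arc_ind_full[of p i] by simp
    then show ?thesis unfolding v_tilde_eq[OF pq] using odd A
      by (simp add: U_add U_diff U_scaleR U_v_vec_edge[OF pq] U_E_alt_edge e U_E_total_edge BC_def)
  next
    case A: False
    have lt: "q < p + int h" using pq N_h[OF A] by simp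
    \<comment> \<open>Here the complement is taken inside one half of the polygon, from
      \<open>q\<close> to the antipode of \<open>p\<close>; its length is even because
      \<open>h = n + 1\<close> is odd.\<close>
    have "odd (int h)" using even by (simp add: h_def)
    then have "even (p + int h - q)" using odd by simp
    then have e: "2 * int (nat (p + int h - q) div 2) = p + int h - q" using lt by (simp add: zdiv_int)
    have ar: "arc_ind p (q - p) z + arc_ind q (p + int h - q) z = arc_ind p (int h) z" for z
      using arc_ind_add[of "q - p" "p + int h - q" p z] pq lt by simp
    have "BC (arc_ind p (q - p)) i + BC (arc_ind q (p + int h - q)) i = 1"
      unfolding BC_def using ar[of i] ar[of "i + int h"] arc_ind_half[OF A, of p i] A by simp
    then show ?thesis unfolding v_tilde_eq[OF pq] using odd A
      by (simp add: U_add U_diff U_scaleR U_v_vec_edge[OF pq] U_E_alt_edge e U_E_total_edge)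
  qed
qed

lemma mo_v_tilde:
  assumes pq: "p < q" "q < p + int (N div 2)" and ij: "i + 2 \<le> j" "j \<le> i + int N - 2"
  shows "mo (v_tilde X n (seg N p q)) i j = pair_count i j (p - 1) q"
  unfolding v_tilde_eq[OF pq]
  by (simp add: mo_add mo_diff mo_scaleR mo_E_alt[OF ij] mo_E_total[OF ij] mo_v_vec[OF pq ij])

lemma v_tilde_keys:
  assumes "l \<in> nonmaximal N"
  shows "Poly_Mapping.keys (v_tilde X n l) \<subseteq> diag_labels X n"
proof
  obtain p q where pq: "p < q" "q < p + int (N div 2)" "l = seg N p q" by (rule nonmaximalE[OF assms])
  fix L assume L: "L \<in> Poly_Mapping.keys (v_tilde X n l)"
  have "v_tilde X n l \<in> LS"
    unfolding pq(3) v_tilde_eq[OF pq(1,2)] if_split[of "\<lambda>u. u \<in> LS"]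
    by (intro conjI impI subspace_add[OF subspace_keys] subspace_diff[OF subspace_keys]
        subspace_scale[OF subspace_keys] v_vec_LS E_alt_LS E_total_LS)
  then obtain s where s: "s \<in> segments N" "L = label X n s" using L by blast
  have "s \<notin> edges N"
  proof
    assume "s \<in> edges N"
    then obtain i where "s = seg N i (i + 1)" unfolding edges_eq[OF N_pos] by blast
    then show False using U_v_tilde_edge[OF pq(1,2), of i] L unfolding U_def s(2) pq(3)
      by (simp add: in_keys_iff split: if_splits)
  qed
  then show "L \<in> diag_labels X n" using s by (simp add: diag_labels_def diagonals_def)
qed

section \<open>The cone\<close>

lemma edge_label_not_diag: "s \<in> edges N \<Longrightarrow> label X n s \<notin> diag_labels X n"
proof
  assume s: "s \<in> edges N" "label X n s \<in> diag_labels X n"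
  then obtain l where l: "l \<in> diagonals N" "label X n s = label X n l" unfolding diag_labels_def by blast
  have "s \<in> segments N" using edges_subset_segments[of N] N_ge s(1) by auto
  moreover have "l \<in> segments N" using l(1) by (simp add: diagonals_def)
  ultimately have "s = l \<or> s = bar l" using label_eq_iff[of l s] l(2) by simp
  then have "s \<in> diagonals N" using l(1) bar_diagonals by auto
  then show False using s(1) by (simp add: diagonals_def)
qed

lemma U_edge_zero:
  assumes "Poly_Mapping.keys \<tau> \<subseteq> diag_labels X n"
  shows "U \<tau> i (i + 1) = 0"
proof -
  have "label X n (seg N i (i + 1)) \<notin> Poly_Mapping.keys \<tau>"
    using edge_label_not_diag[OF seg_edge[OF N_pos]] assms by blast
  then show ?thesis by (simp add: U_def in_keys_iff)
qed

text \<open>If all Monge functionals vanish on \<open>\<tau>\<close>, then \<open>U \<tau>\<close> satisfies a Ptolemy relation with vanishing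
  edges, hence changes sign under rotation by one step; an odd number of steps is a symmetry.\<close>

lemma mo_eq_zero:
  assumes keys: "Poly_Mapping.keys \<tau> \<subseteq> diag_labels X n"
    and flat: "\<And>i j. i + 2 \<le> j \<Longrightarrow> j \<le> i + int N - 2 \<Longrightarrow> mo \<tau> i j = 0"
  shows "\<tau> = 0"
proof -
  have neg: "U \<tau> (i + 1) (j + 1) = - U \<tau> i j" if ij: "i + 2 \<le> j" "j \<le> i + int N - 2" for i j
  proof -
    \<comment> \<open>In the quadrilateral \<open>i + 1\<close>, \<open>j\<close>,
      \<open>j + 1\<close>, \<open>i + N\<close> two opposite sides are polygon edges, where
      \<open>U\<close> vanishes, so its two diagonals have opposite values.\<close>
    have "U \<tau> (i + 1) (i + int N) + U \<tau> j (j + 1) = U \<tau> (i + 1) (j + 1) + U \<tau> j (i + int N)"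
    proof (rule ptolemy_eq[where N = "int N"])
      show "U \<tau> a (b + 1) + U \<tau> (a + 1) b = U \<tau> a b + U \<tau> (a + 1) (b + 1)"
        if "a + 2 \<le> b" "b \<le> a + int N - 2" for a b
        using flat[OF that] by (simp add: mo_def)
    qed (use ij in auto)
    moreover have "U \<tau> (i + 1) (i + int N) = 0"
      using U_edge_zero[OF keys, of "i + int N"] U_shift[of \<tau> "i + int N" "i + 1"] U_commute[of \<tau> "i + 1" "i + int N"]
      by (simp add: algebra_simps)
    moreover have "U \<tau> j (i + int N) = U \<tau> i j" using U_shift[of \<tau> j i] U_commute[of \<tau> i j] by simp
    ultimately show ?thesis using U_edge_zero[OF keys, of j] by simp
  qed
  have pow: "U \<tau> (i + int k) (j + int k) = (- 1) ^ k * U \<tau> i j" if ij: "i + 2 \<le> j" "j \<le> i + int N - 2" for i j k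
  proof (induction k)
    case (Suc k)
    have "U \<tau> (i + int k + 1) (j + int k + 1) = - U \<tau> (i + int k) (j + int k)"
      by (rule neg) (use ij in auto)
    then show ?case using Suc by (simp add: algebra_simps)
  qed simp
  have zero: "U \<tau> i j = 0" if ij: "i + 2 \<le> j" "j \<le> i + int N - 2" for i j
  proof (cases typeA)
    case True
    then have "odd N" using even by (simp add: typeA_def polygon_size_def)
    moreover have "U \<tau> (i + int N) (j + int N) = U \<tau> i j"
      unfolding U_shift using U_commute[of \<tau> "i + int N" j] U_commute[of \<tau> i j] by (simp add: U_shift)
    ultimately show ?thesis using pow[OF ij, of N] by simp
  next
    case False
    have "odd h" using even by (simp add: h_def)
    then show ?thesis using pow[OF ij, of h] U_half[OF False, of \<tau> i j] by simp
  qed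
  have "Poly_Mapping.lookup \<tau> L = 0" if L: "L \<in> diag_labels X n" for L
  proof -
    obtain l where l: "l \<in> diagonals N" "L = label X n l" using L unfolding diag_labels_def by blast
    then obtain i j where ij: "i < j" "j < i + int N" "l = seg N i j"
      using segI[of l N] N_pos unfolding diagonals_def by blast
    then have "U \<tau> i j = 0" using zero seg_diagonals_iff[OF ij(1,2)] l(1) by blast
    then show ?thesis unfolding U_def l(2) ij(3) by (simp split: if_splits)
  qed
  then have "Poly_Mapping.lookup \<tau> L = Poly_Mapping.lookup 0 L" for L
    using keys by (cases "L \<in> Poly_Mapping.keys \<tau>") (auto simp: in_keys_iff)
  then show ?thesis by (rule poly_mapping_eqI)
qed

text \<open>The functional of the two polygon edges adjacent to the minor arc of \<open>l\<close>:
  one ends at its first vertex, hence the \<open>- 1\<close>, the other starts at its last.\<close>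

definition mn :: "nat set \<Rightarrow> lvec \<Rightarrow> real" where
  "mn l \<tau> = mo \<tau> (int (delta_minus N l) - 1) (int (delta_plus N l))"

lemma linear_mn: "linear (mn l)"
  by (rule linearI) (simp_all add: mn_def mo_add mo_scaleR)

lemma mn_seg:
  assumes pq: "p < q" "q < p + int (N div 2)"
  shows "mn (seg N p q) \<tau> = mo \<tau> (p - 1) q"
proof -
  have "int (vx p) = p mod int N" "int (vx q) = q mod int N" using N_pos by simp_all
  moreover have "ind (p mod int N - 1) (p - 1) \<noteq> 0" "ind (q mod int N) q \<noteq> 0"
    by (simp_all add: ind_def mod_diff_left_eq)
  ultimately show ?thesis unfolding mn_def nonmaximal_seg[OF pq] by (simp only: mo_mod)
qed

lemma nonmaximal_nonadjacent:
  assumes "p < q" "q < p + int (N div 2)"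
  shows "p - 1 + 2 \<le> q" "q \<le> p - 1 + int N - 2"
proof -
  have "2 * int (N div 2) \<le> int N" by (simp add: zdiv_int)
  moreover have "5 \<le> int N" using N_ge by simp
  ultimately show "p - 1 + 2 \<le> q" "q \<le> p - 1 + int N - 2" using assms by linarith+
qed

text \<open>Two nonadjacent edges leave two arcs with \<open>N - 2\<close> edges in total, so one of
  them is shorter than \<open>N div 2\<close> and is the minor arc of a suitable
  \<open>l\<close>.\<close>

lemma mo_eq_mn:
  assumes "i + 2 \<le> j" "j \<le> i + int N - 2"
  obtains l where "l \<in> nonmaximal N" "\<forall>\<tau>. mo \<tau> i j = mn l \<tau>"
proof (cases "j - i - 1 < int (N div 2)")
  case True
  then have pq: "i + 1 < j" "j < i + 1 + int (N div 2)" using assms by auto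
  show ?thesis using that[of "seg N (i + 1) j"] nonmaximal_seg(1)[OF pq] mn_seg[OF pq] by simp
next
  case False
  have "int N \<le> 2 * int (N div 2) + 1" by (simp add: zdiv_int)
  then have pq: "j + 1 < i + int N" "i + int N < j + 1 + int (N div 2)" using assms False by auto
  have "mo \<tau> i j = mo \<tau> (j + 1 - 1) (i + int N)" for \<tau>
    unfolding mo_shift using mo_commute[of \<tau> i j] by simp
  then show ?thesis using that[of "seg N (j + 1) (i + int N)"] nonmaximal_seg(1)[OF pq] mn_seg[OF pq] by simp
qed

lemma mn_v_tilde_self:
  assumes "l \<in> nonmaximal N"
  shows "mn l (v_tilde X n l) > 0"
proof -
  obtain p q where pq: "p < q" "q < p + int (N div 2)" "l = seg N p q" by (rule nonmaximalE[OF assms])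
  show ?thesis
    unfolding pq(3) mn_seg[OF pq(1,2)] mo_v_tilde[OF pq(1,2) nonmaximal_nonadjacent[OF pq(1,2)]]
    by (rule pair_count_self)
qed

lemma mo_v_tilde_nonneg:
  assumes "l \<in> nonmaximal N" "i + 2 \<le> j" "j \<le> i + int N - 2"
  shows "mo (v_tilde X n l) i j \<ge> 0"
proof -
  obtain p q where pq: "p < q" "q < p + int (N div 2)" "l = seg N p q" by (rule nonmaximalE[OF assms(1)])
  show ?thesis unfolding pq(3) mo_v_tilde[OF pq(1,2) assms(2,3)] by (rule pair_count_nonneg)
qed

text \<open>A nonzero value means that a symmetry carries one pair of edges to the other. Then all
  Monge functionals agree on the two vectors, which therefore coincide. This is the off-diagonal
  orthogonality, in contrapositive form.\<close>

lemma mn_v_tilde: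
  assumes l: "l \<in> nonmaximal N" "l' \<in> nonmaximal N" "mn l (v_tilde X n l') \<noteq> 0"
  shows "v_tilde X n l = v_tilde X n l'" "mn l \<tau> = mn l' \<tau>"
proof -
  obtain p q where pq: "p < q" "q < p + int (N div 2)" "l = seg N p q" by (rule nonmaximalE[OF l(1)])
  obtain s t where st: "s < t" "t < s + int (N div 2)" "l' = seg N s t" by (rule nonmaximalE[OF l(2)])
  have c: "pair_count (p - 1) q (s - 1) t \<noteq> 0"
    using l(3) unfolding pq(3) mn_seg[OF pq(1,2)] st(3) mo_v_tilde[OF st(1,2) nonmaximal_nonadjacent[OF pq(1,2)]] .
  show "mn l \<tau> = mn l' \<tau>"
    unfolding pq(3) st(3) mn_seg[OF pq(1,2)] mn_seg[OF st(1,2)] by (rule mo_pair_count[OF c])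
  have "v_tilde X n l - v_tilde X n l' = 0"
  proof (rule mo_eq_zero)
    show "Poly_Mapping.keys (v_tilde X n l - v_tilde X n l') \<subseteq> diag_labels X n"
      using subspace_diff[OF subspace_keys, of "v_tilde X n l" "diag_labels X n" "v_tilde X n l'"] v_tilde_keys l(1,2) by simp
    show "mo (v_tilde X n l - v_tilde X n l') i j = 0" if "i + 2 \<le> j" "j \<le> i + int N - 2" for i j
      unfolding mo_diff pq(3) st(3) mo_v_tilde[OF pq(1,2) that] mo_v_tilde[OF st(1,2) that]
        pair_count_cong[OF c] by simp
  qed
  then show "v_tilde X n l = v_tilde X n l'" by simp
qed

definition monge_cone :: "lvec set" where
  "monge_cone = {\<tau>. Poly_Mapping.keys \<tau> \<subseteq> diag_labels X n \<and>
     (\<forall>i j. i + 2 \<le> j \<and> j \<le> i + int N - 2 \<longrightarrow> mo \<tau> i j \<ge> 0)}"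

lemma finite_nonmaximal: "finite (nonmaximal N)"
  unfolding nonmaximal_def by (rule finite_subset[OF _ finite_segments]) auto

lemma monge_cone_simplicial:
  "pointed monge_cone \<and> simplicial_cone_generated_by monge_cone (v_tilde X n ` nonmaximal N)"
proof -
  let ?R = "v_tilde X n ` nonmaximal N" and ?T = "{\<tau> :: lvec. Poly_Mapping.keys \<tau> \<subseteq> diag_labels X n}"
  \<comment> \<open>Segments exchanged by the half-turn give the same generator; \<open>g\<close>
    picks one of them, and \<open>mg\<close> shows that the functional does not depend on the
    choice.\<close>
  define g where "g = inv_into (nonmaximal N) (v_tilde X n)"
  have g: "g w \<in> nonmaximal N" "v_tilde X n (g w) = w" if "w \<in> ?R" for w
    unfolding g_def by (rule inv_into_into[OF that], rule f_inv_into_f[OF that])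
  have mg: "mn (g (v_tilde X n l)) \<tau> = mn l \<tau>" if l: "l \<in> nonmaximal N" for l \<tau>
  proof -
    have w: "v_tilde X n l \<in> ?R" using l by (rule imageI)
    have "mn l (v_tilde X n (g (v_tilde X n l))) \<noteq> 0" unfolding g(2)[OF w] using mn_v_tilde_self[OF l] by simp
    then show ?thesis using mn_v_tilde(2)[OF l g(1)[OF w]] by simp
  qed
  have "monge_cone = {\<tau> \<in> ?T. \<forall>w\<in>?R. mn (g w) \<tau> \<ge> 0}"
  proof (intro equalityI subsetI)
    fix \<tau> assume t: "\<tau> \<in> monge_cone"
    have "mn (g (v_tilde X n l)) \<tau> \<ge> 0" if l: "l \<in> nonmaximal N" for l
    proof -
      obtain p q where pq: "p < q" "q < p + int (N div 2)" "l = seg N p q" by (rule nonmaximalE[OF l])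
      show ?thesis unfolding mg[OF l] unfolding pq(3) mn_seg[OF pq(1,2)]
        using t nonmaximal_nonadjacent[OF pq(1,2)] unfolding monge_cone_def by blast
    qed
    then show "\<tau> \<in> {\<tau> \<in> ?T. \<forall>w\<in>?R. mn (g w) \<tau> \<ge> 0}" using t by (simp add: monge_cone_def)
  next
    fix \<tau> assume t: "\<tau> \<in> {\<tau> \<in> ?T. \<forall>w\<in>?R. mn (g w) \<tau> \<ge> 0}"
    have "mo \<tau> i j \<ge> 0" if ij: "i + 2 \<le> j" "j \<le> i + int N - 2" for i j
    proof -
      obtain l where l: "l \<in> nonmaximal N" "\<forall>\<tau>. mo \<tau> i j = mn l \<tau>" using mo_eq_mn[OF ij] .
      have "mn (g (v_tilde X n l)) \<tau> \<ge> 0" using t l(1) by blast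
      then show ?thesis unfolding l(2)[rule_format] mg[OF l(1)] .
    qed
    then show "\<tau> \<in> monge_cone" using t by (simp add: monge_cone_def)
  qed
  also have "pointed \<dots> \<and> simplicial_cone_generated_by \<dots> ?R"
  proof (rule simplicial_cone_dual_basis)
    show "subspace ?T" by (rule subspace_keys)
    show "?R \<subseteq> ?T" using v_tilde_keys by blast
    show "finite ?R" using finite_nonmaximal by (rule finite_imageI)
    show "linear (mn (g w))" for w by (rule linear_mn)
    show "mn (g w) w > 0" if "w \<in> ?R" for w using mn_v_tilde_self[OF g(1)[OF that]] unfolding g(2)[OF that] .
    show "mn (g w) w' = 0" if w: "w \<in> ?R" "w' \<in> ?R" "w \<noteq> w'" for w w'
      using mn_v_tilde(1)[OF g(1)[OF w(1)] g(1)[OF w(2)]] w(3) unfolding g(2)[OF w(1)] g(2)[OF w(2)] by blast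
    show "\<tau> = 0" if t: "\<tau> \<in> ?T" "\<And>w. w \<in> ?R \<Longrightarrow> mn (g w) \<tau> = 0" for \<tau>
    proof (rule mo_eq_zero)
      show "Poly_Mapping.keys \<tau> \<subseteq> diag_labels X n" using t(1) by simp
      fix i j :: int assume ij: "i + 2 \<le> j" "j \<le> i + int N - 2"
      obtain l where l: "l \<in> nonmaximal N" "\<forall>\<tau>. mo \<tau> i j = mn l \<tau>" using mo_eq_mn[OF ij] .
      show "mo \<tau> i j = 0" using t(2)[OF imageI[OF l(1)]] unfolding mg[OF l(1)] l(2)[rule_format] .
    qed
  qed
  finally show ?thesis .
qed

section \<open>Passing between label coordinates and cluster variables\<close>

lemma finite_diag_labels: "finite (diag_labels X n)"
  unfolding diag_labels_def by (intro finite_imageI finite_diagonals)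

lemma lookup_relabel:
  "Poly_Mapping.lookup (relabel X n x \<omega>) L = (if L \<in> diag_labels X n then Poly_Mapping.lookup \<omega> (x L) else 0)"
proof -
  have "Poly_Mapping.lookup (relabel X n x \<omega>) L =
      (\<Sum>L'\<in>diag_labels X n. if L' = L then Poly_Mapping.lookup \<omega> (x L) else 0)"
    unfolding relabel_def lookup_sum by (intro sum.cong) (auto simp: lookup_basis_vec)
  then show ?thesis using finite_diag_labels by simp
qed

lemma keys_relabel: "Poly_Mapping.keys (relabel X n x \<omega>) \<subseteq> diag_labels X n"
  by (auto simp: in_keys_iff lookup_relabel split: if_splits)

lemma W_eq: "W \<omega> i j = (if seg N i j \<in> edges N then 0
    else (if typeB \<and> diameter i j then 2 else 1) * Poly_Mapping.lookup \<omega> (xs i j))"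
  by (simp add: W_def expo_def)

lemma W_relabel: "i < j \<Longrightarrow> j < i + int N \<Longrightarrow> W \<omega> i j = U (relabel X n x \<omega>) i j"
proof -
  assume ij: "i < j" "j < i + int N"
  show ?thesis
  proof (cases "seg N i j \<in> edges N")
    case True
    then show ?thesis using edge_label_not_diag by (simp add: W_eq U_def lookup_relabel)
  next
    case False
    then have "label X n (seg N i j) \<in> diag_labels X n"
      using seg_in_segments[OF ij] by (simp add: diag_labels_def diagonals_def)
    then show ?thesis using False by (simp add: W_eq U_def lookup_relabel)
  qed
qed

definition monge :: "int \<times> int \<Rightarrow> ('f \<Rightarrow>\<^sub>0 real) \<Rightarrow> real" where
  "monge = (\<lambda>(i, j) \<omega>. W \<omega> i j + W \<omega> (i + 1) (j + 1) - W \<omega> i (j + 1) - W \<omega> (i + 1) j)"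

lemma monge_eq: "i + 2 \<le> j \<Longrightarrow> j \<le> i + int N - 2 \<Longrightarrow> monge (i, j) \<omega> = mo (relabel X n x \<omega>) i j"
  by (simp add: monge_def mo_def W_relabel)

lemma linear_W: "linear (\<lambda>\<omega>. W \<omega> i j)"
  by (rule linearI) (simp_all add: W_eq lookup_add algebra_simps)

lemma linear_monge: "linear (monge a)"
  unfolding monge_def split_def by (intro linear_compose_add linear_compose_sub linear_W)

lemma continuous_on_monge: "continuous_on A (monge a)"
proof -
  have "continuous_on A (\<lambda>\<omega>. W \<omega> i j)" for i j
    unfolding W_eq by (cases "seg N i j \<in> edges N") (auto intro!: continuous_intros continuous_on_lookup)
  then show ?thesis unfolding monge_def split_def by (intro continuous_intros)
qed

text \<open>A right inverse of \<open>relabel\<close> on vectors without edge coordinates, used to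
  lift points of the Monge cone to weights on cluster variables.\<close>

definition unlabel :: "lvec \<Rightarrow> 'f \<Rightarrow>\<^sub>0 real" where
  "unlabel \<tau> = (\<Sum>L\<in>diag_labels X n. Poly_Mapping.single (x L) (Poly_Mapping.lookup \<tau> L))"

lemma lookup_unlabel:
  assumes "L \<in> diag_labels X n"
  shows "Poly_Mapping.lookup (unlabel \<tau>) (x L) = Poly_Mapping.lookup \<tau> L"
proof -
  have "x L' = x L \<longleftrightarrow> L' = L" if "L' \<in> diag_labels X n" for L'
    using x_bij assms that unfolding bij_betw_def by (auto dest: inj_onD)
  then have "Poly_Mapping.lookup (unlabel \<tau>) (x L) =
      (\<Sum>L'\<in>diag_labels X n. if L' = L then Poly_Mapping.lookup \<tau> L else 0)"
    unfolding unlabel_def lookup_sum by (intro sum.cong) (auto simp: lookup_single when_def)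
  then show ?thesis using finite_diag_labels assms by simp
qed

lemma relabel_unlabel:
  assumes "Poly_Mapping.keys \<tau> \<subseteq> diag_labels X n"
  shows "relabel X n x (unlabel \<tau>) = \<tau>"
proof (rule poly_mapping_eqI)
  fix L
  show "Poly_Mapping.lookup (relabel X n x (unlabel \<tau>)) L = Poly_Mapping.lookup \<tau> L"
    using assms by (auto simp: lookup_relabel lookup_unlabel in_keys_iff)
qed

lemma keys_unlabel: "unlabel \<tau> \<in> {\<omega>. Poly_Mapping.keys \<omega> \<subseteq> V}"
proof -
  have "Poly_Mapping.single (x L) c \<in> {\<omega>. Poly_Mapping.keys \<omega> \<subseteq> V}" if "L \<in> diag_labels X n" for L c
    using that x_bij by (auto simp: bij_betw_def)
  then show ?thesis unfolding unlabel_def by (intro subspace_sum[OF subspace_keys])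
qed

text \<open>Taking the closure replaces strict Monge inequalities by weak ones as soon as they have
  a common strict solution.\<close>

lemma groebner_cone_weak:
  "groebner_cone \<iota> n S = {\<omega> \<in> {\<omega>. Poly_Mapping.keys \<omega> \<subseteq> V}.
     \<forall>a\<in>{(i, j). i + 2 \<le> j \<and> j \<le> i + int N - 2}. monge a \<omega> \<ge> 0}"
proof -
  let ?I = "{(i, j). i + 2 \<le> j \<and> j \<le> i + int N - 2}"
  \<comment> \<open>The sum of all \<open>v_tilde\<close> is an interior point: each Monge
    functional is nonnegative on every summand and positive on the summand attached to it.\<close>
  let ?\<tau> = "\<Sum>l\<in>nonmaximal N. v_tilde X n l"
  have keys: "?\<tau> \<in> {\<tau>. Poly_Mapping.keys \<tau> \<subseteq> diag_labels X n}"
    using v_tilde_keys by (intro subspace_sum[OF subspace_keys]) simp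
  have pos: "monge a (unlabel ?\<tau>) > 0" if a: "a \<in> ?I" for a
  proof -
    obtain i j where ij: "a = (i, j)" "i + 2 \<le> j" "j \<le> i + int N - 2" using a by blast
    obtain l where l: "l \<in> nonmaximal N" "\<forall>\<tau>. mo \<tau> i j = mn l \<tau>" using mo_eq_mn[OF ij(2,3)] .
    have "relabel X n x (unlabel ?\<tau>) = ?\<tau>" using keys by (intro relabel_unlabel) simp
    then have "monge a (unlabel ?\<tau>) = (\<Sum>l\<in>nonmaximal N. mo (v_tilde X n l) i j)"
      unfolding ij(1) monge_eq[OF ij(2,3)] mo_sum[symmetric] by simp
    also have "\<dots> > 0"
    proof (rule sum_pos2[OF finite_nonmaximal l(1)])
      show "mo (v_tilde X n l) i j > 0" unfolding l(2)[rule_format] by (rule mn_v_tilde_self[OF l(1)])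
      show "mo (v_tilde X n l') i j \<ge> 0" if "l' \<in> nonmaximal N" for l'
        by (rule mo_v_tilde_nonneg[OF that ij(2,3)])
    qed
    finally show ?thesis .
  qed
  have "{\<omega>. Poly_Mapping.keys \<omega> \<subseteq> V \<and> positive \<omega>} =
      {\<omega> \<in> {\<omega>. Poly_Mapping.keys \<omega> \<subseteq> V}. \<forall>a\<in>?I. monge a \<omega> > 0}"
    by (auto simp: positive_def monge_def algebra_simps)
  also have "closure \<dots> = {\<omega> \<in> {\<omega>. Poly_Mapping.keys \<omega> \<subseteq> V}. \<forall>a\<in>?I. monge a \<omega> \<ge> 0}"
    by (rule closure_strict[OF closed_keys subspace_keys continuous_on_monge linear_monge keys_unlabel pos])
  finally show ?thesis unfolding groebner_cone_eq .
qed

lemma relabel_groebner_cone: "relabel X n x ` groebner_cone \<iota> n S = monge_cone"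
proof (intro equalityI subsetI)
  fix \<tau> assume "\<tau> \<in> relabel X n x ` groebner_cone \<iota> n S"
  then obtain \<omega> where w: "\<omega> \<in> groebner_cone \<iota> n S" "\<tau> = relabel X n x \<omega>" by blast
  have "mo \<tau> i j \<ge> 0" if "i + 2 \<le> j" "j \<le> i + int N - 2" for i j
    unfolding w(2) monge_eq[OF that, symmetric] using w(1) that unfolding groebner_cone_weak by blast
  then show "\<tau> \<in> monge_cone" using keys_relabel unfolding monge_cone_def w(2) by simp
next
  fix \<tau> assume t: "\<tau> \<in> monge_cone"
  have eq: "relabel X n x (unlabel \<tau>) = \<tau>"
    using t by (intro relabel_unlabel) (simp add: monge_cone_def)
  have "monge (i, j) (unlabel \<tau>) \<ge> 0" if "i + 2 \<le> j" "j \<le> i + int N - 2" for i j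
    unfolding monge_eq[OF that] eq using t that by (simp add: monge_cone_def)
  then have "unlabel \<tau> \<in> groebner_cone \<iota> n S"
    unfolding groebner_cone_weak using keys_unlabel[of \<tau>] by auto
  then show "\<tau> \<in> relabel X n x ` groebner_cone \<iota> n S" using eq by (intro image_eqI[of _ _ "unlabel \<tau>"]) simp_all
qed

end

theorem theorem6p1p1:
  fixes \<iota> :: "'k::field_char_0 \<Rightarrow> 'f::field"
    and X :: dynkin
    and n :: nat
    and S :: "'f seed"
    and x :: "nat set set \<Rightarrow> 'f"
  assumes "even n" and "n > 0"
    and "field_embedding \<iota>"
    and "is_seed \<iota> n S"
    and "has_type X n S"
    and "polygon_model X n S x"
  shows "pointed (relabel X n x ` groebner_cone \<iota> n S) \<and>
         simplicial_cone_generated_by (relabel X n x ` groebner_cone \<iota> n S)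
           (v_tilde X n ` nonmaximal (polygon_size X n))"
proof -
  interpret polygon_cluster \<iota> X n S x
    using assms by unfold_locales
  show ?thesis unfolding relabel_groebner_cone by (rule monge_cone_simplicial)
qed

end
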